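(* Let $(M,P,g)$ be an almost para-hermitian manifold. Let $H=(J_1,J_2,J_3)$ be the almost para-hypercomplex structure on $TM$ defined by $$J_1X^h=X^v,\quad J_1X^v=-X^h,$$ $$J_2X^h=(PX)^v,\quad J_2X^v=(PX)^h,$$ $$J_3X^h=(PX)^h,\quad J_3X^v=-(PX)^v,$$ for all vector fields $X$ on $M$, where $X^h$ and $X^v$ are the horizontal and vertical lifts of $X$ to $TM$. Then $H$ is integrable if and only if $(M,P,g)$ is a flat para-K\"ahler manifold.
   Context: Manifolds and tensor fields are smooth. An almost product structure on a manifold $N$ is a $(1,1)$-tensor field $P\neq\pm \mathrm{Id}$ with $P^2=\mathrm{Id}$; an almost complex structure is a $(1,1)$-tensor field $J$ with $J^2=-\mathrm{Id}$. An almost para-hypercomplex structure on $N$ is a triple $H=(J_1,J_2,J_3)$ where $J_1$ is an almost complex structure, $J_2,J_3$ are almost product structures, and $J_2J_1=-J_1J_2=J_3$. It is integrable (and then called a para-hypercomplex structure) if for each $\alpha=1,2,3$ the Nijenhuis tensor $$N_\alpha(X,Y)=[J_\alpha X,J_\alpha Y]-J_\alpha[X,J_\alpha Y]-J_\alpha[J_\alpha X,Y]-\epsilon_\alpha[X,Y]$$ vanishes for all vector fields $X,Y$ on $N$, where $\epsilon_1=1$, $\epsilon_2=\epsilon_3=-1$. An almost para-hermitian manifold $(M,P,g)$ is a manifold $M$ with an almost product structure $P$ and a semi-Riemannian metric $g$ such that $g(PX,PY)=-g(X,Y)$ for all vector fields $X,Y$ on $M$. Let $\nabla$ be the Levi-Civita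 connection of $g$. $(M,P,g)$ is para-K\"ahler if $\nabla P=0$, and it is flat if the curvature tensor $R$ of $\nabla$ vanishes. Let $\pi:TM\to M$ be the natural projection and $K:T(TM)\to TM$ the connection map (Dombrowski) of $\nabla$. For a vector field $X$ on $M$, the horizontal lift $X^h$ and vertical lift $X^v$ are the unique vector fields on $TM$ such that for all $t\in TM$: $\pi_*X^h_t=X_{\pi(t)}$, $KX^h_t=0_{\pi(t)}$, $\pi_*X^v_t=0_{\pi(t)}$, $KX^v_t=X_{\pi(t)}$. *)

theory Defs
  imports "HOL-Analysis.Analysis" "HOL-Library.Function_Algebras"
begin

section \<open>Smooth maps between Euclidean spaces\<close>

text \<open>Iterated directional derivatives. On open subsets of a finite-dimensional space, which is
  the only way this is used below, this is the usual notion of a map of class C^k.\<close>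

primrec Ck_on ::
  "nat \<Rightarrow> 'a::real_normed_vector set \<Rightarrow> ('a \<Rightarrow> 'b::real_normed_vector) \<Rightarrow> bool" where
  "Ck_on 0 S f \<longleftrightarrow> continuous_on S f"
| "Ck_on (Suc k) S f \<longleftrightarrow>
     (\<forall>x\<in>S. f differentiable (at x)) \<and> (\<forall>v. Ck_on k S (\<lambda>x. frechet_derivative f (at x) v))"

definition smooth_on ::
  "'a::real_normed_vector set \<Rightarrow> ('a \<Rightarrow> 'b::real_normed_vector) \<Rightarrow> bool" where
  "smooth_on S f \<longleftrightarrow> (\<forall>k. Ck_on k S f)"


section \<open>Smooth manifolds\<close>

text \<open>A chart is a domain together with a coordinate map (whose values outside the domain are
  irrelevant). A manifold is given by an atlas, not necessarily maximal; the carrier and its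
  topology are those determined by the atlas. The model space is a Euclidean space of positive
  dimension; a 0-dimensional manifold carries no almost product structure in any case.\<close>

type_synonym ('m, 'e) chart = "'m set \<times> ('m \<Rightarrow> 'e)"
type_synonym ('m, 'e) atlas = "('m, 'e) chart set"

definition carrier :: "('m, 'e) atlas \<Rightarrow> 'm set" where
  "carrier A = (\<Union>c\<in>A. fst c)"

abbreviation chart_image :: "('m, 'e) chart \<Rightarrow> 'e set" where
  "chart_image c \<equiv> snd c ` fst c"

definition inv_chart :: "('m, 'e) chart \<Rightarrow> 'e \<Rightarrow> 'm" where
  "inv_chart c = inv_into (fst c) (snd c)"

definition manifold_topology :: "('m, 'e::topological_space) atlas \<Rightarrow> 'm topology" where
  "manifold_topology A = topology_generated_by {fst c \<inter> snd c -` W |c W. c \<in> A \<and> open W}"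

definition smooth_manifold :: "('m, 'e::euclidean_space) atlas \<Rightarrow> bool" where
  "smooth_manifold A \<longleftrightarrow>
     (\<forall>c\<in>A. inj_on (snd c) (fst c) \<and> open (chart_image c)) \<and>
     (\<forall>c\<in>A. \<forall>d\<in>A. open (snd c ` (fst c \<inter> fst d)) \<and>
        smooth_on (snd c ` (fst c \<inter> fst d)) (snd d \<circ> inv_chart c)) \<and>
     Hausdorff_space (manifold_topology A) \<and>
     second_countable (manifold_topology A)"

definition chart_at :: "('m, 'e) atlas \<Rightarrow> 'm \<Rightarrow> ('m, 'e) chart" where
  "chart_at A p = (SOME c. c \<in> A \<and> p \<in> fst c)"

definition smooth_function :: "('m, 'e::euclidean_space) atlas \<Rightarrow> ('m \<Rightarrow> real) \<Rightarrow> bool" where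
  "smooth_function A f \<longleftrightarrow> (\<forall>c\<in>A. smooth_on (chart_image c) (f \<circ> inv_chart c))"


section \<open>Tangent vectors and vector fields\<close>

text \<open>A tangent vector at \<open>p\<close> assigns to every chart around \<open>p\<close> its components in that chart,
  subject to the usual transformation law. The components in all other charts are set to zero;
  in particular \<open>tangent_space A p = {0}\<close> if \<open>p\<close> is not in the carrier, so that the conditions below
  which range over all \<open>p\<close> only fix values outside the carrier to be zero.\<close>

type_synonym ('m, 'e) tvector = "('m, 'e) chart \<Rightarrow> 'e"
type_synonym ('m, 'e) vfield = "'m \<Rightarrow> ('m, 'e) tvector"

definition tangent_space ::
  "('m, 'e::euclidean_space) atlas \<Rightarrow> 'm \<Rightarrow> ('m, 'e) tvector set" where
  "tangent_space A p =
     {v. (\<forall>c\<in>A. \<forall>d\<in>A. p \<in> fst c \<longrightarrow> p \<in> fst d \<longrightarrow>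
            v d = frechet_derivative (snd d \<circ> inv_chart c) (at (snd c p)) (v c)) \<and>
         (\<forall>c. \<not> (c \<in> A \<and> p \<in> fst c) \<longrightarrow> v c = 0)}"

text \<open>The tangent vector at \<open>p\<close> with components \<open>e\<close> in the chart \<open>c\<close>.\<close>

definition chart_vector ::
  "('m, 'e::euclidean_space) atlas \<Rightarrow> ('m, 'e) chart \<Rightarrow> 'm \<Rightarrow> 'e \<Rightarrow> ('m, 'e) tvector" where
  "chart_vector A c p e =
     (\<lambda>d. if d \<in> A \<and> p \<in> fst d
          then frechet_derivative (snd d \<circ> inv_chart c) (at (snd c p)) e else 0)"

definition vector_field :: "('m, 'e::euclidean_space) atlas \<Rightarrow> ('m, 'e) vfield \<Rightarrow> bool" where
  "vector_field A X \<longleftrightarrow>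
     (\<forall>p. X p \<in> tangent_space A p) \<and>
     (\<forall>c\<in>A. smooth_on (chart_image c) (\<lambda>x. X (inv_chart c x) c))"

text \<open>The differential of \<open>F\<close> at \<open>p\<close>, and the derivative of a function along a vector field.\<close>

definition pushforward ::
  "('m, 'e::euclidean_space) atlas \<Rightarrow> ('n, 'f::euclidean_space) atlas \<Rightarrow> ('m \<Rightarrow> 'n) \<Rightarrow>
   'm \<Rightarrow> ('m, 'e) tvector \<Rightarrow> ('n, 'f) tvector" where
  "pushforward A B F p v =
     (\<lambda>d. if d \<in> B \<and> F p \<in> fst d
          then frechet_derivative (snd d \<circ> F \<circ> inv_chart (chart_at A p))
                 (at (snd (chart_at A p) p)) (v (chart_at A p))
          else 0)"

definition field_derivative ::
  "('m, 'e::euclidean_space) atlas \<Rightarrow> ('m, 'e) vfield \<Rightarrow> ('m \<Rightarrow> real) \<Rightarrow> 'm \<Rightarrow> real" where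
  "field_derivative A X f p =
     frechet_derivative (f \<circ> inv_chart (chart_at A p))
       (at (snd (chart_at A p) p)) (X p (chart_at A p))"

definition field_scale :: "('m \<Rightarrow> real) \<Rightarrow> ('m, 'e::real_vector) vfield \<Rightarrow> ('m, 'e) vfield" where
  "field_scale f X = (\<lambda>p c. f p *\<^sub>R X p c)"

text \<open>The Lie bracket by its coordinate expression: in every chart, the components of
  \<open>[X, Y]\<close> are the derivative of those of \<open>Y\<close> along \<open>X\<close> minus that of those of \<open>X\<close> along \<open>Y\<close>.\<close>

definition lie_bracket ::
  "('m, 'e::euclidean_space) atlas \<Rightarrow> ('m, 'e) vfield \<Rightarrow> ('m, 'e) vfield \<Rightarrow> ('m, 'e) vfield" where
  "lie_bracket A X Y =
     (\<lambda>p c. if c \<in> A \<and> p \<in> fst c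
            then frechet_derivative (\<lambda>x. Y (inv_chart c x) c) (at (snd c p)) (X p c)
               - frechet_derivative (\<lambda>x. X (inv_chart c x) c) (at (snd c p)) (Y p c)
            else 0)"


section \<open>Tensor fields of type (1,1)\<close>

definition linear_between ::
  "('c \<Rightarrow> 'e::real_vector) set \<Rightarrow> ('d \<Rightarrow> 'f::real_vector) set \<Rightarrow>
   (('c \<Rightarrow> 'e) \<Rightarrow> 'd \<Rightarrow> 'f) \<Rightarrow> bool" where
  "linear_between V W L \<longleftrightarrow>
     (\<forall>v\<in>V. L v \<in> W) \<and>
     (\<forall>v\<in>V. \<forall>w\<in>V. L (v + w) = L v + L w) \<and>
     (\<forall>r. \<forall>v\<in>V. L (\<lambda>c. r *\<^sub>R v c) = (\<lambda>d. r *\<^sub>R L v d))"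

type_synonym ('m, 'e) endo = "'m \<Rightarrow> ('m, 'e) tvector \<Rightarrow> ('m, 'e) tvector"

definition endo_field :: "('m, 'e::euclidean_space) atlas \<Rightarrow> ('m, 'e) endo \<Rightarrow> bool" where
  "endo_field A J \<longleftrightarrow>
     (\<forall>p. linear_between (tangent_space A p) (tangent_space A p) (J p)) \<and>
     (\<forall>c\<in>A. \<forall>e. smooth_on (chart_image c)
        (\<lambda>x. J (inv_chart c x) (chart_vector A c (inv_chart c x) e) c))"

definition endo_apply :: "('m, 'e) endo \<Rightarrow> ('m, 'e) vfield \<Rightarrow> ('m, 'e) vfield" where
  "endo_apply J X = (\<lambda>p. J p (X p))"

definition almost_complex :: "('m, 'e::euclidean_space) atlas \<Rightarrow> ('m, 'e) endo \<Rightarrow> bool" where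
  "almost_complex A J \<longleftrightarrow>
     endo_field A J \<and> (\<forall>p\<in>carrier A. \<forall>v\<in>tangent_space A p. J p (J p v) = - v)"

definition almost_product :: "('m, 'e::euclidean_space) atlas \<Rightarrow> ('m, 'e) endo \<Rightarrow> bool" where
  "almost_product A P \<longleftrightarrow>
     endo_field A P \<and>
     (\<forall>p\<in>carrier A. \<forall>v\<in>tangent_space A p. P p (P p v) = v) \<and>
     \<not> (\<forall>p\<in>carrier A. \<forall>v\<in>tangent_space A p. P p v = v) \<and>
     \<not> (\<forall>p\<in>carrier A. \<forall>v\<in>tangent_space A p. P p v = - v)"

definition almost_para_hypercomplex ::
  "('m, 'e::euclidean_space) atlas \<Rightarrow> ('m, 'e) endo \<times> ('m, 'e) endo \<times> ('m, 'e) endo \<Rightarrow> bool" where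
  "almost_para_hypercomplex A = (\<lambda>(J1, J2, J3).
     almost_complex A J1 \<and> almost_product A J2 \<and> almost_product A J3 \<and>
     (\<forall>p\<in>carrier A. \<forall>v\<in>tangent_space A p.
        J2 p (J1 p v) = - J1 p (J2 p v) \<and> J2 p (J1 p v) = J3 p v))"

definition nijenhuis ::
  "('m, 'e::euclidean_space) atlas \<Rightarrow> real \<Rightarrow> ('m, 'e) endo \<Rightarrow>
   ('m, 'e) vfield \<Rightarrow> ('m, 'e) vfield \<Rightarrow> ('m, 'e) vfield" where
  "nijenhuis A \<epsilon> J X Y =
     lie_bracket A (endo_apply J X) (endo_apply J Y)
     - endo_apply J (lie_bracket A X (endo_apply J Y))
     - endo_apply J (lie_bracket A (endo_apply J X) Y)
     - field_scale (\<lambda>_. \<epsilon>) (lie_bracket A X Y)"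

definition integrable_triple ::
  "('m, 'e::euclidean_space) atlas \<Rightarrow> ('m, 'e) endo \<times> ('m, 'e) endo \<times> ('m, 'e) endo \<Rightarrow> bool" where
  "integrable_triple A = (\<lambda>(J1, J2, J3).
     \<forall>X Y. vector_field A X \<longrightarrow> vector_field A Y \<longrightarrow>
       nijenhuis A 1 J1 X Y = 0 \<and> nijenhuis A (- 1) J2 X Y = 0 \<and> nijenhuis A (- 1) J3 X Y = 0)"


section \<open>Semi-Riemannian metrics and almost para-hermitian manifolds\<close>

type_synonym ('m, 'e) bilinear_field = "'m \<Rightarrow> ('m, 'e) tvector \<Rightarrow> ('m, 'e) tvector \<Rightarrow> real"

definition metric_index ::
  "('m, 'e::euclidean_space) atlas \<Rightarrow> ('m, 'e) bilinear_field \<Rightarrow> 'm \<Rightarrow> nat" where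
  "metric_index A g p = Max {dim S |S. subspace S \<and>
     (\<forall>e\<in>S. e \<noteq> 0 \<longrightarrow>
        g p (chart_vector A (chart_at A p) p e) (chart_vector A (chart_at A p) p e) < 0)}"

definition semi_riemannian_metric ::
  "('m, 'e::euclidean_space) atlas \<Rightarrow> ('m, 'e) bilinear_field \<Rightarrow> bool" where
  "semi_riemannian_metric A g \<longleftrightarrow>
     (\<forall>p\<in>carrier A. \<forall>u\<in>tangent_space A p. \<forall>v\<in>tangent_space A p.
        g p u v = g p v u \<and>
        (\<forall>w\<in>tangent_space A p. g p (u + w) v = g p u v + g p w v) \<and>
        (\<forall>r. g p (\<lambda>c. r *\<^sub>R u c) v = r * g p u v)) \<and>
     (\<forall>p\<in>carrier A. \<forall>u\<in>tangent_space A p.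
        (\<forall>v\<in>tangent_space A p. g p u v = 0) \<longrightarrow> u = 0) \<and>
     (\<forall>c\<in>A. \<forall>e e'. smooth_on (chart_image c)
        (\<lambda>x. g (inv_chart c x) (chart_vector A c (inv_chart c x) e)
                                (chart_vector A c (inv_chart c x) e'))) \<and>
     (\<exists>k. \<forall>p\<in>carrier A. metric_index A g p = k)"

definition almost_para_hermitian ::
  "('m, 'e::euclidean_space) atlas \<Rightarrow> ('m, 'e) endo \<Rightarrow> ('m, 'e) bilinear_field \<Rightarrow> bool" where
  "almost_para_hermitian A P g \<longleftrightarrow>
     smooth_manifold A \<and> almost_product A P \<and> semi_riemannian_metric A g \<and>
     (\<forall>X Y. vector_field A X \<longrightarrow> vector_field A Y \<longrightarrow>
        (\<forall>p\<in>carrier A. g p (endo_apply P X p) (endo_apply P Y p) = - g p (X p) (Y p)))"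


section \<open>The Levi-Civita connection\<close>

text \<open>Only the values of \<open>D\<close> on vector fields are meaningful.\<close>

type_synonym ('m, 'e) connection = "('m, 'e) vfield \<Rightarrow> ('m, 'e) vfield \<Rightarrow> ('m, 'e) vfield"

definition affine_connection ::
  "('m, 'e::euclidean_space) atlas \<Rightarrow> ('m, 'e) connection \<Rightarrow> bool" where
  "affine_connection A D \<longleftrightarrow>
     (\<forall>X Y. vector_field A X \<longrightarrow> vector_field A Y \<longrightarrow> vector_field A (D X Y)) \<and>
     (\<forall>X Y Z. vector_field A X \<longrightarrow> vector_field A Y \<longrightarrow> vector_field A Z \<longrightarrow>
        D (X + Y) Z = D X Z + D Y Z \<and> D X (Y + Z) = D X Y + D X Z) \<and>
     (\<forall>f X Y. smooth_function A f \<longrightarrow> vector_field A X \<longrightarrow> vector_field A Y \<longrightarrow>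
        D (field_scale f X) Y = field_scale f (D X Y) \<and>
        D X (field_scale f Y) =
          field_scale (field_derivative A X f) Y + field_scale f (D X Y))"

definition levi_civita ::
  "('m, 'e::euclidean_space) atlas \<Rightarrow> ('m, 'e) bilinear_field \<Rightarrow> ('m, 'e) connection \<Rightarrow> bool" where
  "levi_civita A g D \<longleftrightarrow>
     affine_connection A D \<and>
     (\<forall>X Y. vector_field A X \<longrightarrow> vector_field A Y \<longrightarrow>
        D X Y - D Y X = lie_bracket A X Y) \<and>
     (\<forall>X Y Z. vector_field A X \<longrightarrow> vector_field A Y \<longrightarrow> vector_field A Z \<longrightarrow>
        (\<forall>p\<in>carrier A. field_derivative A X (\<lambda>q. g q (Y q) (Z q)) p
           = g p (D X Y p) (Z p) + g p (Y p) (D X Z p)))"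

definition curvature ::
  "('m, 'e::euclidean_space) atlas \<Rightarrow> ('m, 'e) connection \<Rightarrow>
   ('m, 'e) vfield \<Rightarrow> ('m, 'e) vfield \<Rightarrow> ('m, 'e) vfield \<Rightarrow> ('m, 'e) vfield" where
  "curvature A D X Y Z = D X (D Y Z) - D Y (D X Z) - D (lie_bracket A X Y) Z"

definition flat :: "('m, 'e::euclidean_space) atlas \<Rightarrow> ('m, 'e) connection \<Rightarrow> bool" where
  "flat A D \<longleftrightarrow>
     (\<forall>X Y Z. vector_field A X \<longrightarrow> vector_field A Y \<longrightarrow> vector_field A Z \<longrightarrow>
        curvature A D X Y Z = 0)"

text \<open>\<open>P\<close> is parallel: the covariant derivative \<open>(D\<^sub>X P) Y = D\<^sub>X (P Y) - P (D\<^sub>X Y)\<close> vanishes.\<close>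

definition parallel_endo ::
  "('m, 'e::euclidean_space) atlas \<Rightarrow> ('m, 'e) connection \<Rightarrow> ('m, 'e) endo \<Rightarrow> bool" where
  "parallel_endo A D P \<longleftrightarrow>
     (\<forall>X Y. vector_field A X \<longrightarrow> vector_field A Y \<longrightarrow>
        D X (endo_apply P Y) - endo_apply P (D X Y) = 0)"

definition para_kahler ::
  "('m, 'e::euclidean_space) atlas \<Rightarrow> ('m, 'e) endo \<Rightarrow> ('m, 'e) bilinear_field \<Rightarrow>
   ('m, 'e) connection \<Rightarrow> bool" where
  "para_kahler A P g D \<longleftrightarrow>
     almost_para_hermitian A P g \<and> levi_civita A g D \<and> parallel_endo A D P"


section \<open>The tangent bundle, the connection map, and lifts\<close>

text \<open>Points of \<open>TM\<close> are pairs \<open>(p, v)\<close> with \<open>v\<close> in the tangent space at \<open>p\<close>; the projection is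
  \<open>fst\<close>. The manifold structure is given by the charts \<open>(p, v) \<mapsto> (x(p), components of v)\<close>.\<close>

type_synonym ('m, 'e) tpoint = "'m \<times> ('m, 'e) tvector"

definition tangent_chart ::
  "('m, 'e::euclidean_space) atlas \<Rightarrow> ('m, 'e) chart \<Rightarrow> (('m, 'e) tpoint, 'e \<times> 'e) chart" where
  "tangent_chart A c =
     ({(p, v). p \<in> fst c \<and> v \<in> tangent_space A p}, (\<lambda>(p, v). (snd c p, v c)))"

definition tangent_bundle ::
  "('m, 'e::euclidean_space) atlas \<Rightarrow> (('m, 'e) tpoint, 'e \<times> 'e) atlas" where
  "tangent_bundle A = tangent_chart A ` A"

text \<open>Dombrowski's connection map: the fibrewise linear map \<open>T(TM) \<rightarrow> TM\<close> over the projection that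
  sends \<open>Y\<^sub>* X\<^sub>p\<close> to \<open>(D\<^sub>X Y)\<^sub>p\<close>, where the vector field \<open>Y\<close> is regarded as a map \<open>M \<rightarrow> TM\<close>.
  The vectors \<open>Y\<^sub>* X\<^sub>p\<close> with \<open>Y\<^sub>p = t\<close> span the tangent space of \<open>TM\<close> at \<open>t\<close>, so these conditions
  determine \<open>K\<close> on \<open>T(TM)\<close>.\<close>

type_synonym ('m, 'e) connector =
  "('m, 'e) tpoint \<Rightarrow> (('m, 'e) tpoint, 'e \<times> 'e) tvector \<Rightarrow> ('m, 'e) tvector"

definition connection_map ::
  "('m, 'e::euclidean_space) atlas \<Rightarrow> ('m, 'e) connection \<Rightarrow> ('m, 'e) connector \<Rightarrow> bool" where
  "connection_map A D K \<longleftrightarrow>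
     (\<forall>t\<in>carrier (tangent_bundle A).
        linear_between (tangent_space (tangent_bundle A) t) (tangent_space A (fst t)) (K t)) \<and>
     (\<forall>X Y. vector_field A X \<longrightarrow> vector_field A Y \<longrightarrow>
        (\<forall>p\<in>carrier A.
           K (p, Y p) (pushforward A (tangent_bundle A) (\<lambda>q. (q, Y q)) p (X p)) = D X Y p))"

definition horizontal_lift ::
  "('m, 'e::euclidean_space) atlas \<Rightarrow> ('m, 'e) connector \<Rightarrow> ('m, 'e) vfield \<Rightarrow>
   (('m, 'e) tpoint, 'e \<times> 'e) vfield" where
  "horizontal_lift A K X = (THE Z. vector_field (tangent_bundle A) Z \<and>
     (\<forall>t\<in>carrier (tangent_bundle A).
        pushforward (tangent_bundle A) A fst t (Z t) = X (fst t) \<and> K t (Z t) = 0))"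

definition vertical_lift ::
  "('m, 'e::euclidean_space) atlas \<Rightarrow> ('m, 'e) connector \<Rightarrow> ('m, 'e) vfield \<Rightarrow>
   (('m, 'e) tpoint, 'e \<times> 'e) vfield" where
  "vertical_lift A K X = (THE Z. vector_field (tangent_bundle A) Z \<and>
     (\<forall>t\<in>carrier (tangent_bundle A).
        pushforward (tangent_bundle A) A fst t (Z t) = 0 \<and> K t (Z t) = X (fst t)))"

end

theory Submission
  imports Defs
begin

text \<open>
  The idea is to reduce everything on the tangent bundle to vector fields on the base. At a point
  \<open>(p, w)\<close> of the bundle a tangent vector is the same thing as a pair \<open>(a, k)\<close> of tangent vectors
  at \<open>p\<close>: its horizontal part \<open>a\<close>, the image under the differential of the projection, and its vertical
  part \<open>k\<close>, the image under the connection map. In these terms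
  \<open>J\<^sub>1 (a, k) = (- k, a)\<close>, \<open>J\<^sub>2 (a, k) = (P k, P a)\<close> and \<open>J\<^sub>3 (a, k) = (P a, - P k)\<close>, which gives the
  algebraic identities of an almost para-hypercomplex structure. For vector fields \<open>X\<^sub>i, Y\<^sub>i\<close> on
  the base, the fields \<open>(X\<^sub>i, Y\<^sub>i)\<close> on the bundle have at \<open>(p, w)\<close> the bracket
  \<open>([X\<^sub>1, X\<^sub>2], D\<^bsub>X\<^sub>1\<^esub> Y\<^sub>2 - D\<^bsub>X\<^sub>2\<^esub> Y\<^sub>1 - R(X\<^sub>1, X\<^sub>2) w)\<close> (lemma \<open>lie_bracket_lift_field\<close>). This single
  formula contains the classical ones for brackets of horizontal and vertical lifts.

  If the triple is integrable, evaluate the Nijenhuis tensors on horizontal lifts. The one of \<open>J\<^sub>1\<close> is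
  \<open>(0, R(X, Y) w)\<close>, so \<open>R = 0\<close>. The horizontal part of the one of \<open>J\<^sub>2\<close> vanishes exactly when
  \<open>(D\<^sub>X P) Y\<close> is symmetric in \<open>X\<close> and \<open>Y\<close>. On the other hand \<open>g((D\<^sub>X P) Y, Z)\<close> is skew in \<open>Y\<close> and \<open>Z\<close>,
  because \<open>g(P Y, Z)\<close> is and the metric is parallel. A trilinear form that is symmetric in
  its first two and skew in its last two arguments is zero, so \<open>P\<close> is parallel.

  Conversely, the Nijenhuis tensor is a tensor: its value at a point depends only on the values of its
  arguments there (lemma \<open>nijenhuis_pointwise\<close>). Every tangent vector of the bundle is the value of some
  \<open>(X, Y)\<close>, and on such fields all three tensors vanish by the bracket formula if \<open>R = 0\<close> and
  \<open>D P = 0\<close>.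

  Both directions use coordinates. A connection, given as an operator on global vector fields, acts in a
  chart by Christoffel symbols (lemma \<open>connection_in_chart\<close>); this rests on bump functions, which make
  local data global. The connection map then sends a vector with components \<open>(a, b)\<close> at a point
  with components \<open>(x, w)\<close> to \<open>b + \<Gamma>\<^sub>x(a, w)\<close> (lemma \<open>connector_in_chart\<close>). Symmetry of second
  derivatives makes the bracket of two vector fields a vector field and the curvature a tensor.
\<close>

section \<open>Calculus of smooth maps\<close>

lemma frechet_derivative_cong_open:
  assumes "open S" "x \<in> S" "\<And>y. y \<in> S \<Longrightarrow> f y = g y"
  shows "frechet_derivative f (at x) = frechet_derivative g (at x)"
proof -
  have "(f has_derivative D) (at x) \<longleftrightarrow> (g has_derivative D) (at x)" for D
    using assms has_derivative_transform_within_open[of f D x UNIV S g]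
      has_derivative_transform_within_open[of g D x UNIV S f] by auto
  then show ?thesis by (simp add: frechet_derivative_def)
qed

lemma Ck_on_cong:
  assumes "open S" "\<And>y. y \<in> S \<Longrightarrow> f y = g y"
  shows "Ck_on k S f \<longleftrightarrow> Ck_on k S g"
  using assms(2)
proof (induction k arbitrary: f g)
  case 0
  then show ?case by (simp cong: continuous_on_cong)
next
  case (Suc k)
  have d: "f differentiable (at x) \<longleftrightarrow> g differentiable (at x)" if "x \<in> S" for x
    using Suc.prems that assms(1) has_derivative_transform_within_open[of f _ x UNIV S g]
      has_derivative_transform_within_open[of g _ x UNIV S f] 
    unfolding differentiable_def by metis
  have "Ck_on k S (\<lambda>x. frechet_derivative f (at x) v) \<longleftrightarrow>
        Ck_on k S (\<lambda>x. frechet_derivative g (at x) v)" for v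
    by (rule Suc.IH) (metis Suc.prems assms(1) frechet_derivative_cong_open)
  with d show ?case by simp
qed

lemma Ck_on_subset: "Ck_on k S f \<Longrightarrow> T \<subseteq> S \<Longrightarrow> Ck_on k T f"
  by (induction k arbitrary: f) (auto intro: continuous_on_subset)

lemma Ck_on_SucD: "Ck_on (Suc k) S f \<Longrightarrow> Ck_on k S f"
proof (induction k arbitrary: f)
  case 0
  then show ?case
    by (auto intro!: continuous_at_imp_continuous_on differentiable_imp_continuous_within)
qed simp

lemma Ck_on_local:
  assumes "\<And>x. x \<in> S \<Longrightarrow> \<exists>T. open T \<and> x \<in> T \<and> Ck_on k T f"
  shows "Ck_on k S f"
  using assms
proof (induction k arbitrary: f)
  case 0
  then show ?case
    by (auto intro!: continuous_at_imp_continuous_on simp: continuous_on_eq_continuous_at)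
      (metis continuous_on_eq_continuous_at)
next
  case (Suc k)
  show ?case
    unfolding Ck_on.simps
  proof (intro conjI ballI allI)
    show "f differentiable (at x)" if "x \<in> S" for x
      using Suc.prems[OF that] by auto
    show "Ck_on k S (\<lambda>x. frechet_derivative f (at x) v)" for v
      by (rule Suc.IH) (use Suc.prems in fastforce)
  qed
qed

text \<open>The derivative may be given by any formula. In the inductive proofs below this turns the step into the
  claim that the expression obtained from the product or chain rule is again smooth to one order less.\<close>

lemma Ck_on_SucI:
  assumes "open S" "\<And>x. x \<in> S \<Longrightarrow> (f has_derivative f' x) (at x)" "\<And>v. Ck_on k S (\<lambda>x. f' x v)"
  shows "Ck_on (Suc k) S f"
  unfolding Ck_on.simps
proof (intro conjI ballI allI)
  show "f differentiable (at x)" if "x \<in> S" for x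
    using assms(2)[OF that] by (auto simp: differentiable_def)
  show "Ck_on k S (\<lambda>x. frechet_derivative f (at x) v)" for v
  proof (rule Ck_on_cong[OF assms(1), THEN iffD1, OF _ assms(3)])
    show "f' y v = frechet_derivative f (at y) v" if "y \<in> S" for y
      using frechet_derivative_at[OF assms(2)[OF that]] by simp
  qed
qed

lemma Ck_on_has_derivative:
  "Ck_on (Suc k) S f \<Longrightarrow> x \<in> S \<Longrightarrow> (f has_derivative frechet_derivative f (at x)) (at x)"
  by (simp add: frechet_derivative_works)

lemma Ck_on_const: "open S \<Longrightarrow> Ck_on k S (\<lambda>x. c)"
proof (induction k arbitrary: c)
  case (Suc k)
  show ?case by (rule Ck_on_SucI[where f'="\<lambda>_ _. 0"]) (use Suc in auto)
qed simp

lemma Ck_on_bounded_linear: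
  assumes "open S" "bounded_linear L" shows "Ck_on k S L"
proof (cases k)
  case 0
  then show ?thesis
    using assms(2) linear_continuous_on by auto
next
  case (Suc n)
  show ?thesis unfolding Suc
    by (rule Ck_on_SucI[where f'="\<lambda>_. L"])
      (simp_all add: assms Ck_on_const bounded_linear_imp_has_derivative)
qed

lemma Ck_on_add:
  assumes "open S" "Ck_on k S f" "Ck_on k S g" shows "Ck_on k S (\<lambda>x. f x + g x)"
  using assms(2,3)
proof (induction k arbitrary: f g)
  case 0
  then show ?case by (simp add: continuous_on_add)
next
  case (Suc k)
  show ?case
    by (rule Ck_on_SucI[OF assms(1), where f'="\<lambda>x v. frechet_derivative f (at x) v + frechet_derivative g (at x) v"])
      (use Suc in \<open>simp_all add: has_derivative_add frechet_derivative_works[symmetric]\<close>)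
qed

lemma Ck_on_bounded_bilinear:
  assumes "bounded_bilinear B" "open S" "Ck_on k S f" "Ck_on k S g"
  shows "Ck_on k S (\<lambda>x. B (f x) (g x))"
  using assms(3,4)
proof (induction k arbitrary: f g)
  case 0
  then show ?case by (simp add: bounded_bilinear.continuous_on[OF assms(1)])
next
  case (Suc k)
  show ?case
  proof (rule Ck_on_SucI[OF assms(2), where f'="\<lambda>x v. B (f x) (frechet_derivative g (at x) v) + B (frechet_derivative f (at x) v) (g x)"])
    show "((\<lambda>x. B (f x) (g x)) has_derivative
        (\<lambda>v. B (f x) (frechet_derivative g (at x) v) + B (frechet_derivative f (at x) v) (g x))) (at x)"
      if "x \<in> S" for x
      by (intro bounded_bilinear.FDERIV[OF assms(1)] Ck_on_has_derivative[OF Suc.prems(1) that]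
        Ck_on_has_derivative[OF Suc.prems(2) that])
    show "Ck_on k S (\<lambda>x. B (f x) (frechet_derivative g (at x) v) + B (frechet_derivative f (at x) v) (g x))" for v
      by (rule Ck_on_add[OF assms(2)]; rule Suc.IH)
        (use Suc.prems[THEN Ck_on_SucD] Suc.prems in simp_all)
  qed
qed

lemma Ck_on_sum:
  "open S \<Longrightarrow> (\<And>i. i \<in> I \<Longrightarrow> Ck_on k S (f i)) \<Longrightarrow> Ck_on k S (\<lambda>x. \<Sum>i\<in>I. f i x)"
  by (induction I rule: infinite_finite_induct) (auto intro: Ck_on_const Ck_on_add)

lemma linear_Basis_expand:
  fixes L :: "'b::euclidean_space \<Rightarrow> 'c::real_vector"
  assumes "linear L" shows "L v = (\<Sum>i\<in>Basis. (v \<bullet> i) *\<^sub>R L i)"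
proof -
  have "L v = L (\<Sum>i\<in>Basis. (v \<bullet> i) *\<^sub>R i)" by (simp add: euclidean_representation)
  then show ?thesis by (simp add: linear_sum[OF assms] linear_cmul[OF assms])
qed

text \<open>Expanded in the standard basis, the chain rule writes the derivative of \<open>g \<circ> f\<close> as a sum of
  products of a component of the derivative of \<open>f\<close> with a partial derivative of \<open>g\<close>, composed with \<open>f\<close>;
  the induction hypothesis applies to the latter.\<close>

lemma Ck_on_compose:
  fixes f :: "'a::real_normed_vector \<Rightarrow> 'b::euclidean_space" and g :: "'b \<Rightarrow> 'c::real_normed_vector"
  assumes "open S" "open T" "f ` S \<subseteq> T" "Ck_on k S f" "Ck_on k T g"
  shows "Ck_on k S (\<lambda>x. g (f x))"
  using assms(4,5)
proof (induction k arbitrary: g)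
  case 0
  then show ?case using assms(3) continuous_on_compose2 by auto
next
  case (Suc k)
  show ?case
  proof (rule Ck_on_SucI[OF assms(1),
      where f'="\<lambda>x v. \<Sum>i\<in>Basis. (frechet_derivative f (at x) v \<bullet> i) *\<^sub>R frechet_derivative g (at (f x)) i"])
    fix x assume x: "x \<in> S"
    have df: "(f has_derivative frechet_derivative f (at x)) (at x)"
      using Suc.prems x by (blast intro: Ck_on_has_derivative)
    have dg: "(g has_derivative frechet_derivative g (at (f x))) (at (f x))"
      using Suc.prems x assms(3) by (blast intro: Ck_on_has_derivative)
    show "((\<lambda>x. g (f x)) has_derivative
          (\<lambda>v. \<Sum>i\<in>Basis. (frechet_derivative f (at x) v \<bullet> i) *\<^sub>R frechet_derivative g (at (f x)) i)) (at x)"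
      using has_derivative_compose[OF df dg]
      by (subst (asm) linear_Basis_expand[OF has_derivative_linear[OF dg]])
  next
    fix v
    have "Ck_on k S (\<lambda>x. frechet_derivative f (at x) v \<bullet> i)" for i
      using Suc.prems by (intro Ck_on_bounded_bilinear[OF bounded_bilinear_inner assms(1)] Ck_on_const assms(1)) auto
    moreover have "Ck_on k S (\<lambda>x. frechet_derivative g (at (f x)) i)" for i
      by (rule Suc.IH) (use Suc.prems(1)[THEN Ck_on_SucD] Suc.prems(2) in simp_all)
    ultimately show "Ck_on k S (\<lambda>x. \<Sum>i\<in>Basis. (frechet_derivative f (at x) v \<bullet> i) *\<^sub>R frechet_derivative g (at (f x)) i)"
      by (intro Ck_on_sum assms(1) Ck_on_bounded_bilinear[OF bounded_bilinear_scaleR])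
  qed
qed

lemma smooth_on_cong:
  "open S \<Longrightarrow> (\<And>y. y \<in> S \<Longrightarrow> f y = g y) \<Longrightarrow> smooth_on S f \<longleftrightarrow> smooth_on S g"
  unfolding smooth_on_def by (simp add: Ck_on_cong[of S f g])

lemma smooth_on_subset: "smooth_on S f \<Longrightarrow> T \<subseteq> S \<Longrightarrow> smooth_on T f"
  unfolding smooth_on_def using Ck_on_subset[of _ S f T] by simp

lemma smooth_on_local:
  "(\<And>x. x \<in> S \<Longrightarrow> \<exists>T. open T \<and> x \<in> T \<and> smooth_on T f) \<Longrightarrow> smooth_on S f"
  unfolding smooth_on_def by (intro allI Ck_on_local) metis

lemma smooth_on_has_derivative:
  "smooth_on S f \<Longrightarrow> x \<in> S \<Longrightarrow> (f has_derivative frechet_derivative f (at x)) (at x)"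
  unfolding smooth_on_def by (rule Ck_on_has_derivative[of 0]) simp_all

lemma smooth_on_differentiable: "smooth_on S f \<Longrightarrow> x \<in> S \<Longrightarrow> f differentiable (at x)"
  using smooth_on_has_derivative by (auto simp: differentiable_def)

lemma smooth_on_imp_continuous_on: "smooth_on S f \<Longrightarrow> continuous_on S f"
  unfolding smooth_on_def using Ck_on.simps(1)[of S f] by simp

lemma smooth_on_frechet: "smooth_on S f \<Longrightarrow> smooth_on S (\<lambda>x. frechet_derivative f (at x) v)"
  unfolding smooth_on_def using Ck_on.simps(2)[of _ S f] by simp

lemma smooth_on_const: "open S \<Longrightarrow> smooth_on S (\<lambda>x. c)"
  by (simp add: smooth_on_def Ck_on_const)

lemma smooth_on_zero:
  assumes "open S" "\<And>y. y \<in> S \<Longrightarrow> f y = 0" shows "smooth_on S f"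
  using smooth_on_cong[OF assms(1), of f "\<lambda>_. 0"] smooth_on_const[OF assms(1), of 0] assms(2) by simp

lemma smooth_on_bounded_linear: "open S \<Longrightarrow> bounded_linear L \<Longrightarrow> smooth_on S L"
  by (simp add: smooth_on_def Ck_on_bounded_linear)

lemma smooth_on_id: "open S \<Longrightarrow> smooth_on S (\<lambda>x. x)"
  by (simp add: smooth_on_bounded_linear)

lemma smooth_on_fst: "open S \<Longrightarrow> smooth_on S fst"
  by (simp add: smooth_on_bounded_linear bounded_linear_fst)

lemma smooth_on_snd: "open S \<Longrightarrow> smooth_on S snd"
  by (simp add: smooth_on_bounded_linear bounded_linear_snd)

lemma smooth_on_add:
  "open S \<Longrightarrow> smooth_on S f \<Longrightarrow> smooth_on S g \<Longrightarrow> smooth_on S (\<lambda>x. f x + g x)"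
  by (simp add: smooth_on_def Ck_on_add)

lemma smooth_on_sum:
  "open S \<Longrightarrow> (\<And>i. i \<in> I \<Longrightarrow> smooth_on S (f i)) \<Longrightarrow> smooth_on S (\<lambda>x. \<Sum>i\<in>I. f i x)"
  by (simp add: smooth_on_def Ck_on_sum)

lemma smooth_on_scaleR:
  "open S \<Longrightarrow> smooth_on S f \<Longrightarrow> smooth_on S g \<Longrightarrow> smooth_on S (\<lambda>x. f x *\<^sub>R g x)"
  by (simp add: smooth_on_def Ck_on_bounded_bilinear[OF bounded_bilinear_scaleR])

lemma smooth_on_inner:
  "open S \<Longrightarrow> smooth_on S f \<Longrightarrow> smooth_on S g \<Longrightarrow> smooth_on S (\<lambda>x. f x \<bullet> g x)"
  by (simp add: smooth_on_def Ck_on_bounded_bilinear[OF bounded_bilinear_inner])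

lemma smooth_on_mult:
  fixes f g :: "'a::real_normed_vector \<Rightarrow> real"
  shows "open S \<Longrightarrow> smooth_on S f \<Longrightarrow> smooth_on S g \<Longrightarrow> smooth_on S (\<lambda>x. f x * g x)"
  by (simp add: smooth_on_def Ck_on_bounded_bilinear[OF bounded_bilinear_mult])

lemma smooth_on_compose:
  fixes f :: "'a::real_normed_vector \<Rightarrow> 'b::euclidean_space" and g :: "'b \<Rightarrow> 'c::real_normed_vector"
  shows "open S \<Longrightarrow> open T \<Longrightarrow> f ` S \<subseteq> T \<Longrightarrow> smooth_on S f \<Longrightarrow> smooth_on T g \<Longrightarrow>
    smooth_on S (\<lambda>x. g (f x))"
  unfolding smooth_on_def by (simp add: Ck_on_compose[of S T f])

lemma smooth_on_linear_compose:
  fixes f :: "'a::real_normed_vector \<Rightarrow> 'b::euclidean_space" and L :: "'b \<Rightarrow> 'c::real_normed_vector"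
  shows "open S \<Longrightarrow> smooth_on S f \<Longrightarrow> linear L \<Longrightarrow> smooth_on S (\<lambda>x. L (f x))"
  by (rule smooth_on_compose[where T=UNIV]) (simp_all add: smooth_on_bounded_linear linear_conv_bounded_linear)

lemma smooth_on_minus:
  fixes f :: "'a::real_normed_vector \<Rightarrow> 'b::real_normed_vector"
  assumes "open S" "smooth_on S f" shows "smooth_on S (\<lambda>x. - f x)"
  using smooth_on_scaleR[OF assms(1) smooth_on_const[OF assms(1), of "-1"] assms(2)] by simp

lemma smooth_on_diff:
  fixes f :: "'a::real_normed_vector \<Rightarrow> 'b::real_normed_vector"
  assumes "open S" "smooth_on S f" "smooth_on S g" shows "smooth_on S (\<lambda>x. f x - g x)"
  using smooth_on_add[OF assms(1,2) smooth_on_minus[OF assms(1,3)]] by simp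

lemma smooth_on_Pair:
  fixes f :: "'a::real_normed_vector \<Rightarrow> 'b::euclidean_space" and g :: "'a \<Rightarrow> 'c::euclidean_space"
  assumes "open S" "smooth_on S f" "smooth_on S g" shows "smooth_on S (\<lambda>x. (f x, g x))"
proof -
  have "linear (\<lambda>a::'b. (a, 0::'c))" "linear (\<lambda>b::'c. (0::'b, b))"
    by (auto intro!: linearI)
  from smooth_on_add[OF assms(1) smooth_on_linear_compose[OF assms(1,2) this(1)]
      smooth_on_linear_compose[OF assms(1,3) this(2)]]
  show ?thesis by simp
qed

text \<open>Expanding the argument in the standard basis reduces a field of linear maps to
  finitely many functions of the base point.\<close>

lemma smooth_on_linear_field:
  fixes J :: "'x::real_normed_vector \<Rightarrow> 'e::euclidean_space \<Rightarrow> 'f::real_normed_vector"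
  assumes "open S" "\<And>x. x \<in> S \<Longrightarrow> linear (J x)" "\<And>e. smooth_on S (\<lambda>x. J x e)" "smooth_on S u"
  shows "smooth_on S (\<lambda>x. J x (u x))"
proof -
  have "smooth_on S (\<lambda>x. \<Sum>i\<in>Basis. (u x \<bullet> i) *\<^sub>R J x i)"
    using assms by (intro smooth_on_sum smooth_on_scaleR smooth_on_inner smooth_on_const) auto
  then show ?thesis
    by (rule smooth_on_cong[OF assms(1), THEN iffD1, rotated])
      (simp add: linear_Basis_expand[OF assms(2), symmetric])
qed

lemma linear_frechet_derivative_smooth:
  "smooth_on S f \<Longrightarrow> x \<in> S \<Longrightarrow> linear (frechet_derivative f (at x))"
  by (rule has_derivative_linear[OF smooth_on_has_derivative])

lemma smooth_on_frechet_field: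
  fixes f :: "'a::euclidean_space \<Rightarrow> 'b::real_normed_vector"
  assumes "open S" "smooth_on S f" "smooth_on S u"
  shows "smooth_on S (\<lambda>x. frechet_derivative f (at x) (u x))"
  by (rule smooth_on_linear_field)
    (use assms in \<open>auto intro: linear_frechet_derivative_smooth smooth_on_frechet\<close>)

text \<open>By linearity of \<open>J x\<close>, expanding \<open>u\<close> in the standard basis reduces this to the ordinary product
  rule, so that the dependence of \<open>J\<close> on the base point has to be known for constant arguments only.\<close>

lemma has_derivative_linear_field:
  fixes J :: "'x::real_normed_vector \<Rightarrow> 'e::euclidean_space \<Rightarrow> 'f::real_normed_vector"
  assumes "open S" "z \<in> S" "\<And>x. x \<in> S \<Longrightarrow> linear (J x)"
    and J': "\<And>e. ((\<lambda>x. J x e) has_derivative J' e) (at z)" and u: "(u has_derivative u') (at z)"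
  shows "((\<lambda>x. J x (u x)) has_derivative (\<lambda>h. J' (u z) h + J z (u' h))) (at z)"
proof -
  have expand: "J x e = (\<Sum>i\<in>Basis. (e \<bullet> i) *\<^sub>R J x i)" if "x \<in> S" for x e
    using linear_Basis_expand[OF assms(3)[OF that]] .
  have "((\<lambda>x. \<Sum>i\<in>Basis. (u z \<bullet> i) *\<^sub>R J x i) has_derivative (\<lambda>h. \<Sum>i\<in>Basis. (u z \<bullet> i) *\<^sub>R J' i h)) (at z)"
    using J' by (auto intro!: derivative_eq_intros)
  then have "((\<lambda>x. J x (u z)) has_derivative (\<lambda>h. \<Sum>i\<in>Basis. (u z \<bullet> i) *\<^sub>R J' i h)) (at z)"
    by (rule has_derivative_transform_within_open[OF _ assms(1,2)]) (rule expand[symmetric])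
  then have J'u: "J' (u z) = (\<lambda>h. \<Sum>i\<in>Basis. (u z \<bullet> i) *\<^sub>R J' i h)"
    by (rule has_derivative_unique[OF J'])
  have "((\<lambda>x. \<Sum>i\<in>Basis. (u x \<bullet> i) *\<^sub>R J x i) has_derivative
        (\<lambda>h. \<Sum>i\<in>Basis. (u z \<bullet> i) *\<^sub>R J' i h + (u' h \<bullet> i) *\<^sub>R J z i)) (at z)"
    using J' u by (auto intro!: derivative_eq_intros)
  then have "((\<lambda>x. J x (u x)) has_derivative
        (\<lambda>h. \<Sum>i\<in>Basis. (u z \<bullet> i) *\<^sub>R J' i h + (u' h \<bullet> i) *\<^sub>R J z i)) (at z)"
    by (rule has_derivative_transform_within_open[OF _ assms(1,2)]) (rule expand[symmetric])
  then show ?thesis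
    by (simp add: sum.distrib J'u expand[OF assms(2), symmetric])
qed

lemma has_derivative_bilinear_field:
  fixes G :: "'x::real_normed_vector \<Rightarrow> 'e::euclidean_space \<Rightarrow> 'e' :: euclidean_space \<Rightarrow> 'f::real_normed_vector"
  assumes "open S" "z \<in> S"
    and l1: "\<And>x b. x \<in> S \<Longrightarrow> linear (\<lambda>a. G x a b)" and l2: "\<And>x a. x \<in> S \<Longrightarrow> linear (G x a)"
    and G': "\<And>a b. ((\<lambda>x. G x a b) has_derivative G' a b) (at z)"
    and u: "(u has_derivative u') (at z)" and v: "(v has_derivative v') (at z)"
  shows "((\<lambda>x. G x (u x) (v x)) has_derivative
          (\<lambda>h. G' (u z) (v z) h + G z (u' h) (v z) + G z (u z) (v' h))) (at z)"
proof (rule has_derivative_linear_field[where J="\<lambda>x. G x (u x)" and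
      J'="\<lambda>b h. G' (u z) b h + G z (u' h) b", OF assms(1,2) l2 _ v])
  show "((\<lambda>x. G x (u x) b) has_derivative (\<lambda>h. G' (u z) b h + G z (u' h) b)) (at z)" for b
    by (rule has_derivative_linear_field[where J="\<lambda>x a. G x a b", OF assms(1,2) l1 G' u])
qed

section \<open>Symmetry of second derivatives\<close>

lemma has_real_derivative_along_line:
  assumes "(F has_derivative F') (at (p + r *\<^sub>R w))"
  shows "((\<lambda>r. F (p + r *\<^sub>R w)) has_real_derivative F' w) (at r)"
proof -
  have "((\<lambda>r. p + r *\<^sub>R w) has_derivative (\<lambda>h. h *\<^sub>R w)) (at r)"
    by (auto intro!: derivative_eq_intros)
  from has_derivative_compose[OF this assms]
  have "((\<lambda>r. F (p + r *\<^sub>R w)) has_derivative (\<lambda>h. F' (h *\<^sub>R w))) (at r)" .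
  moreover have "F' (h *\<^sub>R w) = F' w * h" for h
    by (simp add: linear_cmul[OF has_derivative_linear[OF assms]])
  ultimately show ?thesis by (simp add: has_field_derivative_def)
qed

text \<open>Two applications of the mean value theorem: first in direction \<open>u\<close> to the difference of \<open>f\<close> between
  points displaced by \<open>s *\<^sub>R v\<close>, then in direction \<open>v\<close> to the derivative along \<open>u\<close>.\<close>

lemma second_difference_mean_value:
  fixes f :: "'a::real_normed_vector \<Rightarrow> real"
  assumes S: "\<And>a b. 0 \<le> a \<Longrightarrow> a \<le> s \<Longrightarrow> 0 \<le> b \<Longrightarrow> b \<le> s \<Longrightarrow> x + a *\<^sub>R u + b *\<^sub>R v \<in> S"
    and f: "smooth_on S f" and s: "s > 0"
  obtains a b where "0 \<le> a" "a \<le> s" "0 \<le> b" "b \<le> s"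
    "f (x + s *\<^sub>R u + s *\<^sub>R v) - f (x + s *\<^sub>R u) - f (x + s *\<^sub>R v) + f x =
      s\<^sup>2 * frechet_derivative (\<lambda>y. frechet_derivative f (at y) u) (at (x + a *\<^sub>R u + b *\<^sub>R v)) v"
proof -
  define g where "g r = f ((x + s *\<^sub>R v) + r *\<^sub>R u) - f (x + r *\<^sub>R u)" for r
  have "\<exists>a>0. a < s \<and> g s - g 0 = (s - 0) *
      (frechet_derivative f (at ((x + s *\<^sub>R v) + a *\<^sub>R u)) u - frechet_derivative f (at (x + a *\<^sub>R u)) u)"
  proof (rule MVT2[OF s])
    fix r assume r: "0 \<le> r" "r \<le> s"
    have "x + s *\<^sub>R v + r *\<^sub>R u \<in> S" "x + r *\<^sub>R u \<in> S"
      using S[of r s] S[of r 0] r s by (simp_all add: algebra_simps)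
    then show "(g has_real_derivative frechet_derivative f (at (x + s *\<^sub>R v + r *\<^sub>R u)) u
        - frechet_derivative f (at (x + r *\<^sub>R u)) u) (at r)"
      unfolding g_def
      by (intro DERIV_diff has_real_derivative_along_line smooth_on_has_derivative[OF f])
  qed
  then obtain a where a: "0 < a" "a < s" and ga: "g s - g 0 = s *
      (frechet_derivative f (at ((x + a *\<^sub>R u) + s *\<^sub>R v)) u
       - frechet_derivative f (at ((x + a *\<^sub>R u) + 0 *\<^sub>R v)) u)"
    by (auto simp: algebra_simps)
  have "\<exists>b>0. b < s \<and> frechet_derivative f (at ((x + a *\<^sub>R u) + s *\<^sub>R v)) u
       - frechet_derivative f (at ((x + a *\<^sub>R u) + 0 *\<^sub>R v)) u =
       (s - 0) * frechet_derivative (\<lambda>y. frechet_derivative f (at y) u) (at ((x + a *\<^sub>R u) + b *\<^sub>R v)) v"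
  proof (rule MVT2[OF s])
    fix r assume r: "0 \<le> r" "r \<le> s"
    show "((\<lambda>r. frechet_derivative f (at ((x + a *\<^sub>R u) + r *\<^sub>R v)) u) has_real_derivative
       frechet_derivative (\<lambda>y. frechet_derivative f (at y) u) (at ((x + a *\<^sub>R u) + r *\<^sub>R v)) v) (at r)"
      using S[of a r] r a
      by (intro has_real_derivative_along_line[where F="\<lambda>y. frechet_derivative f (at y) u"]
          smooth_on_has_derivative[OF smooth_on_frechet[OF f]]) auto
  qed
  then obtain b where b: "0 < b" "b < s" and gb: "frechet_derivative f (at ((x + a *\<^sub>R u) + s *\<^sub>R v)) u
       - frechet_derivative f (at ((x + a *\<^sub>R u) + 0 *\<^sub>R v)) u =
       s * frechet_derivative (\<lambda>y. frechet_derivative f (at y) u) (at ((x + a *\<^sub>R u) + b *\<^sub>R v)) v"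
    by auto
  have "f (x + s *\<^sub>R u + s *\<^sub>R v) - f (x + s *\<^sub>R u) - f (x + s *\<^sub>R v) + f x = g s - g 0"
    by (simp add: g_def algebra_simps)
  also have "\<dots> = s\<^sup>2 * frechet_derivative (\<lambda>y. frechet_derivative f (at y) u) (at (x + a *\<^sub>R u + b *\<^sub>R v)) v"
    by (simp only: ga gb) (simp add: power2_eq_square)
  finally show ?thesis using that[of a b] a b by simp
qed

text \<open>The second difference is symmetric in \<open>u\<close> and \<open>v\<close>. Divided by \<open>s\<^sup>2\<close> it is a value of either
  mixed derivative at a point near \<open>x\<close>, and both are continuous.\<close>

lemma symmetric_second_derivative_real:
  fixes f :: "'a::real_normed_vector \<Rightarrow> real"
  assumes "open S" "x \<in> S" "smooth_on S f"
  shows "frechet_derivative (\<lambda>y. frechet_derivative f (at y) u) (at x) v =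
         frechet_derivative (\<lambda>y. frechet_derivative f (at y) v) (at x) u"
proof (rule ccontr)
  define U where "U u v y = frechet_derivative (\<lambda>y. frechet_derivative f (at y) u) (at y) v" for u v y
  assume "\<not> ?thesis"
  then have e: "\<bar>U u v x - U v u x\<bar> > 0" by (simp add: U_def)
  define e where "e = \<bar>U u v x - U v u x\<bar> / 2"
  have "e > 0" using e by (simp add: e_def)
  have "continuous_on S (U u v)" for u v
    unfolding U_def[abs_def] using assms(3) by (intro smooth_on_imp_continuous_on smooth_on_frechet)
  then have cont: "isCont (U u v) x" for u v
    by (simp add: continuous_on_eq_continuous_at assms(1,2))
  have near_cont: "\<exists>d>0. \<forall>y. dist y x < d \<longrightarrow> dist (U u v y) (U u v x) < e" for u v
    using cont[of u v] \<open>e > 0\<close> by (simp add: continuous_at_eps_delta dist_norm)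
  obtain d1 where d1: "d1 > 0" "\<And>y. dist y x < d1 \<Longrightarrow> dist (U u v y) (U u v x) < e"
    using near_cont[of u v] by auto
  obtain d2 where d2: "d2 > 0" "\<And>y. dist y x < d2 \<Longrightarrow> dist (U v u y) (U v u x) < e"
    using near_cont[of v u] by auto
  obtain d3 where d3: "d3 > 0" "ball x d3 \<subseteq> S"
    using assms(1,2) by (auto elim: openE)
  define d where "d = min d1 (min d2 d3)"
  \<comment> \<open>The summand 1 keeps the denominator positive if \<open>u = v = 0\<close>.\<close>
  define s where "s = d / (norm u + norm v + 1)"
  have d: "d > 0" using d1 d2 d3 by (simp add: d_def)
  have s: "s > 0" using d by (simp add: s_def add_nonneg_pos)
  have near: "dist (x + a *\<^sub>R u + b *\<^sub>R v) x < d" if "0 \<le> a" "a \<le> s" "0 \<le> b" "b \<le> s" for a b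
  proof -
    have "norm (a *\<^sub>R u + b *\<^sub>R v) \<le> a * norm u + b * norm v"
      using that by (intro order_trans[OF norm_triangle_ineq]) simp
    also have "\<dots> \<le> s * norm u + s * norm v"
      using that by (intro add_mono mult_right_mono) auto
    also have "\<dots> < s * (norm u + norm v + 1)"
      using s by (simp add: algebra_simps)
    also have "\<dots> = d" unfolding s_def by (simp add: add_nonneg_eq_0_iff)
    finally show ?thesis by (simp add: dist_norm add.assoc)
  qed
  have in_S: "x + a *\<^sub>R u + b *\<^sub>R v \<in> S" if "0 \<le> a" "a \<le> s" "0 \<le> b" "b \<le> s" for a b
    using near[OF that] d3 by (auto simp: d_def dist_commute subset_eq)
  have in_S': "x + a *\<^sub>R v + b *\<^sub>R u \<in> S" if "0 \<le> a" "a \<le> s" "0 \<le> b" "b \<le> s" for a b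
    using in_S[OF that(3,4,1,2)] by (simp add: algebra_simps)
  obtain a b where ab: "0 \<le> a" "a \<le> s" "0 \<le> b" "b \<le> s"
    and eq1: "f (x + s *\<^sub>R u + s *\<^sub>R v) - f (x + s *\<^sub>R u) - f (x + s *\<^sub>R v) + f x = s\<^sup>2 * U u v (x + a *\<^sub>R u + b *\<^sub>R v)"
    unfolding U_def by (rule second_difference_mean_value[of s x u v S f, OF in_S assms(3) s])
  obtain a' b' where ab': "0 \<le> a'" "a' \<le> s" "0 \<le> b'" "b' \<le> s"
    and eq2: "f (x + s *\<^sub>R v + s *\<^sub>R u) - f (x + s *\<^sub>R v) - f (x + s *\<^sub>R u) + f x = s\<^sup>2 * U v u (x + a' *\<^sub>R v + b' *\<^sub>R u)"
    unfolding U_def by (rule second_difference_mean_value[of s x v u S f, OF in_S' assms(3) s])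
  have "s\<^sup>2 * U u v (x + a *\<^sub>R u + b *\<^sub>R v) = s\<^sup>2 * U v u (x + b' *\<^sub>R u + a' *\<^sub>R v)"
    using eq1 eq2 by (simp add: algebra_simps)
  then have "U u v (x + a *\<^sub>R u + b *\<^sub>R v) = U v u (x + b' *\<^sub>R u + a' *\<^sub>R v)"
    using s by simp
  moreover have "dist (U u v (x + a *\<^sub>R u + b *\<^sub>R v)) (U u v x) < e"
    using near[OF ab] by (intro d1) (simp add: d_def)
  moreover have "dist (U v u (x + b' *\<^sub>R u + a' *\<^sub>R v)) (U v u x) < e"
    using near[OF ab'(3,4,1,2)] by (intro d2) (simp add: d_def)
  ultimately show False unfolding dist_real_def e_def by (smt (verit) field_sum_of_halves)
qed

lemma symmetric_second_derivative:
  fixes f :: "'a::real_normed_vector \<Rightarrow> 'b::euclidean_space"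
  assumes S: "open S" "x \<in> S" and f: "smooth_on S f"
  shows "frechet_derivative (\<lambda>y. frechet_derivative f (at y) u) (at x) v =
         frechet_derivative (\<lambda>y. frechet_derivative f (at y) v) (at x) u"
proof (rule euclidean_eqI)
  fix b :: 'b assume "b \<in> Basis"
  define fb where "fb y = f y \<bullet> b" for y
  have fb: "smooth_on S fb"
    unfolding fb_def[abs_def] using S f by (intro smooth_on_inner smooth_on_const)
  have inner: "frechet_derivative (\<lambda>y. h y \<bullet> b) (at y) w = frechet_derivative h (at y) w \<bullet> b"
    if "smooth_on S h" "y \<in> S" for h :: "'a \<Rightarrow> 'b" and y w
    by (simp add: frechet_derivative_at[OF has_derivative_inner_left[OF smooth_on_has_derivative[OF that]], symmetric])
  have "frechet_derivative (\<lambda>y. frechet_derivative fb (at y) w) (at x) z =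
      frechet_derivative (\<lambda>y. frechet_derivative f (at y) w) (at x) z \<bullet> b" for w z
  proof -
    have "frechet_derivative (\<lambda>y. frechet_derivative fb (at y) w) (at x) =
        frechet_derivative (\<lambda>y. frechet_derivative f (at y) w \<bullet> b) (at x)"
      by (rule frechet_derivative_cong_open[OF S]) (simp add: fb_def[abs_def] inner[OF f])
    then show ?thesis using inner[OF smooth_on_frechet[OF f] S(2)] by simp
  qed
  then show "frechet_derivative (\<lambda>y. frechet_derivative f (at y) u) (at x) v \<bullet> b =
         frechet_derivative (\<lambda>y. frechet_derivative f (at y) v) (at x) u \<bullet> b"
    using symmetric_second_derivative_real[OF S fb, of u v] by simp
qed

section \<open>Bump functions\<close>

text \<open>The functions \<open>t\<^bsup>-n\<^esup> exp (-1/t)\<close> extended by zero: the derivative of each is a linear combination of two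
  others, so smoothness follows for all of them together.\<close>

definition flat_exp :: "nat \<Rightarrow> real \<Rightarrow> real" where
  "flat_exp n t = (if t \<le> 0 then 0 else inverse t ^ n * exp (- inverse t))"

lemma flat_exp_tendsto_0: "(flat_exp n \<longlongrightarrow> 0) (at 0)"
proof (rule filterlim_split_at)
  show "(flat_exp n \<longlongrightarrow> 0) (at_left 0)"
    by (rule tendsto_eventually) (auto simp: flat_exp_def eventually_at_filter)
  have "((\<lambda>t::real. inverse t ^ n / exp (inverse t)) \<longlongrightarrow> 0) (at_right 0)"
    by (rule filterlim_compose[OF tendsto_power_div_exp_0 filterlim_inverse_at_top_right])
  then show "(flat_exp n \<longlongrightarrow> 0) (at_right 0)"
    by (rule Lim_transform_eventually)
      (auto simp: flat_exp_def eventually_at_filter exp_minus divide_inverse)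
qed

lemma flat_exp_has_derivative:
  "(flat_exp n has_real_derivative (flat_exp (n + 2) t - real n * flat_exp (n + 1) t)) (at t)"
proof -
  consider "t < 0" | "t = 0" | "t > 0" by linarith
  then show ?thesis
  proof cases
    case 1
    have "((\<lambda>_. 0) has_real_derivative 0) (at t)" by simp
    then have "(flat_exp n has_real_derivative 0) (at t)"
      by (rule has_field_derivative_transform_within_open[where S="{..<0}"]) (use 1 in \<open>auto simp: flat_exp_def\<close>)
    then show ?thesis using 1 by (simp add: flat_exp_def)
  next
    case 2
    have "((\<lambda>h. (flat_exp n (0 + h) - flat_exp n 0) / h) \<longlongrightarrow> 0) (at 0)"
      by (rule Lim_transform_eventually[OF flat_exp_tendsto_0[of "Suc n"]])
        (auto simp: flat_exp_def eventually_at_filter divide_inverse)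
    then show ?thesis using 2 by (simp add: DERIV_def flat_exp_def)
  next
    case 3
    have "((\<lambda>t. inverse t ^ n) has_real_derivative - (real n * inverse t ^ (n + 1))) (at t)"
    proof (induction n)
      case (Suc n)
      have "((\<lambda>t. inverse t * inverse t ^ n) has_real_derivative
          - inverse t * inverse t * inverse t ^ n + inverse t * - (real n * inverse t ^ (n + 1))) (at t)"
        by (rule DERIV_cong[OF DERIV_mult'[OF DERIV_inverse Suc]]) (use 3 in \<open>auto simp: algebra_simps\<close>)
      then show ?case by (simp add: algebra_simps)
    qed simp
    moreover have "((\<lambda>t. exp (- inverse t)) has_real_derivative (inverse t * inverse t) * exp (- inverse t)) (at t)"
      by (rule DERIV_cong[OF DERIV_fun_exp[OF DERIV_minus[OF DERIV_inverse]]]) (use 3 in simp_all)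
    ultimately have "((\<lambda>t. inverse t ^ n * exp (- inverse t)) has_real_derivative
        - (real n * inverse t ^ (n + 1)) * exp (- inverse t) + ((inverse t * inverse t) * exp (- inverse t)) * inverse t ^ n) (at t)"
      by (rule DERIV_mult)
    then have "((\<lambda>t. inverse t ^ n * exp (- inverse t)) has_real_derivative
        (flat_exp (n + 2) t - real n * flat_exp (n + 1) t)) (at t)"
      using 3 by (elim DERIV_cong) (simp add: flat_exp_def algebra_simps)
    then show ?thesis
      by (rule has_field_derivative_transform_within_open[where S="{0<..}"]) (use 3 in \<open>auto simp: flat_exp_def\<close>)
  qed
qed

lemma Ck_on_flat_exp: "Ck_on k UNIV (flat_exp n)"
proof (induction k arbitrary: n)
  case 0
  have "isCont (flat_exp n) x" for x
    using DERIV_isCont[OF flat_exp_has_derivative] .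
  then show ?case by (simp add: continuous_at_imp_continuous_on)
next
  case (Suc k)
  show ?case
  proof (rule Ck_on_SucI[where f'="\<lambda>t v. (flat_exp (n + 2) t + - real n * flat_exp (n + 1) t) * v"])
    show "(flat_exp n has_derivative (\<lambda>v. (flat_exp (n + 2) x + - real n * flat_exp (n + 1) x) * v)) (at x)" for x
      using flat_exp_has_derivative[of n x] by (simp add: has_field_derivative_def)
    show "Ck_on k UNIV (\<lambda>x. (flat_exp (n + 2) x + - real n * flat_exp (n + 1) x) * v)" for v
      by (intro Ck_on_bounded_bilinear[OF bounded_bilinear_mult] Ck_on_add Ck_on_const Suc open_UNIV)
  qed simp
qed

lemma Ck_on_inverse: "Ck_on k {0<..} (inverse :: real \<Rightarrow> real)"
proof (induction k)
  case 0
  then show ?case by (auto intro!: continuous_intros)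
next
  case (Suc k)
  show ?case
  proof (rule Ck_on_SucI[where f'="\<lambda>t v. - 1 * (inverse t * inverse t) * v"])
    show "(inverse has_derivative (\<lambda>v. - 1 * (inverse x * inverse x) * v)) (at x)" if "x \<in> {0<..}" for x :: real
      using that by (auto intro!: derivative_eq_intros simp: algebra_simps)
    show "Ck_on k {0<..} (\<lambda>x. - 1 * (inverse x * inverse x) * v)" for v :: real
      by (intro Ck_on_bounded_bilinear[OF bounded_bilinear_mult] Ck_on_const Suc open_greaterThan)
  qed simp
qed

text \<open>Writing \<open>h\<close> for \<^const>\<open>flat_exp\<close> with exponent 0, the function is \<open>h t / (h t + h (1 - t))\<close>.\<close>

lemma smooth_step_exists:
  obtains s :: "real \<Rightarrow> real" where "smooth_on UNIV s" "\<And>t. t \<le> 0 \<Longrightarrow> s t = 0" "\<And>t. t \<ge> 1 \<Longrightarrow> s t = 1"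
proof
  have sm: "smooth_on UNIV (flat_exp 0)" by (simp add: smooth_on_def Ck_on_flat_exp)
  have "smooth_on UNIV (\<lambda>t::real. 1 - t)"
    by (intro smooth_on_diff smooth_on_const smooth_on_id open_UNIV)
  from smooth_on_compose[OF open_UNIV open_UNIV _ this sm]
  have sm': "smooth_on UNIV (\<lambda>t. flat_exp 0 (1 - t))" by simp
  have pos: "flat_exp 0 t + flat_exp 0 (1 - t) > 0" for t
    by (auto simp: flat_exp_def add_pos_pos)
  have "smooth_on {0<..} (inverse :: real \<Rightarrow> real)" by (simp add: smooth_on_def Ck_on_inverse)
  from smooth_on_compose[OF open_UNIV open_greaterThan _ smooth_on_add[OF open_UNIV sm sm'] this]
  have "smooth_on UNIV (\<lambda>t. inverse (flat_exp 0 t + flat_exp 0 (1 - t)))"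
    by (simp add: pos image_subset_iff)
  then show "smooth_on UNIV (\<lambda>t. flat_exp 0 t * inverse (flat_exp 0 t + flat_exp 0 (1 - t)))"
    by (rule smooth_on_mult[OF open_UNIV sm])
  show "flat_exp 0 t * inverse (flat_exp 0 t + flat_exp 0 (1 - t)) = 0" if "t \<le> 0" for t
    using that by (simp add: flat_exp_def)
  show "flat_exp 0 t * inverse (flat_exp 0 t + flat_exp 0 (1 - t)) = 1" if "t \<ge> 1" for t
    using that by (simp add: flat_exp_def)
qed

lemma bump_function_exists:
  fixes x :: "'e::euclidean_space"
  assumes "open V" "x \<in> V"
  obtains \<phi> :: "'e \<Rightarrow> real" and W C where "smooth_on UNIV \<phi>" "open W" "compact C" "x \<in> W" "W \<subseteq> C" "C \<subseteq> V"
    "\<forall>y\<in>W. \<phi> y = 1" "\<forall>y. y \<notin> C \<longrightarrow> \<phi> y = 0"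
proof -
  obtain r where r: "r > 0" "cball x r \<subseteq> V" using assms open_contains_cball by blast
  obtain s :: "real \<Rightarrow> real" where s: "smooth_on UNIV s" "\<And>t. t \<le> 0 \<Longrightarrow> s t = 0" "\<And>t. t \<ge> 1 \<Longrightarrow> s t = 1"
    using smooth_step_exists by blast
  \<comment> \<open>Positive exactly in the open ball of radius \<open>r\<close>, and equal to 2, hence above 1, at the centre.\<close>
  define q where "q y = (r\<^sup>2 - (y - x) \<bullet> (y - x)) * (2 / r\<^sup>2)" for y
  define W where "W = {y. q y > 1}"
  have q: "smooth_on UNIV q" unfolding q_def[abs_def]
    by (intro smooth_on_mult smooth_on_diff smooth_on_inner smooth_on_const smooth_on_id open_UNIV)
  have "smooth_on UNIV (\<lambda>y. s (q y))"
    using smooth_on_compose[OF open_UNIV open_UNIV _ q s(1)] by simp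
  moreover have "open W" unfolding W_def
    using smooth_on_imp_continuous_on[OF q] by (intro open_Collect_less) auto
  moreover have "x \<in> W" using r by (simp add: W_def q_def)
  moreover have in_C: "y \<in> cball x r" if "q y > 0" for y
  proof -
    have "r\<^sup>2 - (y - x) \<bullet> (y - x) > 0" using that r unfolding q_def by (elim zero_less_mult_pos2) simp
    then have "norm (y - x) \<le> r"
      using r by (intro power2_le_imp_le[of "norm (y - x)" r]) (simp_all add: power2_norm_eq_inner)
    then show ?thesis by (simp add: dist_norm norm_minus_commute)
  qed
  moreover have "s (q y) = 0" if "y \<notin> cball x r" for y
    using in_C[of y] that by (intro s(2)) (meson linorder_not_le)
  ultimately show ?thesis
    using r(2) s(3) by (intro that[of "\<lambda>y. s (q y)" W "cball x r"]) (auto simp: W_def intro!: in_C s(3))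
qed

section \<open>Charts and tangent vectors\<close>

text \<open>The conditions on the charts alone. They suffice for every local computation and are inherited by the
  tangent bundle.\<close>

locale smooth_atlas =
  fixes A :: "('m, 'e::euclidean_space) atlas"
  assumes chart_inj: "c \<in> A \<Longrightarrow> inj_on (snd c) (fst c)"
    and open_chart_image: "c \<in> A \<Longrightarrow> open (chart_image c)"
    and open_overlap: "c \<in> A \<Longrightarrow> d \<in> A \<Longrightarrow> open (snd c ` (fst c \<inter> fst d))"
    and smooth_transition: "c \<in> A \<Longrightarrow> d \<in> A \<Longrightarrow>
      smooth_on (snd c ` (fst c \<inter> fst d)) (snd d \<circ> inv_chart c)"

lemma smooth_manifold_imp_smooth_atlas: "smooth_manifold A \<Longrightarrow> smooth_atlas A"
  by (simp add: smooth_manifold_def smooth_atlas_def)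

abbreviation transition_derivative ::
  "('m, 'e::euclidean_space) chart \<Rightarrow> ('m, 'e) chart \<Rightarrow> 'm \<Rightarrow> 'e \<Rightarrow> 'e" where
  "transition_derivative c d p \<equiv> frechet_derivative (snd d \<circ> inv_chart c) (at (snd c p))"

lemma inv_chart_in: "x \<in> chart_image c \<Longrightarrow> inv_chart c x \<in> fst c"
  by (simp add: inv_chart_def inv_into_into)

lemma snd_inv_chart: "x \<in> chart_image c \<Longrightarrow> snd c (inv_chart c x) = x"
  by (simp add: inv_chart_def f_inv_into_f)

lemma tangent_zero_outside: "v \<in> tangent_space A p \<Longrightarrow> \<not> (c \<in> A \<and> p \<in> fst c) \<Longrightarrow> v c = 0"
  unfolding tangent_space_def by blast

lemma tangent_outside_carrier: "v \<in> tangent_space A p \<Longrightarrow> p \<notin> carrier A \<Longrightarrow> v = 0"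
  using tangent_zero_outside[of v A p] by (auto simp: carrier_def)

lemma chart_at:
  assumes "p \<in> carrier A" shows "chart_at A p \<in> A" "p \<in> fst (chart_at A p)"
proof -
  have "\<exists>c. c \<in> A \<and> p \<in> fst c" using assms by (auto simp: carrier_def)
  then have "chart_at A p \<in> A \<and> p \<in> fst (chart_at A p)" unfolding chart_at_def by (rule someI_ex)
  then show "chart_at A p \<in> A" "p \<in> fst (chart_at A p)" by auto
qed

context smooth_atlas
begin

lemma inv_chart_snd: "c \<in> A \<Longrightarrow> p \<in> fst c \<Longrightarrow> inv_chart c (snd c p) = p"
  by (simp add: chart_inj inv_chart_def)

lemma in_carrier: "c \<in> A \<Longrightarrow> p \<in> fst c \<Longrightarrow> p \<in> carrier A"
  by (auto simp: carrier_def)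

lemma overlap_eq: "c \<in> A \<Longrightarrow> snd c ` (fst c \<inter> fst d) = {x \<in> chart_image c. inv_chart c x \<in> fst d}"
  by (auto simp: inv_chart_snd)

lemma transition_has_derivative:
  assumes "c \<in> A" "d \<in> A" "p \<in> fst c" "p \<in> fst d"
  shows "((snd d \<circ> inv_chart c) has_derivative transition_derivative c d p) (at (snd c p))"
  by (rule smooth_on_has_derivative[OF smooth_transition[OF assms(1,2)]]) (use assms in auto)

lemma linear_transition_derivative:
  "c \<in> A \<Longrightarrow> d \<in> A \<Longrightarrow> p \<in> fst c \<Longrightarrow> p \<in> fst d \<Longrightarrow> linear (transition_derivative c d p)"
  by (rule has_derivative_linear[OF transition_has_derivative])

lemma chart_change:
  fixes f :: "'m \<Rightarrow> 'b"
  assumes "c \<in> A" "y \<in> snd d ` (fst d \<inter> fst c)" "d \<in> A"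
  shows "(f \<circ> inv_chart d) y = (f \<circ> inv_chart c) ((snd c \<circ> inv_chart d) y)"
  using assms by (auto simp: inv_chart_snd)

lemma has_derivative_chart_change:
  fixes f :: "'m \<Rightarrow> 'b::real_normed_vector"
  assumes "c \<in> A" "d \<in> A" "p \<in> fst c" "p \<in> fst d"
    and f': "((f \<circ> inv_chart c) has_derivative f') (at (snd c p))"
  shows "((f \<circ> inv_chart d) has_derivative (\<lambda>v. f' (transition_derivative d c p v))) (at (snd d p))"
proof -
  have "((f \<circ> inv_chart c) has_derivative f') (at ((snd c \<circ> inv_chart d) (snd d p)))"
    using f' assms by (simp add: inv_chart_snd)
  from has_derivative_compose[OF transition_has_derivative[OF assms(2,1,4,3)] this]
  show ?thesis
  proof (rule has_derivative_transform_within_open[OF _ open_overlap[OF assms(2,1)]])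
    show "snd d p \<in> snd d ` (fst d \<inter> fst c)" using assms by auto
  qed (rule chart_change[OF assms(1) _ assms(2), symmetric])
qed

lemma transition_derivative_compose:
  assumes "c \<in> A" "d \<in> A" "e \<in> A" "p \<in> fst c" "p \<in> fst d" "p \<in> fst e"
  shows "transition_derivative d e p (transition_derivative c d p v) = transition_derivative c e p v"
  using frechet_derivative_at[OF has_derivative_chart_change[OF assms(2,1,5,4) transition_has_derivative[OF assms(2,3,5,6)]]]
  by metis

lemma transition_derivative_self:
  assumes "c \<in> A" "p \<in> fst c" shows "transition_derivative c c p v = v"
proof -
  have "transition_derivative c c p = frechet_derivative (\<lambda>x. x) (at (snd c p))"
    by (rule frechet_derivative_cong_open[OF open_chart_image[OF assms(1)]])
      (use assms in \<open>auto simp: inv_chart_snd\<close>)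
  then show ?thesis by simp
qed

lemma tangent_component:
  "v \<in> tangent_space A p \<Longrightarrow> c \<in> A \<Longrightarrow> d \<in> A \<Longrightarrow> p \<in> fst c \<Longrightarrow> p \<in> fst d \<Longrightarrow>
    v d = transition_derivative c d p (v c)"
  unfolding tangent_space_def by blast

lemma chart_vector_self: "c \<in> A \<Longrightarrow> p \<in> fst c \<Longrightarrow> chart_vector A c p e c = e"
  by (simp add: chart_vector_def transition_derivative_self)

lemma chart_vector_tangent: "c \<in> A \<Longrightarrow> p \<in> fst c \<Longrightarrow> chart_vector A c p e \<in> tangent_space A p"
  by (auto simp: tangent_space_def chart_vector_def transition_derivative_compose)

text \<open>A tangent vector is determined by its components in a single chart. Almost every identity between
  tangent vectors below is reduced to one between components in this way.\<close>

lemma tangent_eqI: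
  assumes "v \<in> tangent_space A p" "w \<in> tangent_space A p" "c \<in> A" "p \<in> fst c" "v c = w c"
  shows "v = w"
proof
  fix d show "v d = w d"
    using assms tangent_component[of v p c d] tangent_component[of w p c d]
    by (cases "d \<in> A \<and> p \<in> fst d") (auto simp: tangent_zero_outside)
qed

lemma chart_vector_component: "v \<in> tangent_space A p \<Longrightarrow> c \<in> A \<Longrightarrow> p \<in> fst c \<Longrightarrow> chart_vector A c p (v c) = v"
  by (rule tangent_eqI[of _ p _ c]) (auto simp: chart_vector_tangent chart_vector_self)

lemma tangent_0: "0 \<in> tangent_space A p"
  by (auto simp: tangent_space_def linear_transition_derivative linear_0)

lemma tangent_spaceI:
  assumes "\<And>c d. c \<in> A \<Longrightarrow> d \<in> A \<Longrightarrow> p \<in> fst c \<Longrightarrow> p \<in> fst d \<Longrightarrow>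
      v d = transition_derivative c d p (v c)"
    and "\<And>c. \<not> (c \<in> A \<and> p \<in> fst c) \<Longrightarrow> v c = 0"
  shows "v \<in> tangent_space A p"
  using assms unfolding tangent_space_def by blast

lemma tangent_add:
  assumes "v \<in> tangent_space A p" "w \<in> tangent_space A p" shows "v + w \<in> tangent_space A p"
proof (rule tangent_spaceI)
  fix c d assume cd: "c \<in> A" "d \<in> A" "p \<in> fst c" "p \<in> fst d"
  show "(v + w) d = transition_derivative c d p ((v + w) c)"
    by (simp add: tangent_component[OF assms(1) cd] tangent_component[OF assms(2) cd]
        linear_add[OF linear_transition_derivative[OF cd]])
qed (simp add: tangent_zero_outside[OF assms(1)] tangent_zero_outside[OF assms(2)])

lemma tangent_scale:
  assumes "v \<in> tangent_space A p" shows "(\<lambda>c. r *\<^sub>R v c) \<in> tangent_space A p"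
proof (rule tangent_spaceI)
  fix c d assume cd: "c \<in> A" "d \<in> A" "p \<in> fst c" "p \<in> fst d"
  show "r *\<^sub>R v d = transition_derivative c d p (r *\<^sub>R v c)"
    by (simp add: tangent_component[OF assms cd] linear_cmul[OF linear_transition_derivative[OF cd]])
qed (simp add: tangent_zero_outside[OF assms])

lemma tangent_minus: "v \<in> tangent_space A p \<Longrightarrow> - v \<in> tangent_space A p"
  using tangent_scale[of v p "-1"] by (simp add: fun_Compl_def)

lemma tangent_diff: "v \<in> tangent_space A p \<Longrightarrow> w \<in> tangent_space A p \<Longrightarrow> v - w \<in> tangent_space A p"
  using tangent_add[OF _ tangent_minus] by (simp add: diff_conv_add_uminus del: add_uminus_conv_diff)

lemma chart_vector_add: "c \<in> A \<Longrightarrow> p \<in> fst c \<Longrightarrow> chart_vector A c p (a + b) = chart_vector A c p a + chart_vector A c p b"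
  by (rule tangent_eqI[of _ p _ c]) (auto simp: chart_vector_tangent chart_vector_self tangent_add)

lemma chart_vector_scale: "c \<in> A \<Longrightarrow> p \<in> fst c \<Longrightarrow> chart_vector A c p (r *\<^sub>R a) = (\<lambda>d. r *\<^sub>R chart_vector A c p a d)"
  by (rule tangent_eqI[of _ p _ c]) (auto simp: chart_vector_tangent chart_vector_self tangent_scale)

text \<open>The derivative of a map along a tangent vector may be computed in any chart, so the
  choice of chart in \<^const>\<open>field_derivative\<close> and \<^const>\<open>pushforward\<close> is immaterial.\<close>

lemma frechet_derivative_any_chart:
  fixes f :: "'m \<Rightarrow> 'b::real_normed_vector"
  assumes "v \<in> tangent_space A p" "c \<in> A" "p \<in> fst c" "(f \<circ> inv_chart c) differentiable (at (snd c p))"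
  shows "frechet_derivative (f \<circ> inv_chart (chart_at A p)) (at (snd (chart_at A p) p)) (v (chart_at A p)) =
         frechet_derivative (f \<circ> inv_chart c) (at (snd c p)) (v c)"
proof -
  define d where "d = chart_at A p"
  have d: "d \<in> A" "p \<in> fst d" using chart_at[OF in_carrier[OF assms(2,3)]] by (auto simp: d_def)
  have "frechet_derivative (f \<circ> inv_chart d) (at (snd d p)) =
      (\<lambda>v. frechet_derivative (f \<circ> inv_chart c) (at (snd c p)) (transition_derivative d c p v))"
    by (rule frechet_derivative_at[symmetric, OF has_derivative_chart_change[OF assms(2) d(1) assms(3) d(2)]])
      (rule frechet_derivative_works[THEN iffD1, OF assms(4)])
  then show ?thesis using tangent_component[OF assms(1) d(1) assms(2) d(2) assms(3)] by (simp add: d_def)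
qed

lemma field_derivative_eq:
  assumes "X p \<in> tangent_space A p" "c \<in> A" "p \<in> fst c" "(f \<circ> inv_chart c) differentiable (at (snd c p))"
  shows "field_derivative A X f p = frechet_derivative (f \<circ> inv_chart c) (at (snd c p)) (X p c)"
  unfolding field_derivative_def by (rule frechet_derivative_any_chart[of "X p", OF assms])

lemma pushforward_eq:
  assumes "v \<in> tangent_space A p" "c \<in> A" "p \<in> fst c" "d \<in> B" "F p \<in> fst d"
    "(snd d \<circ> F \<circ> inv_chart c) differentiable (at (snd c p))"
  shows "pushforward A B F p v d = frechet_derivative (snd d \<circ> F \<circ> inv_chart c) (at (snd c p)) (v c)"
  unfolding pushforward_def using frechet_derivative_any_chart[of v p c "snd d \<circ> F"] assms by simp

section \<open>Smooth functions, vector fields and endomorphism fields\<close>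

text \<open>The set consists of the coordinates in \<open>d\<close> of the points whose coordinates in \<open>c\<close> lie in \<open>V\<close>.\<close>

lemma open_chart_shift:
  assumes "c \<in> A" "d \<in> A" "open V" "V \<subseteq> chart_image c"
  shows "open {y \<in> chart_image d. inv_chart d y \<in> inv_chart c ` V}"
proof -
  have "{y \<in> chart_image d. inv_chart d y \<in> inv_chart c ` V} =
      snd d ` (fst d \<inter> fst c) \<inter> (snd c \<circ> inv_chart d) -` V"
  proof (intro set_eqI iffI)
    fix y assume "y \<in> {y \<in> chart_image d. inv_chart d y \<in> inv_chart c ` V}"
    then obtain x where "x \<in> V" "inv_chart d y = inv_chart c x" "y \<in> chart_image d" by auto
    then show "y \<in> snd d ` (fst d \<inter> fst c) \<inter> (snd c \<circ> inv_chart d) -` V"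
      using assms inv_chart_in[of x c] snd_inv_chart[of x c] by (auto simp: overlap_eq)
  next
    fix y assume y: "y \<in> snd d ` (fst d \<inter> fst c) \<inter> (snd c \<circ> inv_chart d) -` V"
    then have "inv_chart d y = inv_chart c (snd c (inv_chart d y))"
      using assms by (auto simp: overlap_eq inv_chart_snd)
    then show "y \<in> {y \<in> chart_image d. inv_chart d y \<in> inv_chart c ` V}" using y by auto
  qed
  then show ?thesis
    using continuous_open_preimage[OF smooth_on_imp_continuous_on[OF smooth_transition[OF assms(2,1)]]
        open_overlap[OF assms(2,1)] assms(3)] by simp
qed

lemma chart_shiftD:
  assumes "c \<in> A" "d \<in> A" "V \<subseteq> chart_image c" "y \<in> chart_image d" "inv_chart d y \<in> inv_chart c ` V"
  shows "y \<in> snd d ` (fst d \<inter> fst c)" "(snd c \<circ> inv_chart d) y \<in> V" "(snd c \<circ> inv_chart d) y \<in> snd c ` (fst c \<inter> fst d)"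
    "inv_chart c (snd c (inv_chart d y)) = inv_chart d y" "inv_chart d y \<in> fst c" "inv_chart d y \<in> fst d"
proof -
  obtain x where x: "x \<in> V" "inv_chart d y = inv_chart c x" using assms by auto
  show *: "inv_chart d y \<in> fst c" "inv_chart d y \<in> fst d"
    using x assms inv_chart_in[of x c] inv_chart_in[of y d] by auto
  show "y \<in> snd d ` (fst d \<inter> fst c)" using assms * by (simp add: overlap_eq)
  show "(snd c \<circ> inv_chart d) y \<in> V" using x assms snd_inv_chart[of x c] by auto
  show "inv_chart c (snd c (inv_chart d y)) = inv_chart d y" using * assms by (simp add: inv_chart_snd)
  show "(snd c \<circ> inv_chart d) y \<in> snd c ` (fst c \<inter> fst d)" using * by auto
qed

lemma smooth_transition_shift:
  assumes "c \<in> A" "d \<in> A" "V \<subseteq> chart_image c"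
  shows "smooth_on {y \<in> chart_image d. inv_chart d y \<in> inv_chart c ` V} (snd c \<circ> inv_chart d)"
  by (rule smooth_on_subset[OF smooth_transition[OF assms(2,1)]]) (use chart_shiftD(1)[OF assms] in blast)

lemma smooth_on_chart_change:
  fixes f :: "'m \<Rightarrow> 'b::real_normed_vector"
  assumes "c \<in> A" "d \<in> A" "open V" "V \<subseteq> chart_image c" "smooth_on V (f \<circ> inv_chart c)"
  shows "smooth_on {y \<in> chart_image d. inv_chart d y \<in> inv_chart c ` V} (f \<circ> inv_chart d)"
proof -
  note o = open_chart_shift[OF assms(1-4)] and shift = chart_shiftD[OF assms(1,2,4)]
  have "smooth_on {y \<in> chart_image d. inv_chart d y \<in> inv_chart c ` V}
      (\<lambda>y. (f \<circ> inv_chart c) ((snd c \<circ> inv_chart d) y))"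
    by (rule smooth_on_compose[OF o assms(3) _ smooth_transition_shift[OF assms(1,2,4)] assms(5)])
      (use shift(2) in blast)
  then show ?thesis
    by (rule smooth_on_cong[OF o, THEN iffD1, rotated]) (use shift(4) in auto)
qed

lemma smooth_on_components_chart_change:
  assumes "c \<in> A" "d \<in> A" "open V" "V \<subseteq> chart_image c"
    and X: "\<And>p. X p \<in> tangent_space A p" and sm: "smooth_on V (\<lambda>x. X (inv_chart c x) c)"
  shows "smooth_on {y \<in> chart_image d. inv_chart d y \<in> inv_chart c ` V} (\<lambda>y. X (inv_chart d y) d)"
proof -
  note o = open_chart_shift[OF assms(1-4)] and shift = chart_shiftD[OF assms(1,2,4)]
  let ?W = "V \<inter> snd c ` (fst c \<inter> fst d)"
  have W: "open ?W" using open_overlap assms by blast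
  have "smooth_on ?W (\<lambda>x. frechet_derivative (snd d \<circ> inv_chart c) (at x) (X (inv_chart c x) c))"
    by (rule smooth_on_frechet_field[OF W])
      (use smooth_on_subset[OF sm] smooth_on_subset[OF smooth_transition[OF assms(1,2)]] in auto)
  from smooth_on_compose[OF o W _ smooth_transition_shift[OF assms(1,2,4)] this]
  have "smooth_on {y \<in> chart_image d. inv_chart d y \<in> inv_chart c ` V}
     (\<lambda>y. frechet_derivative (snd d \<circ> inv_chart c) (at ((snd c \<circ> inv_chart d) y))
           (X (inv_chart c ((snd c \<circ> inv_chart d) y)) c))"
    using shift(2,3) by blast
  then show ?thesis
  proof (rule smooth_on_cong[OF o, THEN iffD1, rotated])
    fix y assume "y \<in> {y \<in> chart_image d. inv_chart d y \<in> inv_chart c ` V}"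
    then have "y \<in> chart_image d" "inv_chart d y \<in> inv_chart c ` V" by auto
    note shift[OF this]
    then show "frechet_derivative (snd d \<circ> inv_chart c) (at ((snd c \<circ> inv_chart d) y))
           (X (inv_chart c ((snd c \<circ> inv_chart d) y)) c) = X (inv_chart d y) d"
      using tangent_component[OF X assms(1,2)] by simp
  qed
qed

lemma vector_field_tangent: "vector_field A X \<Longrightarrow> X p \<in> tangent_space A p"
  by (simp add: vector_field_def)

lemma vector_field_smooth: "vector_field A X \<Longrightarrow> c \<in> A \<Longrightarrow> smooth_on (chart_image c) (\<lambda>x. X (inv_chart c x) c)"
  by (simp add: vector_field_def)

text \<open>Smoothness of the components needs to be checked near each point in one chart only, because they
  transform by the derivative of the transition map, which is smooth.\<close>

lemma vector_fieldI:
  assumes X: "\<And>p. X p \<in> tangent_space A p"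
    and sm: "\<And>p. p \<in> carrier A \<Longrightarrow> \<exists>c\<in>A. \<exists>V. open V \<and> V \<subseteq> chart_image c \<and> p \<in> inv_chart c ` V \<and>
      smooth_on V (\<lambda>x. X (inv_chart c x) c)"
  shows "vector_field A X"
  unfolding vector_field_def
proof (intro conjI allI ballI X smooth_on_local)
  fix d y assume d: "d \<in> A" and y: "y \<in> chart_image d"
  obtain c V where c: "c \<in> A" and V: "open V" "V \<subseteq> chart_image c" "inv_chart d y \<in> inv_chart c ` V"
      "smooth_on V (\<lambda>x. X (inv_chart c x) c)"
    using sm[OF in_carrier[OF d inv_chart_in[OF y]]] by auto
  show "\<exists>T. open T \<and> y \<in> T \<and> smooth_on T (\<lambda>x. X (inv_chart d x) d)"
    using open_chart_shift[OF c d V(1,2)] smooth_on_components_chart_change[OF c d V(1,2) X V(4)] y V(3)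
    by (intro exI[of _ "{y \<in> chart_image d. inv_chart d y \<in> inv_chart c ` V}"]) simp
qed

lemma smooth_functionI:
  assumes sm: "\<And>p. p \<in> carrier A \<Longrightarrow> \<exists>c\<in>A. \<exists>V. open V \<and> V \<subseteq> chart_image c \<and> p \<in> inv_chart c ` V \<and>
      smooth_on V (f \<circ> inv_chart c)"
  shows "smooth_function A f"
  unfolding smooth_function_def
proof (intro ballI smooth_on_local)
  fix d y assume d: "d \<in> A" and y: "y \<in> chart_image d"
  obtain c V where c: "c \<in> A" and V: "open V" "V \<subseteq> chart_image c" "inv_chart d y \<in> inv_chart c ` V"
      "smooth_on V (f \<circ> inv_chart c)"
    using sm[OF in_carrier[OF d inv_chart_in[OF y]]] by auto
  show "\<exists>T. open T \<and> y \<in> T \<and> smooth_on T (f \<circ> inv_chart d)"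
    using open_chart_shift[OF c d V(1,2)] smooth_on_chart_change[OF c d V(1,2,4)] y V(3)
    by (intro exI[of _ "{y \<in> chart_image d. inv_chart d y \<in> inv_chart c ` V}"]) simp
qed

lemma vector_field_0: "vector_field A 0"
  by (simp add: vector_field_def tangent_0 smooth_on_const open_chart_image)

lemma vector_field_add: "vector_field A X \<Longrightarrow> vector_field A Y \<Longrightarrow> vector_field A (X + Y)"
  by (simp add: vector_field_def tangent_add smooth_on_add open_chart_image)

lemma vector_field_minus: "vector_field A X \<Longrightarrow> vector_field A (- X)"
  by (simp add: vector_field_def tangent_minus smooth_on_minus open_chart_image)

lemma vector_field_diff: "vector_field A X \<Longrightarrow> vector_field A Y \<Longrightarrow> vector_field A (X - Y)"
  by (simp add: vector_field_def tangent_diff smooth_on_diff open_chart_image)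

lemma vector_field_sum: "(\<And>i. i \<in> I \<Longrightarrow> vector_field A (f i)) \<Longrightarrow> vector_field A (\<Sum>i\<in>I. f i)"
  by (induction I rule: infinite_finite_induct) (auto intro: vector_field_0 vector_field_add)

lemma vector_field_scale: "smooth_function A f \<Longrightarrow> vector_field A X \<Longrightarrow> vector_field A (field_scale f X)"
  by (simp add: vector_field_def smooth_function_def tangent_scale field_scale_def comp_def
      smooth_on_scaleR open_chart_image)

lemma vector_field_eqI:
  assumes "vector_field A X" "vector_field A Y" "\<And>p. p \<in> carrier A \<Longrightarrow> X p = Y p"
  shows "X = Y"
proof
  fix p show "X p = Y p"
    using assms(3) tangent_outside_carrier[OF vector_field_tangent[OF assms(1)]]
      tangent_outside_carrier[OF vector_field_tangent[OF assms(2)]] by (cases "p \<in> carrier A") auto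
qed

text \<open>In coordinates an endomorphism field is a matrix that depends on the point.\<close>

definition chart_endo :: "('m, 'e) endo \<Rightarrow> ('m, 'e) chart \<Rightarrow> 'e \<Rightarrow> 'e \<Rightarrow> 'e" where
  "chart_endo J c x e = J (inv_chart c x) (chart_vector A c (inv_chart c x) e) c"

context
  fixes J :: "('m, 'e) endo" assumes J: "endo_field A J"
begin

lemma endo_tangent: "v \<in> tangent_space A p \<Longrightarrow> J p v \<in> tangent_space A p"
  using J by (simp add: endo_field_def linear_between_def)

lemma endo_add: "v \<in> tangent_space A p \<Longrightarrow> w \<in> tangent_space A p \<Longrightarrow> J p (v + w) = J p v + J p w"
  using J by (simp add: endo_field_def linear_between_def)

lemma endo_scale: "v \<in> tangent_space A p \<Longrightarrow> J p (\<lambda>c. r *\<^sub>R v c) = (\<lambda>c. r *\<^sub>R J p v c)"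
  using J by (simp add: endo_field_def linear_between_def)

lemma endo_minus: "v \<in> tangent_space A p \<Longrightarrow> J p (- v) = - J p v"
  using endo_scale[of v p "-1"] by (simp add: fun_Compl_def)

lemma endo_diff: "v \<in> tangent_space A p \<Longrightarrow> w \<in> tangent_space A p \<Longrightarrow> J p (v - w) = J p v - J p w"
  using endo_add[of v p "- w"] by (simp add: tangent_minus endo_minus)

lemma endo_0: "J p 0 = 0"
  using endo_add[OF tangent_0 tangent_0, of p] by simp

lemma chart_endo_component:
  "v \<in> tangent_space A p \<Longrightarrow> c \<in> A \<Longrightarrow> p \<in> fst c \<Longrightarrow> J p v c = chart_endo J c (snd c p) (v c)"
  by (simp add: chart_endo_def inv_chart_snd chart_vector_component)

lemma linear_chart_endo: "c \<in> A \<Longrightarrow> x \<in> chart_image c \<Longrightarrow> linear (chart_endo J c x)"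
  using inv_chart_in[of x c]
  by (intro linearI) (auto simp: chart_endo_def chart_vector_add chart_vector_scale endo_add endo_scale chart_vector_tangent)

lemma smooth_chart_endo: "c \<in> A \<Longrightarrow> smooth_on (chart_image c) (\<lambda>x. chart_endo J c x e)"
  using J by (simp add: endo_field_def chart_endo_def)

lemma chart_endo_apply:
  assumes "vector_field A X" "c \<in> A" "x \<in> chart_image c"
  shows "endo_apply J X (inv_chart c x) c = chart_endo J c x (X (inv_chart c x) c)"
  using chart_endo_component[OF vector_field_tangent[OF assms(1)] assms(2) inv_chart_in[OF assms(3)]] assms
  by (simp add: endo_apply_def snd_inv_chart)

lemma vector_field_endo_apply: "vector_field A X \<Longrightarrow> vector_field A (endo_apply J X)"
  unfolding vector_field_def[of A "endo_apply J X"]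
proof (intro conjI allI ballI)
  assume X: "vector_field A X"
  show "endo_apply J X p \<in> tangent_space A p" for p
    by (simp add: endo_apply_def endo_tangent vector_field_tangent X)
  fix c assume c: "c \<in> A"
  have "smooth_on (chart_image c) (\<lambda>x. chart_endo J c x (X (inv_chart c x) c))"
    by (rule smooth_on_linear_field[OF open_chart_image[OF c] linear_chart_endo[OF c] smooth_chart_endo[OF c]
          vector_field_smooth[OF X c]])
  then show "smooth_on (chart_image c) (\<lambda>x. endo_apply J X (inv_chart c x) c)"
    by (rule smooth_on_cong[OF open_chart_image[OF c], THEN iffD1, rotated]) (simp add: chart_endo_apply X c)
qed

end

text \<open>The bracket transforms like a vector because the second derivative of a chart transition,
  which enters the derivative of the transformed components, is symmetric.\<close>

lemma lie_bracket_tangent: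
  assumes X: "vector_field A X" and Y: "vector_field A Y"
  shows "lie_bracket A X Y p \<in> tangent_space A p"
proof (rule tangent_spaceI)
  show "lie_bracket A X Y p c = 0" if "\<not> (c \<in> A \<and> p \<in> fst c)" for c
    using that by (auto simp: lie_bracket_def)
next
  fix c d assume cd: "c \<in> A" "d \<in> A" "p \<in> fst c" "p \<in> fst d"
  let ?\<tau> = "snd d \<circ> inv_chart c" and ?x = "snd c p"
  define S where "S = snd c ` (fst c \<inter> fst d)"
  have S: "open S" "?x \<in> S" using open_overlap[OF cd(1,2)] cd by (auto simp: S_def)
  have \<tau>: "smooth_on S ?\<tau>" unfolding S_def by (rule smooth_transition[OF cd(1,2)])
  \<comment> \<open>The extra term when transformed components are differentiated; by symmetry it drops out of the bracket.\<close>
  define D2 where "D2 u v = frechet_derivative (\<lambda>y. frechet_derivative ?\<tau> (at y) u) (at ?x) v" for u v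
  have key: "frechet_derivative (\<lambda>x. Z (inv_chart d x) d) (at (snd d p)) (W p d) =
      D2 (Z p c) (W p c) + frechet_derivative ?\<tau> (at ?x) (frechet_derivative (\<lambda>x. Z (inv_chart c x) c) (at ?x) (W p c))"
    if Z: "vector_field A Z" and W: "vector_field A W" for Z W
  proof -
    let ?Zc = "\<lambda>x. Z (inv_chart c x) c" and ?Zd = "\<lambda>x. Z (inv_chart d x) d"
    have 1: "((\<lambda>x. frechet_derivative ?\<tau> (at x) (?Zc x)) has_derivative
        (\<lambda>h. D2 (?Zc ?x) h + frechet_derivative ?\<tau> (at ?x) (frechet_derivative ?Zc (at ?x) h))) (at ?x)"
      unfolding D2_def
      by (rule has_derivative_linear_field[OF S linear_frechet_derivative_smooth[OF \<tau>]
            smooth_on_has_derivative[OF smooth_on_frechet[OF \<tau>] S(2)]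
            smooth_on_has_derivative[OF vector_field_smooth[OF Z cd(1)]]]) (use cd in auto)
    have "(?Zd has_derivative frechet_derivative ?Zd (at (?\<tau> ?x))) (at (?\<tau> ?x))"
      by (rule smooth_on_has_derivative[OF vector_field_smooth[OF Z cd(2)]]) (use cd in \<open>auto simp: inv_chart_snd\<close>)
    from has_derivative_compose[OF transition_has_derivative[OF cd] this]
    have 2: "((\<lambda>x. frechet_derivative ?\<tau> (at x) (?Zc x)) has_derivative
        (\<lambda>h. frechet_derivative ?Zd (at (?\<tau> ?x)) (transition_derivative c d p h))) (at ?x)"
    proof (rule has_derivative_transform_within_open[OF _ S])
      fix y assume "y \<in> S"
      then obtain q where q: "q \<in> fst c" "q \<in> fst d" "y = snd c q" by (auto simp: S_def)
      then show "?Zd (?\<tau> y) = frechet_derivative ?\<tau> (at y) (?Zc y)"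
        using tangent_component[OF vector_field_tangent[OF Z] cd(1,2) q(1,2)] cd by (simp add: inv_chart_snd)
    qed
    from has_derivative_unique[OF 2 1] have
      "frechet_derivative ?Zd (at (?\<tau> ?x)) (transition_derivative c d p (W p c)) =
       D2 (?Zc ?x) (W p c) + frechet_derivative ?\<tau> (at ?x) (frechet_derivative ?Zc (at ?x) (W p c))"
      by (rule fun_cong)
    then show ?thesis
      using tangent_component[OF vector_field_tangent[OF W] cd, symmetric] cd by (simp add: inv_chart_snd)
  qed
  have sym: "D2 u v = D2 v u" for u v
    unfolding D2_def by (rule symmetric_second_derivative[OF S \<tau>])
  show "lie_bracket A X Y p d = transition_derivative c d p (lie_bracket A X Y p c)"
    using cd key[OF X Y] key[OF Y X] sym[of "X p c" "Y p c"]
    by (simp add: lie_bracket_def linear_diff[OF linear_transition_derivative[OF cd]])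
qed

end

section \<open>Cutting off and extending local data\<close>

locale hausdorff_atlas = smooth_atlas A for A :: "('m, 'e::euclidean_space) atlas" +
  assumes Hausdorff: "Hausdorff_space (manifold_topology A)"
begin

lemma continuous_map_inv_chart:
  assumes "c \<in> A"
  shows "continuous_map (top_of_set (chart_image c)) (manifold_topology A) (inv_chart c)"
  unfolding manifold_topology_def
proof (rule continuous_on_generated_topo)
  fix U assume "U \<in> {fst d \<inter> snd d -` W |d W. d \<in> A \<and> open W}"
  then obtain d W where d: "d \<in> A" and W: "open W" and U: "U = fst d \<inter> snd d -` W" by auto
  have "inv_chart c -` U \<inter> chart_image c = snd c ` (fst c \<inter> fst d) \<inter> (snd d \<circ> inv_chart c) -` W"
    by (auto simp: U overlap_eq[OF assms])
  then have "open (inv_chart c -` U \<inter> chart_image c)"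
    using continuous_open_preimage[OF smooth_on_imp_continuous_on[OF smooth_transition[OF assms d]] open_overlap[OF assms d] W]
    by simp
  then show "openin (top_of_set (chart_image c)) (inv_chart c -` U \<inter> topspace (top_of_set (chart_image c)))"
    by (simp add: open_chart_image[OF assms] openin_open_eq)
next
  have "fst c \<inter> snd c -` UNIV \<in> {fst d \<inter> snd d -` W |d W. d \<in> A \<and> open W}"
    by (intro CollectI exI[of _ c] exI[of _ UNIV]) (simp add: assms)
  then have "fst c \<inter> snd c -` UNIV \<subseteq> \<Union> {fst d \<inter> snd d -` W |d W. d \<in> A \<and> open W}"
    by (rule Sup_upper)
  then have "fst c \<subseteq> \<Union> {fst d \<inter> snd d -` W |d W. d \<in> A \<and> open W}"
    by simp
  moreover have "inv_chart c ` topspace (top_of_set (chart_image c)) \<subseteq> fst c"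
    by (simp add: image_subset_iff inv_chart_in)
  ultimately show "inv_chart c ` topspace (top_of_set (chart_image c)) \<subseteq> \<Union> {fst d \<inter> snd d -` W |d W. d \<in> A \<and> open W}"
    by (rule order_trans[rotated])
qed

text \<open>This is where the Hausdorff property enters: a compact subset of a chart domain is closed in
  the whole manifold, so that data supported in it can be extended by zero.\<close>

lemma open_complement_compact:
  assumes "c \<in> A" "d \<in> A" "compact C" "C \<subseteq> chart_image c"
  shows "open {y \<in> chart_image d. inv_chart d y \<notin> inv_chart c ` C}"
proof -
  have "compactin (top_of_set (chart_image c)) C"
    using assms by (simp add: compactin_subtopology)
  then have "closedin (manifold_topology A) (inv_chart c ` C)"
    by (intro compactin_imp_closedin[OF Hausdorff] image_compactin[OF _ continuous_map_inv_chart[OF assms(1)]])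
  from closedin_continuous_map_preimage[OF continuous_map_inv_chart[OF assms(2)] this]
  have "openin (top_of_set (chart_image d)) (chart_image d - {y \<in> chart_image d. inv_chart d y \<in> inv_chart c ` C})"
    by (simp add: closedin_def)
  moreover have "chart_image d - {y \<in> chart_image d. inv_chart d y \<in> inv_chart c ` C} =
      {y \<in> chart_image d. inv_chart d y \<notin> inv_chart c ` C}" by blast
  ultimately show ?thesis using open_chart_image[OF assms(2)] by (simp add: openin_open_eq)
qed

text \<open>A bump function around \<open>x\<close> turns any smooth function or field of components given on \<open>V\<close> into a global
  one without changing it near \<open>x\<close>.\<close>

lemma cutoff_exists:
  assumes c: "c \<in> A" and V: "open V" "V \<subseteq> chart_image c" and x: "x \<in> V"
  obtains f :: "'m \<Rightarrow> real" and W where "smooth_function A f" "open W" "x \<in> W" "W \<subseteq> V"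
    "\<forall>y\<in>W. f (inv_chart c y) = 1" "\<forall>q. q \<notin> inv_chart c ` V \<longrightarrow> f q = 0"
    "\<forall>u. smooth_on V u \<longrightarrow> smooth_function A (\<lambda>q. f q * u (snd c q))"
    "\<forall>u. smooth_on V u \<longrightarrow>
      vector_field A (\<lambda>q. if q \<in> inv_chart c ` V then chart_vector A c q (f q *\<^sub>R u (snd c q)) else 0)"
proof -
  obtain \<phi> :: "'e \<Rightarrow> real" and W C where \<phi>: "smooth_on UNIV \<phi>" and W1: "open W" and C1: "compact C"
    and W2: "x \<in> W" "W \<subseteq> C" and C2: "C \<subseteq> V"
    and \<phi>1: "\<forall>y\<in>W. \<phi> y = 1" and \<phi>0: "\<forall>y. y \<notin> C \<longrightarrow> \<phi> y = 0"
    by (rule bump_function_exists[OF V(1) x])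
  note W = W1 W2 and C = C1 C2
  define f where "f q = (if q \<in> inv_chart c ` V then \<phi> (snd c q) else 0)" for q
  have in_fst: "q \<in> fst c" if "q \<in> inv_chart c ` V" for q using that V(2) inv_chart_in[of _ c] by fastforce
  have f_in: "f (inv_chart c y) = \<phi> y" if "y \<in> V" for y
    using that V(2) snd_inv_chart[of y c] by (auto simp: f_def)
  have f_zero: "f q = 0" if "q \<notin> inv_chart c ` C" for q
  proof (cases "q \<in> inv_chart c ` V")
    case True
    then obtain y where "y \<in> V" "q = inv_chart c y" by auto
    then show ?thesis using that f_in[of y] \<phi>0 by auto
  qed (simp add: f_def)
  have V\<phi>: "smooth_on V \<phi>" using smooth_on_subset[OF \<phi>] by simp
  \<comment> \<open>Every point lies in \<open>V\<close> or in the open complement of the support, where everything vanishes.\<close>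
  have cover: "\<exists>d\<in>A. \<exists>U. open U \<and> U \<subseteq> chart_image d \<and> p \<in> inv_chart d ` U \<and> P d U"
    if "p \<in> carrier A" and inside: "P c V"
      and outside: "\<And>d. d \<in> A \<Longrightarrow> P d {y \<in> chart_image d. inv_chart d y \<notin> inv_chart c ` C}" for p P
  proof (cases "p \<in> inv_chart c ` V")
    case True
    then show ?thesis using V inside c by blast
  next
    case False
    let ?d = "chart_at A p"
    have d: "?d \<in> A" "p \<in> fst ?d" using chart_at[OF that(1)] .
    have "p = inv_chart ?d (snd ?d p)" using d by (simp add: inv_chart_snd)
    then have "p \<in> inv_chart ?d ` {y \<in> chart_image ?d. inv_chart ?d y \<notin> inv_chart c ` C}"
      using False d C(2) by (intro image_eqI[where x="snd ?d p"]) auto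
    moreover have "open {y \<in> chart_image ?d. inv_chart ?d y \<notin> inv_chart c ` C}"
      using C V(2) by (intro open_complement_compact c d) auto
    ultimately show ?thesis using outside[OF d(1)] d(1) by blast
  qed
  have fu: "smooth_function A (\<lambda>q. f q * u (snd c q))" if u: "smooth_on V u" for u
  proof (rule smooth_functionI, erule cover)
    have "smooth_on V (\<lambda>y. \<phi> y * u y)" by (rule smooth_on_mult[OF V(1) V\<phi> u])
    then show "smooth_on V ((\<lambda>q. f q * u (snd c q)) \<circ> inv_chart c)"
      by (rule smooth_on_cong[OF V(1), THEN iffD1, rotated]) (use V(2) in \<open>auto simp: f_in snd_inv_chart\<close>)
    fix d assume d: "d \<in> A"
    have "open {y \<in> chart_image d. inv_chart d y \<notin> inv_chart c ` C}"
      using C V(2) by (intro open_complement_compact c d) auto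
    then show "smooth_on {y \<in> chart_image d. inv_chart d y \<notin> inv_chart c ` C} ((\<lambda>q. f q * u (snd c q)) \<circ> inv_chart d)"
      by (rule smooth_on_zero) (simp add: f_zero)
  qed
  have vf: "vector_field A (\<lambda>q. if q \<in> inv_chart c ` V then chart_vector A c q (f q *\<^sub>R u (snd c q)) else 0)"
    (is "vector_field A ?X") if u: "smooth_on V u" for u
  proof (rule vector_fieldI)
    show "?X p \<in> tangent_space A p" for p
      by (simp add: tangent_0 chart_vector_tangent[OF c in_fst])
    fix p assume "p \<in> carrier A"
    then show "\<exists>d\<in>A. \<exists>U. open U \<and> U \<subseteq> chart_image d \<and> p \<in> inv_chart d ` U \<and> smooth_on U (\<lambda>x. ?X (inv_chart d x) d)"
    proof (rule cover)
      have "smooth_on V (\<lambda>y. \<phi> y *\<^sub>R u y)" by (rule smooth_on_scaleR[OF V(1) V\<phi> u])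
      then show "smooth_on V (\<lambda>x. ?X (inv_chart c x) c)"
        by (rule smooth_on_cong[OF V(1), THEN iffD1, rotated])
          (use V(2) in \<open>auto simp: f_in snd_inv_chart chart_vector_self[OF c in_fst]\<close>)
      fix d assume d: "d \<in> A"
      have "chart_vector A c q 0 = 0" if "q \<in> inv_chart c ` V" for q
        by (rule tangent_eqI[of _ q _ c]) (use in_fst[OF that] c in \<open>auto simp: chart_vector_tangent tangent_0 chart_vector_self\<close>)
      then have *: "?X q = 0" if "q \<notin> inv_chart c ` C" for q using that f_zero by simp
      have "open {y \<in> chart_image d. inv_chart d y \<notin> inv_chart c ` C}"
        using C V(2) by (intro open_complement_compact c d) auto
      then show "smooth_on {y \<in> chart_image d. inv_chart d y \<notin> inv_chart c ` C} (\<lambda>x. ?X (inv_chart d x) d)"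
        by (rule smooth_on_zero) (simp add: * del: image_iff)
    qed
  qed
  show ?thesis
  proof (rule that[of f W])
    show "smooth_function A f" using fu[OF smooth_on_const[OF V(1), of 1]] by simp
    show "\<forall>y\<in>W. f (inv_chart c y) = 1" using W(3) C(2) \<phi>1 f_in by auto
  qed (use W C fu vf in \<open>auto simp: f_def\<close>)
qed

lemma extend_local_field:
  assumes c: "c \<in> A" and V: "open V" "V \<subseteq> chart_image c" and x: "x \<in> V" and u: "smooth_on V u"
  obtains X W where "vector_field A X" "open W" "x \<in> W" "W \<subseteq> V" "\<forall>y\<in>W. X (inv_chart c y) c = u y"
proof -
  obtain f :: "'m \<Rightarrow> real" and W where f: "smooth_function A f" "open W" "x \<in> W" "W \<subseteq> V"
    "\<forall>y\<in>W. f (inv_chart c y) = 1" "\<forall>q. q \<notin> inv_chart c ` V \<longrightarrow> f q = 0"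
    "\<forall>u. smooth_on V u \<longrightarrow> smooth_function A (\<lambda>q. f q * u (snd c q))"
    "\<forall>u. smooth_on V u \<longrightarrow>
      vector_field A (\<lambda>q. if q \<in> inv_chart c ` V then chart_vector A c q (f q *\<^sub>R u (snd c q)) else 0)"
    by (rule cutoff_exists[OF assms(1-4)])
  show ?thesis
  proof (rule that[OF f(8)[rule_format, OF u] f(2-4)], rule ballI)
    fix y assume y: "y \<in> W"
    then have "y \<in> V" "y \<in> chart_image c" using f V by auto
    then show "(if inv_chart c y \<in> inv_chart c ` V
         then chart_vector A c (inv_chart c y) (f (inv_chart c y) *\<^sub>R u (snd c (inv_chart c y))) else 0) c = u y"
      using f(5) y by (simp add: chart_vector_self[OF c inv_chart_in] snd_inv_chart)
  qed
qed

lemma vector_field_through: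
  assumes "v \<in> tangent_space A p"
  obtains X where "vector_field A X" "X p = v"
proof (cases "p \<in> carrier A")
  case True
  define c where "c = chart_at A p"
  have c: "c \<in> A" "p \<in> fst c" using chart_at[OF True] by (auto simp: c_def)
  then have x: "snd c p \<in> chart_image c" by simp
  obtain X W where X: "vector_field A X" "open W" "snd c p \<in> W" "W \<subseteq> chart_image c" "\<forall>y\<in>W. X (inv_chart c y) c = v c"
    by (rule extend_local_field[OF c(1) open_chart_image[OF c(1)] order_refl x smooth_on_const[OF open_chart_image[OF c(1)], of "v c"]])
  have "X (inv_chart c (snd c p)) c = v c" using X(5) X(3) by blast
  then have "X p c = v c" using c by (simp add: inv_chart_snd)
  then have "X p = v" by (rule tangent_eqI[OF vector_field_tangent[OF X(1)] assms c])
  then show ?thesis using that X(1) by blast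
next
  case False
  then show ?thesis using that[OF vector_field_0] tangent_outside_carrier[OF assms] by simp
qed

end

section \<open>Connections in a chart\<close>

lemma sum_fun_apply: "(\<Sum>i\<in>I. F i) q = (\<Sum>i\<in>I. F i q)"
  by (induction I rule: infinite_finite_induct) auto

locale connection_atlas = hausdorff_atlas A for A :: "('m, 'e::euclidean_space) atlas" +
  fixes D :: "('m, 'e) connection"
  assumes connection: "affine_connection A D"
begin

lemma D_field: "vector_field A X \<Longrightarrow> vector_field A Y \<Longrightarrow> vector_field A (D X Y)"
  using connection by (simp add: affine_connection_def)

lemma D_add_left:
  "vector_field A X \<Longrightarrow> vector_field A Y \<Longrightarrow> vector_field A Z \<Longrightarrow> D (X + Y) Z = D X Z + D Y Z"
  using connection unfolding affine_connection_def by blast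

lemma D_add_right:
  "vector_field A X \<Longrightarrow> vector_field A Y \<Longrightarrow> vector_field A Z \<Longrightarrow> D X (Y + Z) = D X Y + D X Z"
  using connection unfolding affine_connection_def by blast

lemma D_scale_left:
  "smooth_function A f \<Longrightarrow> vector_field A X \<Longrightarrow> vector_field A Y \<Longrightarrow>
    D (field_scale f X) Y = field_scale f (D X Y)"
  using connection unfolding affine_connection_def by blast

lemma D_scale_right:
  "smooth_function A f \<Longrightarrow> vector_field A X \<Longrightarrow> vector_field A Y \<Longrightarrow>
    D X (field_scale f Y) = field_scale (field_derivative A X f) Y + field_scale f (D X Y)"
  using connection unfolding affine_connection_def by blast

lemma D_0_left: "vector_field A Y \<Longrightarrow> D 0 Y = 0"
  using D_add_left[OF vector_field_0 vector_field_0, of Y] by simp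

lemma D_0_right: "vector_field A X \<Longrightarrow> D X 0 = 0"
  using D_add_right[OF _ vector_field_0 vector_field_0, of X] by simp

lemma D_minus_left: "vector_field A X \<Longrightarrow> vector_field A Y \<Longrightarrow> D (- X) Y = - D X Y"
  using D_add_left[of X "- X" Y] by (simp add: vector_field_minus D_0_left eq_neg_iff_add_eq_0 add.commute)

lemma D_minus_right: "vector_field A X \<Longrightarrow> vector_field A Y \<Longrightarrow> D X (- Y) = - D X Y"
  using D_add_right[of X Y "- Y"] by (simp add: vector_field_minus D_0_right eq_neg_iff_add_eq_0 add.commute)

lemma D_sum_left:
  "(\<And>i. i \<in> I \<Longrightarrow> vector_field A (f i)) \<Longrightarrow> vector_field A Y \<Longrightarrow> D (\<Sum>i\<in>I. f i) Y = (\<Sum>i\<in>I. D (f i) Y)"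
  by (induction I rule: infinite_finite_induct) (auto simp: D_0_left D_add_left vector_field_sum)

lemma D_sum_right:
  "(\<And>i. i \<in> I \<Longrightarrow> vector_field A (f i)) \<Longrightarrow> vector_field A X \<Longrightarrow> D X (\<Sum>i\<in>I. f i) = (\<Sum>i\<in>I. D X (f i))"
  by (induction I rule: infinite_finite_induct) (auto simp: D_0_right D_add_right vector_field_sum)

text \<open>A cutoff function that is 1 near the point turns the local expansion of the fields in the
  frame \<open>E\<close> into a global one, to which linearity and the Leibniz rule apply.\<close>

lemma connection_in_frame:
  assumes c: "c \<in> A" and V: "open V" "V \<subseteq> chart_image c" and x: "x \<in> V"
    and E: "\<And>i. i \<in> Basis \<Longrightarrow> vector_field A (E i)"
    and Ec: "\<And>i y. i \<in> Basis \<Longrightarrow> y \<in> V \<Longrightarrow> E i (inv_chart c y) c = i"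
    and X: "vector_field A X" and Y: "vector_field A Y"
  shows "D X Y (inv_chart c x) c =
    frechet_derivative (\<lambda>y. Y (inv_chart c y) c) (at x) (X (inv_chart c x) c) +
    (\<Sum>i\<in>Basis. \<Sum>j\<in>Basis. ((X (inv_chart c x) c \<bullet> i) * (Y (inv_chart c x) c \<bullet> j)) *\<^sub>R
        D (E i) (E j) (inv_chart c x) c)"
proof -
  let ?p = "inv_chart c x"
  obtain f :: "'m \<Rightarrow> real" and W where f: "smooth_function A f" and W: "open W" "x \<in> W" "W \<subseteq> V"
    and f1: "\<forall>y\<in>W. f (inv_chart c y) = 1" and f0: "\<forall>q. q \<notin> inv_chart c ` V \<longrightarrow> f q = 0"
    and fu: "\<forall>u. smooth_on V u \<longrightarrow> smooth_function A (\<lambda>q. f q * u (snd c q))"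
    and "\<forall>u. smooth_on V u \<longrightarrow>
      vector_field A (\<lambda>q. if q \<in> inv_chart c ` V then chart_vector A c q (f q *\<^sub>R u (snd c q)) else 0)"
    by (rule cutoff_exists[OF c V x])
  have xc: "x \<in> chart_image c" using x V by auto
  have p: "?p \<in> fst c" "snd c ?p = x" using xc by (auto simp: inv_chart_in snd_inv_chart)
  have fp: "f ?p = 1" using f1 W(2) by blast
  define Zc where "Zc Z i q = f q * (Z (inv_chart c (snd c q)) c \<bullet> i)" for Z :: "('m, 'e) vfield" and i q
  have sm: "smooth_on V (\<lambda>y. Z (inv_chart c y) c)" if "vector_field A Z" for Z
    using smooth_on_subset[OF vector_field_smooth[OF that c] V(2)] .
  have Zc: "smooth_function A (Zc Z i)" if "vector_field A Z" for Z i
    unfolding Zc_def[abs_def] by (rule fu[rule_format], intro smooth_on_inner V sm that smooth_on_const)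
  have Zcp: "Zc Z i ?p = Z ?p c \<bullet> i" for Z i by (simp add: Zc_def fp p)
  \<comment> \<open>The expansion in the frame holds over \<open>V\<close>; multiplied by \<open>f\<close>, which vanishes elsewhere, it holds globally.\<close>
  have decomp: "field_scale f Z = (\<Sum>i\<in>Basis. field_scale (Zc Z i) (E i))" if Z: "vector_field A Z" for Z
  proof (rule vector_field_eqI)
    show "vector_field A (field_scale f Z)" by (rule vector_field_scale[OF f Z])
    show S: "vector_field A (\<Sum>i\<in>Basis. field_scale (Zc Z i) (E i))"
      by (intro vector_field_sum vector_field_scale Zc Z E)
    show "field_scale f Z q = (\<Sum>i\<in>Basis. field_scale (Zc Z i) (E i)) q" for q
    proof (cases "q \<in> inv_chart c ` V")
      case True
      then obtain y where y: "y \<in> V" "q = inv_chart c y" by auto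
      then have yc: "y \<in> chart_image c" using V by auto
      have q: "q \<in> fst c" "snd c q = y" using yc y by (auto simp: inv_chart_in snd_inv_chart)
      show ?thesis
      proof (rule tangent_eqI[OF vector_field_tangent[OF vector_field_scale[OF f Z]] vector_field_tangent[OF S] c q(1)])
        have "(\<Sum>i\<in>Basis. field_scale (Zc Z i) (E i)) q c = f q *\<^sub>R (\<Sum>i\<in>Basis. (Z q c \<bullet> i) *\<^sub>R i)"
          using y q by (simp add: sum_fun_apply field_scale_def Zc_def Ec scaleR_sum_right)
        then show "field_scale f Z q c = (\<Sum>i\<in>Basis. field_scale (Zc Z i) (E i)) q c"
          by (simp add: euclidean_representation field_scale_def)
      qed
    next
      case False
      then show ?thesis by (simp add: sum_fun_apply field_scale_def Zc_def f0 fun_eq_iff)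
    qed
  qed
  have left: "D X Z ?p c = (\<Sum>i\<in>Basis. (X ?p c \<bullet> i) *\<^sub>R D (E i) Z ?p c)" if Z: "vector_field A Z" for Z
  proof -
    have "D X Z ?p c = D (field_scale f X) Z ?p c"
      unfolding D_scale_left[OF f X Z] by (simp add: field_scale_def fp)
    also have "\<dots> = (\<Sum>i\<in>Basis. field_scale (Zc X i) (D (E i) Z)) ?p c"
      by (simp add: decomp[OF X] D_sum_left vector_field_scale Zc X E Z D_scale_left)
    finally show ?thesis by (simp add: sum_fun_apply field_scale_def Zcp)
  qed
  have diff_f: "field_derivative A X f ?p = 0"
  proof -
    have "((f \<circ> inv_chart c) has_derivative (\<lambda>_. 0)) (at x)"
      by (rule has_derivative_transform_within_open[OF has_derivative_const[of 1] W(1,2)]) (simp add: f1)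
    then have "(f \<circ> inv_chart c) differentiable (at (snd c ?p))" "frechet_derivative (f \<circ> inv_chart c) (at (snd c ?p)) = (\<lambda>_. 0)"
      unfolding p(2) by (auto simp: differentiable_def dest: frechet_derivative_at)
    then show ?thesis using field_derivative_eq[of X ?p c f] vector_field_tangent[OF X] c p(1) by simp
  qed
  have diff_Y: "field_derivative A X (Zc Y j) ?p = frechet_derivative (\<lambda>y. Y (inv_chart c y) c) (at x) (X ?p c) \<bullet> j" for j
  proof -
    have "((\<lambda>y. Y (inv_chart c y) c \<bullet> j) has_derivative
        (\<lambda>h. frechet_derivative (\<lambda>y. Y (inv_chart c y) c) (at x) h \<bullet> j)) (at x)"
      by (rule has_derivative_inner_left[OF smooth_on_has_derivative[OF sm[OF Y] x]])
    then have "((Zc Y j \<circ> inv_chart c) has_derivative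
        (\<lambda>h. frechet_derivative (\<lambda>y. Y (inv_chart c y) c) (at x) h \<bullet> j)) (at x)"
      by (rule has_derivative_transform_within_open[OF _ W(1,2)])
        (use W V in \<open>auto simp: Zc_def f1 snd_inv_chart subset_iff\<close>)
    then have "(Zc Y j \<circ> inv_chart c) differentiable (at (snd c ?p))"
      "(\<lambda>h. frechet_derivative (\<lambda>y. Y (inv_chart c y) c) (at x) h \<bullet> j) = frechet_derivative (Zc Y j \<circ> inv_chart c) (at (snd c ?p))"
      unfolding p(2) by (blast intro: differentiableI, rule frechet_derivative_at)
    then show ?thesis using field_derivative_eq[of X ?p c "Zc Y j"] vector_field_tangent[OF X] c p(1) by (simp add: fun_eq_iff)
  qed
  have "D X Y ?p c = D X (field_scale f Y) ?p c"
    unfolding D_scale_right[OF f X Y] by (simp add: field_scale_def fp diff_f)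
  also have "\<dots> = (\<Sum>j\<in>Basis. field_scale (field_derivative A X (Zc Y j)) (E j) + field_scale (Zc Y j) (D X (E j))) ?p c"
    by (simp add: decomp[OF Y] D_sum_right vector_field_scale Zc X E Y D_scale_right)
  also have "\<dots> = (\<Sum>j\<in>Basis. (frechet_derivative (\<lambda>y. Y (inv_chart c y) c) (at x) (X ?p c) \<bullet> j) *\<^sub>R j)
      + (\<Sum>j\<in>Basis. (Y ?p c \<bullet> j) *\<^sub>R D X (E j) ?p c)"
    by (simp add: sum_fun_apply field_scale_def diff_Y Zcp Ec x sum.distrib)
  also have "(\<Sum>j\<in>Basis. (Y ?p c \<bullet> j) *\<^sub>R D X (E j) ?p c) =
      (\<Sum>i\<in>Basis. \<Sum>j\<in>Basis. ((X ?p c \<bullet> i) * (Y ?p c \<bullet> j)) *\<^sub>R D (E i) (E j) ?p c)"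
    by (subst sum.swap) (simp add: left E scaleR_sum_right mult.commute)
  finally show ?thesis by (simp add: euclidean_representation)
qed

text \<open>Near the point the components are constant, so their derivative does not contribute to a covariant
  derivative, and only the Christoffel symbol remains.\<close>

definition local_constant_field :: "('m, 'e) chart \<Rightarrow> 'e \<Rightarrow> 'e \<Rightarrow> ('m, 'e) vfield" where
  "local_constant_field c x a = (SOME X. vector_field A X \<and>
     (\<exists>W. open W \<and> x \<in> W \<and> W \<subseteq> chart_image c \<and> (\<forall>y\<in>W. X (inv_chart c y) c = a)))"

definition christoffel :: "('m, 'e) chart \<Rightarrow> 'e \<Rightarrow> 'e \<Rightarrow> 'e \<Rightarrow> 'e" where
  "christoffel c x a b = D (local_constant_field c x a) (local_constant_field c x b) (inv_chart c x) c"

lemma local_constant_field: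
  assumes "c \<in> A" "x \<in> chart_image c"
  shows "vector_field A (local_constant_field c x a)"
    and "\<exists>W. open W \<and> x \<in> W \<and> W \<subseteq> chart_image c \<and> (\<forall>y\<in>W. local_constant_field c x a (inv_chart c y) c = a)"
proof -
  have "\<exists>X. vector_field A X \<and> (\<exists>W. open W \<and> x \<in> W \<and> W \<subseteq> chart_image c \<and> (\<forall>y\<in>W. X (inv_chart c y) c = a))"
    by (rule extend_local_field[OF assms(1) open_chart_image[OF assms(1)] order_refl assms(2)
        smooth_on_const[OF open_chart_image[OF assms(1)], of a]]) blast
  from someI_ex[OF this] show "vector_field A (local_constant_field c x a)"
    and "\<exists>W. open W \<and> x \<in> W \<and> W \<subseteq> chart_image c \<and> (\<forall>y\<in>W. local_constant_field c x a (inv_chart c y) c = a)"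
    unfolding local_constant_field_def by auto
qed

text \<open>The Christoffel symbols are defined pointwise, with fields chosen anew at every point. One frame \<open>E\<close> that
  is constant near \<open>x\<close> represents them all on a neighbourhood; this shows that they do not depend on the
  choices and vary smoothly.\<close>

lemma christoffel_near:
  assumes c: "c \<in> A" and x: "x \<in> chart_image c"
  obtains V E where "open V" "x \<in> V" "V \<subseteq> chart_image c" "\<And>i. i \<in> Basis \<Longrightarrow> vector_field A (E i)"
    "\<And>y a b. y \<in> V \<Longrightarrow> christoffel c y a b =
        (\<Sum>i\<in>Basis. \<Sum>j\<in>Basis. ((a \<bullet> i) * (b \<bullet> j)) *\<^sub>R D (E i) (E j) (inv_chart c y) c)"
    "\<And>X Y y. y \<in> V \<Longrightarrow> vector_field A X \<Longrightarrow> vector_field A Y \<Longrightarrow> D X Y (inv_chart c y) c =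
        frechet_derivative (\<lambda>y. Y (inv_chart c y) c) (at y) (X (inv_chart c y) c) +
        christoffel c y (X (inv_chart c y) c) (Y (inv_chart c y) c)"
proof -
  define E where "E = local_constant_field c x"
  obtain W where W: "\<And>i. open (W i)" "\<And>i. x \<in> W i" "\<And>i. W i \<subseteq> chart_image c"
    "\<And>i y. y \<in> W i \<Longrightarrow> E i (inv_chart c y) c = i"
    using local_constant_field(2)[OF c x] unfolding E_def by metis
  define V where "V = chart_image c \<inter> (\<Inter>i\<in>Basis. W i)"
  have "open V" unfolding V_def by (intro open_Int open_INT open_chart_image[OF c] ballI W(1) finite_Basis)
  moreover have "x \<in> V" unfolding V_def using W(2) x by blast
  ultimately have V: "open V" "x \<in> V" "V \<subseteq> chart_image c" by (auto simp: V_def)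
  have E: "vector_field A (E i)" for i unfolding E_def by (rule local_constant_field(1)[OF c x])
  have Ec: "E i (inv_chart c y) c = i" if "i \<in> Basis" "y \<in> V" for i y
    using that by (intro W(4)) (auto simp: V_def)
  have frame: "D X Y (inv_chart c y) c = frechet_derivative (\<lambda>y. Y (inv_chart c y) c) (at y) (X (inv_chart c y) c) +
    (\<Sum>i\<in>Basis. \<Sum>j\<in>Basis. ((X (inv_chart c y) c \<bullet> i) * (Y (inv_chart c y) c \<bullet> j)) *\<^sub>R
        D (E i) (E j) (inv_chart c y) c)"
    if "y \<in> V" "vector_field A X" "vector_field A Y" for X Y y
    by (rule connection_in_frame[OF c V(1,3) that(1) E _ that(2,3)]) (rule Ec)
  have chr: "christoffel c y a b =
        (\<Sum>i\<in>Basis. \<Sum>j\<in>Basis. ((a \<bullet> i) * (b \<bullet> j)) *\<^sub>R D (E i) (E j) (inv_chart c y) c)" if y: "y \<in> V" for y a b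
  proof -
    have yc: "y \<in> chart_image c" using y V by auto
    have val: "local_constant_field c y a (inv_chart c y) c = a" for a
      using local_constant_field(2)[OF c yc, of a] by auto
    obtain U where U: "open U" "y \<in> U" "\<And>z. z \<in> U \<Longrightarrow> local_constant_field c y b (inv_chart c z) c = b"
      using local_constant_field(2)[OF c yc, of b] by auto
    \<comment> \<open>Only the components of this field near \<open>y\<close> enter, and they are constant.\<close>
    have "frechet_derivative (\<lambda>z. local_constant_field c y b (inv_chart c z) c) (at y) = frechet_derivative (\<lambda>z. b) (at y)"
      by (rule frechet_derivative_cong_open[OF U])
    then show ?thesis
      using frame[OF y local_constant_field(1)[OF c yc, of a] local_constant_field(1)[OF c yc, of b]]
      by (simp add: christoffel_def val)
  qed
  show ?thesis
    by (rule that[OF V E chr]) (simp_all add: frame chr)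
qed

lemma connection_in_chart:
  assumes "c \<in> A" "x \<in> chart_image c" "vector_field A X" "vector_field A Y"
  shows "D X Y (inv_chart c x) c = frechet_derivative (\<lambda>y. Y (inv_chart c y) c) (at x) (X (inv_chart c x) c) +
        christoffel c x (X (inv_chart c x) c) (Y (inv_chart c x) c)"
  by (rule christoffel_near[OF assms(1,2)]) (simp add: assms(3,4))

lemma linear_christoffel:
  assumes "c \<in> A" "x \<in> chart_image c"
  shows "linear (\<lambda>a. christoffel c x a b)" "linear (christoffel c x a)"
proof -
  obtain E where E: "\<And>a b. christoffel c x a b =
        (\<Sum>i\<in>Basis. \<Sum>j\<in>Basis. ((a \<bullet> i) * (b \<bullet> j)) *\<^sub>R D (E i) (E j) (inv_chart c x) c)"
    by (rule christoffel_near[OF assms]) blast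
  show "linear (\<lambda>a. christoffel c x a b)" "linear (christoffel c x a)"
    by (auto intro!: linearI simp: E inner_add_left algebra_simps sum.distrib scaleR_sum_right)
qed

lemma smooth_christoffel:
  assumes c: "c \<in> A"
  shows "smooth_on (chart_image c) (\<lambda>x. christoffel c x a b)"
proof (rule smooth_on_local)
  fix x assume x: "x \<in> chart_image c"
  obtain V E where V: "open V" "x \<in> V" "V \<subseteq> chart_image c"
    and E: "\<And>i. i \<in> Basis \<Longrightarrow> vector_field A (E i)"
    and chr: "\<And>y a b. y \<in> V \<Longrightarrow> christoffel c y a b =
        (\<Sum>i\<in>Basis. \<Sum>j\<in>Basis. ((a \<bullet> i) * (b \<bullet> j)) *\<^sub>R D (E i) (E j) (inv_chart c y) c)"
    by (rule christoffel_near[OF c x]) blast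
  have "smooth_on V (\<lambda>y. \<Sum>i\<in>Basis. \<Sum>j\<in>Basis. ((a \<bullet> i) * (b \<bullet> j)) *\<^sub>R D (E i) (E j) (inv_chart c y) c)"
    by (intro smooth_on_sum smooth_on_scaleR smooth_on_const V
        smooth_on_subset[OF vector_field_smooth[OF D_field[OF E E] c]])
  then have "smooth_on V (\<lambda>x. christoffel c x a b)"
    by (rule smooth_on_cong[OF V(1), THEN iffD1, rotated]) (simp add: chr)
  then show "\<exists>T. open T \<and> x \<in> T \<and> smooth_on T (\<lambda>x. christoffel c x a b)" using V by blast
qed

end

section \<open>The tangent bundle as a manifold\<close>

lemma tangent_chart_iff [simp]: "(p, v) \<in> fst (tangent_chart A c) \<longleftrightarrow> p \<in> fst c \<and> v \<in> tangent_space A p"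
  by (simp add: tangent_chart_def)

lemma snd_tangent_chart [simp]: "snd (tangent_chart A c) (p, v) = (snd c p, v c)"
  by (simp add: tangent_chart_def)

context smooth_atlas
begin

lemma carrier_tangent_bundle: "(p, v) \<in> carrier (tangent_bundle A) \<longleftrightarrow> p \<in> carrier A \<and> v \<in> tangent_space A p"
  by (auto simp: carrier_def tangent_bundle_def)

lemma tangent_chart_overlap:
  assumes c: "c \<in> A"
  shows "snd (tangent_chart A c) ` (fst (tangent_chart A c) \<inter> fst (tangent_chart A d)) =
    snd c ` (fst c \<inter> fst d) \<times> UNIV"
proof (intro set_eqI iffI)
  fix z assume "z \<in> snd c ` (fst c \<inter> fst d) \<times> (UNIV :: 'e set)"
  then obtain p w where p: "p \<in> fst c" "p \<in> fst d" "z = (snd c p, w)" by auto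
  show "z \<in> snd (tangent_chart A c) ` (fst (tangent_chart A c) \<inter> fst (tangent_chart A d))"
    using p c by (intro image_eqI[where x="(p, chart_vector A c p w)"])
      (simp_all add: chart_vector_self chart_vector_tangent)
qed auto

lemma tangent_chart_image: "c \<in> A \<Longrightarrow> chart_image (tangent_chart A c) = chart_image c \<times> UNIV"
  using tangent_chart_overlap[of c c] by simp

lemma tangent_chart_inj: "c \<in> A \<Longrightarrow> inj_on (snd (tangent_chart A c)) (fst (tangent_chart A c))"
proof (rule inj_onI)
  fix z z' assume c: "c \<in> A" and z: "z \<in> fst (tangent_chart A c)" "z' \<in> fst (tangent_chart A c)"
    and eq: "snd (tangent_chart A c) z = snd (tangent_chart A c) z'"
  obtain p w p' w' where zz: "z = (p, w)" "z' = (p', w')" by (cases z, cases z')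
  have p: "p' = p" using z eq inj_onD[OF chart_inj[OF c]] by (simp add: zz)
  then have "w = w'" using z eq by (intro tangent_eqI[of w p w' c] c) (auto simp: zz)
  then show "z = z'" by (simp add: zz p)
qed

lemma inv_tangent_chart:
  assumes "c \<in> A" "x \<in> chart_image c"
  shows "inv_chart (tangent_chart A c) (x, w) = (inv_chart c x, chart_vector A c (inv_chart c x) w)"
proof -
  have "(inv_chart c x, chart_vector A c (inv_chart c x) w) \<in> fst (tangent_chart A c)"
    using assms inv_chart_in[of x c] by (simp add: chart_vector_tangent)
  moreover have "snd (tangent_chart A c) (inv_chart c x, chart_vector A c (inv_chart c x) w) = (x, w)"
    using assms inv_chart_in[of x c] by (simp add: chart_vector_self snd_inv_chart)
  ultimately show ?thesis
    unfolding inv_chart_def[of "tangent_chart A c"]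
    by (metis inv_into_f_f tangent_chart_inj[OF assms(1)])
qed

text \<open>If \<open>\<tau>\<close> is the transition map between two charts of the manifold, the one between the induced charts
  is \<open>(x, w) \<mapsto> (\<tau> x, \<tau>' x w)\<close>.\<close>

lemma smooth_atlas_tangent_bundle: "smooth_atlas (tangent_bundle A)"
proof (rule smooth_atlas.intro)
  fix C assume "C \<in> tangent_bundle A"
  then obtain c where c: "c \<in> A" and C: "C = tangent_chart A c" by (auto simp: tangent_bundle_def)
  show "inj_on (snd C) (fst C)" unfolding C by (rule tangent_chart_inj[OF c])
  show "open (chart_image C)" unfolding C tangent_chart_image[OF c]
    by (intro open_Times open_UNIV open_chart_image[OF c])
  fix B assume "B \<in> tangent_bundle A"
  then obtain d where d: "d \<in> A" and B: "B = tangent_chart A d" by (auto simp: tangent_bundle_def)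
  let ?S = "snd c ` (fst c \<inter> fst d) \<times> (UNIV :: 'e set)" and ?\<tau> = "snd d \<circ> inv_chart c"
  have S: "open ?S" by (intro open_Times open_UNIV open_overlap[OF c d])
  then show "open (snd C ` (fst C \<inter> fst B))" unfolding C B tangent_chart_overlap[OF c] .
  have \<tau>: "smooth_on ?S (\<lambda>z. ?\<tau> (fst z))"
    by (rule smooth_on_compose[OF S open_overlap[OF c d] _ smooth_on_fst[OF S] smooth_transition[OF c d]]) auto
  have \<tau>': "smooth_on ?S (\<lambda>z. frechet_derivative ?\<tau> (at (fst z)) (snd z))"
  proof (rule smooth_on_linear_field[where J="\<lambda>z. frechet_derivative ?\<tau> (at (fst z))", OF S])
    show "linear (frechet_derivative ?\<tau> (at (fst z)))" if "z \<in> ?S" for z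
      using that by (intro linear_frechet_derivative_smooth[OF smooth_transition[OF c d]]) auto
    show "smooth_on ?S (\<lambda>z. frechet_derivative ?\<tau> (at (fst z)) e)" for e
      by (rule smooth_on_compose[OF S open_overlap[OF c d] _ smooth_on_fst[OF S]
          smooth_on_frechet[OF smooth_transition[OF c d]]]) auto
  qed (rule smooth_on_snd[OF S])
  have eq: "(?\<tau> (fst z), frechet_derivative ?\<tau> (at (fst z)) (snd z)) =
        (snd (tangent_chart A d) \<circ> inv_chart (tangent_chart A c)) z" if zS: "z \<in> ?S" for z
  proof -
    obtain p where p: "p \<in> fst c" "p \<in> fst d" and "fst z = snd c p"
      using zS unfolding mem_Times_iff by blast
    then have z: "z = (snd c p, snd z)" by (simp add: prod_eq_iff)
    show ?thesis using p c d by (subst (1 2 3) z) (simp add: inv_tangent_chart inv_chart_snd chart_vector_def)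
  qed
  have "smooth_on ?S (snd (tangent_chart A d) \<circ> inv_chart (tangent_chart A c))"
    by (rule smooth_on_cong[OF S, THEN iffD1, OF _ smooth_on_Pair[OF S \<tau> \<tau>']]) (rule eq)
  then show "smooth_on (snd C ` (fst C \<inter> fst B)) (snd B \<circ> inv_chart C)"
    unfolding C B tangent_chart_overlap[OF c] .
qed

end

text \<open>The definition of the pushforward uses the same chart of the source for all charts of the target; the
  transformation law in the target is then the chain rule.\<close>

lemma (in smooth_atlas) pushforward_tangent:
  fixes F :: "'m \<Rightarrow> 'n" and B :: "('n, 'f::euclidean_space) atlas"
  assumes B: "smooth_atlas B" and v: "v \<in> tangent_space A p" and c: "c \<in> A" "p \<in> fst c"
    and diff: "\<And>d. d \<in> B \<Longrightarrow> F p \<in> fst d \<Longrightarrow> (snd d \<circ> F \<circ> inv_chart c) differentiable (at (snd c p))"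
    and nbhd: "\<And>d. d \<in> B \<Longrightarrow> F p \<in> fst d \<Longrightarrow> \<exists>U. open U \<and> snd c p \<in> U \<and> (\<forall>y\<in>U. F (inv_chart c y) \<in> fst d)"
  shows "pushforward A B F p v \<in> tangent_space B (F p)"
proof -
  interpret B: smooth_atlas B by fact
  show ?thesis
  proof (rule B.tangent_spaceI)
    show "pushforward A B F p v d = 0" if "\<not> (d \<in> B \<and> F p \<in> fst d)" for d
      using that by (auto simp: pushforward_def)
  next
    fix d e assume de: "d \<in> B" "e \<in> B" "F p \<in> fst d" "F p \<in> fst e"
    let ?x = "snd c p"
    obtain U where U: "open U" "?x \<in> U" "\<And>y. y \<in> U \<Longrightarrow> F (inv_chart c y) \<in> fst d"
      using nbhd[OF de(1,3)] by blast
    have x: "(snd d \<circ> F \<circ> inv_chart c) ?x = snd d (F p)" using c by (simp add: inv_chart_snd)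
    have "((snd e \<circ> inv_chart d) has_derivative transition_derivative d e (F p)) (at ((snd d \<circ> F \<circ> inv_chart c) ?x))"
      unfolding x by (rule B.transition_has_derivative[OF de])
    from has_derivative_compose[OF diff[OF de(1,3), unfolded frechet_derivative_works] this]
    have "((snd e \<circ> F \<circ> inv_chart c) has_derivative
        (\<lambda>h. transition_derivative d e (F p) (frechet_derivative (snd d \<circ> F \<circ> inv_chart c) (at ?x) h))) (at ?x)"
      by (rule has_derivative_transform_within_open[OF _ U(1,2)])
        (use U(3) de in \<open>simp add: B.inv_chart_snd\<close>)
    from frechet_derivative_at[OF this]
    show "pushforward A B F p v e = transition_derivative d e (F p) (pushforward A B F p v d)"
      using pushforward_eq[OF v c de(2,4) diff[OF de(2,4)]] pushforward_eq[OF v c de(1,3) diff[OF de(1,3)]]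
      by (simp add: fun_eq_iff)
  qed
qed

section \<open>The connection map in a chart\<close>

locale connector_atlas = connection_atlas A D
  for A :: "('m, 'e::euclidean_space) atlas" and D :: "('m, 'e) connection" +
  fixes K :: "('m, 'e) connector"
  assumes connector: "connection_map A D K"

sublocale connector_atlas \<subseteq> TM: smooth_atlas "tangent_bundle A"
  by (rule smooth_atlas_tangent_bundle)

context connector_atlas
begin

abbreviation "TA \<equiv> tangent_bundle A"
abbreviation "tc \<equiv> tangent_chart A"

lemma tc_in: "c \<in> A \<Longrightarrow> tc c \<in> TA"
  by (simp add: tangent_bundle_def)

lemma connector_linear:
  "(p, w) \<in> carrier TA \<Longrightarrow> linear_between (tangent_space TA (p, w)) (tangent_space A p) (K (p, w))"
  using connector by (auto simp: connection_map_def)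

lemma connector_tangent: "(p, w) \<in> carrier TA \<Longrightarrow> \<zeta> \<in> tangent_space TA (p, w) \<Longrightarrow> K (p, w) \<zeta> \<in> tangent_space A p"
  using connector_linear[of p w] by (simp add: linear_between_def)

lemma connector_add:
  "(p, w) \<in> carrier TA \<Longrightarrow> \<zeta> \<in> tangent_space TA (p, w) \<Longrightarrow> \<xi> \<in> tangent_space TA (p, w) \<Longrightarrow>
    K (p, w) (\<zeta> + \<xi>) = K (p, w) \<zeta> + K (p, w) \<xi>"
  using connector_linear[of p w] by (simp add: linear_between_def)

lemma connector_pushforward:
  "vector_field A X \<Longrightarrow> vector_field A Y \<Longrightarrow> p \<in> carrier A \<Longrightarrow>
     K (p, Y p) (pushforward A TA (\<lambda>q. (q, Y q)) p (X p)) = D X Y p"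
  using connector by (simp add: connection_map_def)

text \<open>A tangent vector of the bundle with nonzero horizontal part \<open>a\<close> is tangent to a section whose
  components have constant derivative: one chooses a linear map taking \<open>a\<close> to the vertical part.\<close>

lemma connector_in_chart_nonzero:
  assumes c: "c \<in> A" "p \<in> fst c" and w: "w \<in> tangent_space A p" and z: "\<zeta> \<in> tangent_space TA (p, w)"
    and ab: "\<zeta> (tc c) = (a, b)" and a: "a \<noteq> 0"
  shows "K (p, w) \<zeta> c = b + christoffel c (snd c p) a (w c)"
proof -
  let ?x = "snd c p"
  have x: "?x \<in> chart_image c" using c by simp
  have o: "open (chart_image c)" by (rule open_chart_image[OF c(1)])
  \<comment> \<open>A linear map with value \<open>b\<close> at \<open>a\<close>.\<close>
  define L where "L h = ((h \<bullet> a) / (a \<bullet> a)) *\<^sub>R b" for h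
  have L: "bounded_linear L"
    unfolding linear_conv_bounded_linear[symmetric]
    by (rule linearI) (auto simp: L_def inner_add_left add_divide_distrib algebra_simps)
  have La: "L a = b" using a by (simp add: L_def)
  define u where "u y = w c + (L y - L ?x)" for y
  have u: "smooth_on (chart_image c) u" unfolding u_def[abs_def]
    by (intro smooth_on_add smooth_on_diff smooth_on_const smooth_on_bounded_linear[OF o L] o)
  have u': "(u has_derivative L) (at ?x)" unfolding u_def[abs_def]
    by (auto intro!: derivative_eq_intros bounded_linear_imp_has_derivative L)
  obtain Y W where Y: "vector_field A Y" and W: "open W" "?x \<in> W" "W \<subseteq> chart_image c"
    and Yu: "\<forall>y\<in>W. Y (inv_chart c y) c = u y"
    by (rule extend_local_field[OF c(1) o order_refl x u])
  obtain X where X: "vector_field A X" "X p = chart_vector A c p a"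
    by (rule vector_field_through[OF chart_vector_tangent[OF c, of a]])
  have Xc: "X p c = a" by (simp add: X chart_vector_self c)
  have "Y (inv_chart c ?x) c = w c" using Yu W(2) by (simp add: u_def)
  then have Yp: "Y p = w"
    using c by (intro tangent_eqI[OF vector_field_tangent[OF Y] w c]) (simp add: inv_chart_snd)
  have Y': "((\<lambda>y. Y (inv_chart c y) c) has_derivative L) (at ?x)"
    by (rule has_derivative_transform_within_open[OF u' W(1,2)]) (simp add: Yu)
  let ?F = "\<lambda>q. (q, Y q)"
  have F: "(snd (tc d) \<circ> ?F \<circ> inv_chart c) = (\<lambda>y. ((snd d \<circ> inv_chart c) y, Y (inv_chart c y) d))" for d
    by (auto simp: fun_eq_iff)
  have dF: "(snd (tc d) \<circ> ?F \<circ> inv_chart c) differentiable (at ?x)" if d: "d \<in> A" "p \<in> fst d" for d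
  proof -
    have "((\<lambda>q. Y q d) \<circ> inv_chart d) differentiable (at (snd d p))"
      using smooth_on_differentiable[OF vector_field_smooth[OF Y d(1)], of "snd d p"] d(2) by (simp add: comp_def)
    from has_derivative_chart_change[OF d(1) c(1) d(2) c(2) this[unfolded frechet_derivative_works]]
    have "((\<lambda>y. Y (inv_chart c y) d) has_derivative
        (\<lambda>v. frechet_derivative ((\<lambda>q. Y q d) \<circ> inv_chart d) (at (snd d p)) (transition_derivative c d p v))) (at ?x)"
      by (simp add: comp_def)
    from has_derivative_Pair[OF transition_has_derivative[OF c(1) d(1) c(2) d(2)] this]
    show ?thesis unfolding F by (rule differentiableI)
  qed
  let ?pf = "pushforward A TA ?F p (X p)"
  have "?pf \<in> tangent_space TA (?F p)"
  proof (rule pushforward_tangent[OF TM.smooth_atlas_axioms vector_field_tangent[OF X(1)] c])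
    fix C assume C: "C \<in> TA" "?F p \<in> fst C"
    then obtain d where d: "d \<in> A" "C = tc d" "p \<in> fst d" by (auto simp: tangent_bundle_def)
    show "(snd C \<circ> ?F \<circ> inv_chart c) differentiable (at ?x)" unfolding d(2) by (rule dF[OF d(1,3)])
    have "?x \<in> snd c ` (fst c \<inter> fst d)" using c d by auto
    moreover have "?F (inv_chart c y) \<in> fst C" if "y \<in> snd c ` (fst c \<inter> fst d)" for y
      using that d c by (auto simp: inv_chart_snd vector_field_tangent[OF Y])
    ultimately show "\<exists>U. open U \<and> ?x \<in> U \<and> (\<forall>y\<in>U. ?F (inv_chart c y) \<in> fst C)"
      using open_overlap[OF c(1) d(1)] by (intro exI[of _ "snd c ` (fst c \<inter> fst d)"] conjI ballI)
  qed
  then have pf: "?pf \<in> tangent_space TA (p, w)" by (simp add: Yp)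
  have "((snd (tc c) \<circ> ?F \<circ> inv_chart c) has_derivative (\<lambda>h. (h, L h))) (at ?x)"
    by (rule has_derivative_transform_within_open[OF has_derivative_Pair[OF has_derivative_ident Y'] o x])
      (simp add: snd_inv_chart)
  from frechet_derivative_at[OF this]
  have "?pf (tc c) = (a, b)"
    using pushforward_eq[OF vector_field_tangent[OF X(1)] c tc_in[OF c(1)] _ dF[OF c]] c
    by (simp add: Xc La[symmetric] vector_field_tangent[OF Y] fun_eq_iff)
  then have "?pf = \<zeta>"
    using c w by (intro TM.tangent_eqI[OF pf z tc_in[OF c(1)]]) (simp_all add: ab)
  then have "K (p, w) \<zeta> c = D X Y p c"
    using connector_pushforward[OF X(1) Y in_carrier[OF c]] by (simp add: Yp)
  also have "D X Y p c = L a + christoffel c ?x a (w c)"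
    using connection_in_chart[OF c(1) x X(1) Y] frechet_derivative_at[OF Y'] c
    by (simp add: inv_chart_snd Xc Yp)
  finally show ?thesis by (simp add: La)
qed

text \<open>A vector without horizontal part is the difference of two vectors with the same nonzero horizontal part,
  and the connection map is linear on the fibre.\<close>

lemma connector_in_chart:
  assumes c: "c \<in> A" "p \<in> fst c" and w: "w \<in> tangent_space A p" and z: "\<zeta> \<in> tangent_space TA (p, w)"
  shows "K (p, w) \<zeta> c = snd (\<zeta> (tc c)) + christoffel c (snd c p) (fst (\<zeta> (tc c))) (w c)"
proof (cases "fst (\<zeta> (tc c)) = 0")
  case False
  then show ?thesis using connector_in_chart_nonzero[OF c w z, of "fst (\<zeta> (tc c))" "snd (\<zeta> (tc c))"] by simp
next
  case True
  obtain a :: 'e where "a \<in> Basis" by fastforce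
  then have a: "a \<noteq> 0" by auto
  have t: "(p, w) \<in> fst (tc c)" "tc c \<in> TA" using c w tc_in by auto
  define \<xi> where "\<xi> = chart_vector TA (tc c) (p, w) (a, 0)"
  have xi: "\<xi> \<in> tangent_space TA (p, w)" "\<xi> (tc c) = (a, 0)"
    using TM.chart_vector_tangent[OF t(2,1)] TM.chart_vector_self[OF t(2,1)] by (auto simp: \<xi>_def)
  have sum: "(\<zeta> + \<xi>) (tc c) = (a, snd (\<zeta> (tc c)))" using True xi by (simp add: prod_eq_iff)
  have "K (p, w) (\<zeta> + \<xi>) c = snd (\<zeta> (tc c)) + christoffel c (snd c p) a (w c)"
    by (rule connector_in_chart_nonzero[OF c w TM.tangent_add[OF z xi(1)] sum a])
  moreover have "K (p, w) \<xi> c = christoffel c (snd c p) a (w c)"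
    using connector_in_chart_nonzero[OF c w xi a] by simp
  moreover have "K (p, w) (\<zeta> + \<xi>) = K (p, w) \<zeta> + K (p, w) \<xi>"
    using c w in_carrier[OF c] by (intro connector_add z xi) (simp add: carrier_tangent_bundle)
  moreover have "christoffel c (snd c p) 0 (w c) = 0"
    using linear_0[OF linear_christoffel(1)[OF c(1)]] c by simp
  ultimately show ?thesis using True by simp
qed

section \<open>Lifts\<close>

lemma pushforward_fst_component:
  assumes c: "c \<in> A" "p \<in> fst c" and w: "w \<in> tangent_space A p" and z: "\<zeta> \<in> tangent_space TA (p, w)"
  shows "pushforward TA A fst (p, w) \<zeta> c = fst (\<zeta> (tc c))"
proof -
  have t: "(p, w) \<in> fst (tc c)" "tc c \<in> TA" using c w tc_in by auto
  have S: "open (chart_image c \<times> (UNIV :: 'e set))" by (intro open_Times open_UNIV open_chart_image[OF c(1)])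
  have d: "((snd c \<circ> fst \<circ> inv_chart (tc c)) has_derivative fst) (at (snd (tc c) (p, w)))"
    by (rule has_derivative_transform_within_open[OF bounded_linear_imp_has_derivative[OF bounded_linear_fst] S])
      (use c in \<open>auto simp: inv_tangent_chart inv_chart_snd\<close>)
  have "pushforward TA A fst (p, w) \<zeta> c =
      frechet_derivative (snd c \<circ> fst \<circ> inv_chart (tc c)) (at (snd (tc c) (p, w))) (\<zeta> (tc c))"
    by (rule TM.pushforward_eq[OF z t(2,1) c(1)]) (use c d in \<open>auto simp: differentiable_def\<close>)
  then show ?thesis using frechet_derivative_at[OF d] by simp
qed

lemma pushforward_fst_tangent:
  assumes t: "(p, w) \<in> carrier TA" and z: "\<zeta> \<in> tangent_space TA (p, w)"
  shows "pushforward TA A fst (p, w) \<zeta> \<in> tangent_space A p"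
proof -
  define c where "c = chart_at A p"
  have w: "w \<in> tangent_space A p" and c: "c \<in> A" "p \<in> fst c"
    using t chart_at by (auto simp: c_def carrier_tangent_bundle)
  have tc: "(p, w) \<in> fst (tc c)" "tc c \<in> TA" using c w tc_in by auto
  have S: "open (chart_image c \<times> (UNIV :: 'e set))" by (intro open_Times open_UNIV open_chart_image[OF c(1)])
  have eq: "fst (inv_chart (tc c) y) = inv_chart c (fst y)" if "y \<in> chart_image c \<times> UNIV" for y
    using that by (cases y) (auto simp: inv_tangent_chart[OF c(1)])
  have "pushforward TA A fst (p, w) \<zeta> \<in> tangent_space A (fst (p, w))"
  proof (rule TM.pushforward_tangent[OF smooth_atlas_axioms z tc(2,1)])
    fix d assume d: "d \<in> A" "fst (p, w) \<in> fst d"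
    have "((snd d \<circ> inv_chart c) has_derivative transition_derivative c d p) (at (fst (snd c p, w c)))"
      using transition_has_derivative[OF c(1) d(1) c(2)] d by simp
    from has_derivative_compose[OF bounded_linear_imp_has_derivative[OF bounded_linear_fst] this]
    have "((snd d \<circ> fst \<circ> inv_chart (tc c)) has_derivative (\<lambda>h. transition_derivative c d p (fst h))) (at (snd c p, w c))"
      by (rule has_derivative_transform_within_open[OF _ S]) (use c eq in auto)
    then show "(snd d \<circ> fst \<circ> inv_chart (tc c)) differentiable (at (snd (tc c) (p, w)))"
      by (auto simp: differentiable_def)
    let ?U = "snd c ` (fst c \<inter> fst d) \<times> (UNIV :: 'e set)"
    have "open ?U" by (intro open_Times open_UNIV open_overlap c d)
    moreover have "snd (tc c) (p, w) \<in> ?U" using c d by auto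
    moreover have "fst (inv_chart (tc c) y) \<in> fst d" if "y \<in> ?U" for y
      using that c by (subst eq) (auto simp: inv_chart_snd)
    ultimately show "\<exists>U. open U \<and> snd (tc c) (p, w) \<in> U \<and> (\<forall>y\<in>U. fst (inv_chart (tc c) y) \<in> fst d)"
      by (intro exI[of _ ?U] conjI ballI)
  qed
  then show ?thesis by simp
qed

text \<open>In the chart, a vector with horizontal part \<open>a\<close> and vertical part \<open>k\<close> at \<open>(p, w)\<close> has components
  \<open>(a, k - \<Gamma>(a, w))\<close>, as \<open>connector_in_chart\<close> shows. The chart is chosen here; \<open>lift_component\<close> frees the
  formula from the choice.\<close>

definition lift :: "('m, 'e) tpoint \<Rightarrow> ('m, 'e) tvector \<Rightarrow> ('m, 'e) tvector \<Rightarrow> (('m, 'e) tpoint, 'e \<times> 'e) tvector" where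
  "lift t a k = (let c = chart_at A (fst t) in
     chart_vector TA (tc c) t (a c, k c - christoffel c (snd c (fst t)) (a c) (snd t c)))"

lemma lift_outside: "t \<notin> carrier TA \<Longrightarrow> lift t a k = 0"
  by (auto simp: lift_def Let_def chart_vector_def carrier_def fun_eq_iff)

lemma lift_unique:
  assumes t: "(p, w) \<in> carrier TA" and z: "\<zeta> \<in> tangent_space TA (p, w)"
  shows "lift (p, w) (pushforward TA A fst (p, w) \<zeta>) (K (p, w) \<zeta>) = \<zeta>"
proof -
  define c where "c = chart_at A p"
  have w: "w \<in> tangent_space A p" and c: "c \<in> A" "p \<in> fst c"
    using t chart_at by (auto simp: c_def carrier_tangent_bundle)
  have tc: "(p, w) \<in> fst (tc c)" "tc c \<in> TA" using c w tc_in by auto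
  show ?thesis
    using TM.chart_vector_component[OF z tc(2,1)]
    by (simp add: lift_def Let_def c_def[symmetric] connector_in_chart[OF c w z] pushforward_fst_component[OF c w z])
qed

context
  fixes p w a k
  assumes t: "(p, w) \<in> carrier TA" and a: "a \<in> tangent_space A p" and k: "k \<in> tangent_space A p"
begin

lemma lift_characterization:
  "lift (p, w) a k \<in> tangent_space TA (p, w)"
  "pushforward TA A fst (p, w) (lift (p, w) a k) = a"
  "K (p, w) (lift (p, w) a k) = k"
proof -
  define c where "c = chart_at A p"
  have w: "w \<in> tangent_space A p" and c: "c \<in> A" "p \<in> fst c"
    using t chart_at by (auto simp: c_def carrier_tangent_bundle)
  have tc: "(p, w) \<in> fst (tc c)" "tc c \<in> TA" using c w tc_in by auto
  have eq: "lift (p, w) a k = chart_vector TA (tc c) (p, w) (a c, k c - christoffel c (snd c p) (a c) (w c))"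
    by (simp add: lift_def Let_def c_def)
  show T: "lift (p, w) a k \<in> tangent_space TA (p, w)"
    unfolding eq by (rule TM.chart_vector_tangent[OF tc(2,1)])
  have comp: "lift (p, w) a k (tc c) = (a c, k c - christoffel c (snd c p) (a c) (w c))"
    unfolding eq by (rule TM.chart_vector_self[OF tc(2,1)])
  show "pushforward TA A fst (p, w) (lift (p, w) a k) = a"
    by (rule tangent_eqI[OF pushforward_fst_tangent[OF t T] a c])
      (simp add: pushforward_fst_component[OF c w T] comp)
  show "K (p, w) (lift (p, w) a k) = k"
    by (rule tangent_eqI[OF connector_tangent[OF t T] k c])
      (simp add: connector_in_chart[OF c w T] comp)
qed

text \<open>The projection and the connection map determine the components in every chart, so the transformation law
  of the Christoffel symbols is implicit in the invariance of these two maps.\<close>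

lemma lift_component:
  assumes c: "c \<in> A" "p \<in> fst c"
  shows "lift (p, w) a k (tc c) = (a c, k c - christoffel c (snd c p) (a c) (w c))"
proof -
  have w: "w \<in> tangent_space A p" using t by (auto simp: carrier_tangent_bundle)
  have "fst (lift (p, w) a k (tc c)) = a c"
    using pushforward_fst_component[OF c w lift_characterization(1)] lift_characterization(2) by simp
  moreover have "snd (lift (p, w) a k (tc c)) = k c - christoffel c (snd c p) (a c) (w c)"
    using connector_in_chart[OF c w lift_characterization(1)] lift_characterization(3) calculation by simp
  ultimately show ?thesis by (simp add: prod_eq_iff)
qed

end

lemma lift_add:
  assumes "(p, w) \<in> carrier TA" "a \<in> tangent_space A p" "k \<in> tangent_space A p"
    "a' \<in> tangent_space A p" "k' \<in> tangent_space A p"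
  shows "lift (p, w) a k + lift (p, w) a' k' = lift (p, w) (a + a') (k + k')"
proof -
  define c where "c = chart_at A p"
  have w: "w \<in> tangent_space A p" and c: "c \<in> A" "p \<in> fst c"
    using assms(1) chart_at by (auto simp: c_def carrier_tangent_bundle)
  have x: "snd c p \<in> chart_image c" using c by simp
  have sums: "a + a' \<in> tangent_space A p" "k + k' \<in> tangent_space A p"
    using assms by (simp_all add: tangent_add)
  show ?thesis
  proof (rule TM.tangent_eqI)
    show "lift (p, w) a k + lift (p, w) a' k' \<in> tangent_space TA (p, w)"
      by (intro TM.tangent_add lift_characterization assms)
    show "lift (p, w) (a + a') (k + k') \<in> tangent_space TA (p, w)"
      by (intro lift_characterization assms sums)
    show "tc c \<in> TA" "(p, w) \<in> fst (tc c)" using c w by (simp_all add: tc_in)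
    show "(lift (p, w) a k + lift (p, w) a' k') (tc c) = lift (p, w) (a + a') (k + k') (tc c)"
      unfolding plus_fun_apply lift_component[OF assms(1-3) c] lift_component[OF assms(1,4,5) c]
        lift_component[OF assms(1) sums c] linear_add[OF linear_christoffel(1)[OF c(1) x]]
      by simp
  qed
qed

lemma lift_minus:
  assumes "(p, w) \<in> carrier TA" "a \<in> tangent_space A p" "k \<in> tangent_space A p"
  shows "- lift (p, w) a k = lift (p, w) (- a) (- k)"
proof -
  have "lift (p, w) 0 0 = lift (p, w) 0 0 + lift (p, w) 0 0"
    by (simp add: lift_add assms tangent_0)
  then have "lift (p, w) 0 0 = 0" by simp
  moreover have "lift (p, w) a k + lift (p, w) (- a) (- k) = lift (p, w) 0 0"
    by (simp add: lift_add assms tangent_minus)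
  ultimately show ?thesis by (simp add: minus_unique)
qed

lemma vector_field_lift:
  assumes X: "vector_field A X" and Y: "vector_field A Y"
  shows "vector_field TA (\<lambda>t. lift t (X (fst t)) (Y (fst t)))"
  unfolding vector_field_def
proof (intro conjI allI ballI)
  show "lift t (X (fst t)) (Y (fst t)) \<in> tangent_space TA t" for t
    by (cases t; cases "t \<in> carrier TA")
      (simp_all add: lift_characterization vector_field_tangent X Y lift_outside TM.tangent_0)
  fix C assume "C \<in> TA"
  then obtain c where c: "c \<in> A" and C: "C = tc c" by (auto simp: tangent_bundle_def)
  let ?S = "chart_image c \<times> (UNIV :: 'e set)"
  have o: "open (chart_image c)" by (rule open_chart_image[OF c])
  have S: "open ?S" by (intro open_Times open_UNIV o)
  have base: "smooth_on ?S (\<lambda>z. f (fst z))" if "smooth_on (chart_image c) f" for f :: "'e \<Rightarrow> 'e"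
    by (rule smooth_on_compose[OF S o _ smooth_on_fst[OF S] that]) auto
  have Xs: "smooth_on ?S (\<lambda>z. X (inv_chart c (fst z)) c)" by (rule base[OF vector_field_smooth[OF X c]])
  have Ys: "smooth_on ?S (\<lambda>z. Y (inv_chart c (fst z)) c)" by (rule base[OF vector_field_smooth[OF Y c]])
  have "smooth_on ?S (\<lambda>z. christoffel c (fst z) (X (inv_chart c (fst z)) c) (snd z))"
  proof (rule smooth_on_linear_field[where J="\<lambda>z. christoffel c (fst z) (X (inv_chart c (fst z)) c)",
        OF S _ _ smooth_on_snd[OF S]])
    show "linear (christoffel c (fst z) (X (inv_chart c (fst z)) c))" if "z \<in> ?S" for z
      using that by (intro linear_christoffel c) auto
    show "smooth_on ?S (\<lambda>z. christoffel c (fst z) (X (inv_chart c (fst z)) c) e)" for e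
      by (rule smooth_on_linear_field[where J="\<lambda>z a. christoffel c (fst z) a e", OF S _ base[OF smooth_christoffel[OF c]] Xs])
        (auto intro: linear_christoffel c)
  qed
  from smooth_on_Pair[OF S Xs smooth_on_diff[OF S Ys this]]
  show "smooth_on (chart_image C) (\<lambda>z. lift (inv_chart C z) (X (fst (inv_chart C z))) (Y (fst (inv_chart C z))) C)"
    unfolding C tangent_chart_image[OF c]
  proof (rule smooth_on_cong[OF S, THEN iffD1, rotated])
    fix z assume "z \<in> ?S"
    then obtain x v where z: "z = (x, v)" "x \<in> chart_image c" by auto
    let ?p = "inv_chart c x"
    have p: "?p \<in> fst c" by (rule inv_chart_in[OF z(2)])
    have "(?p, chart_vector A c ?p v) \<in> carrier TA"
      using chart_vector_tangent[OF c p] in_carrier[OF c p] by (simp add: carrier_tangent_bundle)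
    then show "(X (inv_chart c (fst z)) c, Y (inv_chart c (fst z)) c - christoffel c (fst z) (X (inv_chart c (fst z)) c) (snd z)) =
        lift (inv_chart (tc c) z) (X (fst (inv_chart (tc c) z))) (Y (fst (inv_chart (tc c) z))) (tc c)"
      using p z by (simp add: inv_tangent_chart[OF c] lift_component vector_field_tangent X Y c snd_inv_chart chart_vector_self)
  qed
qed

text \<open>The definite description denotes this field because it is smooth, by \<open>vector_field_lift\<close>, and because
  a tangent vector of the bundle is determined by its two parts.\<close>

lemma horizontal_lift_eq:
  assumes X: "vector_field A X"
  shows "horizontal_lift A K X = (\<lambda>t. lift t (X (fst t)) 0)"
  unfolding horizontal_lift_def
proof (rule the_equality)
  have vf: "vector_field TA (\<lambda>t. lift t (X (fst t)) 0)"
    using vector_field_lift[OF X vector_field_0] by simp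
  then show "vector_field TA (\<lambda>t. lift t (X (fst t)) 0) \<and> (\<forall>t\<in>carrier TA.
      pushforward TA A fst t (lift t (X (fst t)) 0) = X (fst t) \<and> K t (lift t (X (fst t)) 0) = 0)"
    by (auto simp: lift_characterization vector_field_tangent X tangent_0)
  fix Z assume Z: "vector_field TA Z \<and> (\<forall>t\<in>carrier TA. pushforward TA A fst t (Z t) = X (fst t) \<and> K t (Z t) = 0)"
  show "Z = (\<lambda>t. lift t (X (fst t)) 0)"
  proof (rule TM.vector_field_eqI[OF _ vf])
    fix t assume t: "t \<in> carrier TA"
    then show "Z t = lift t (X (fst t)) 0"
      using lift_unique[of "fst t" "snd t" "Z t"] Z TM.vector_field_tangent[of Z t] by simp
  qed (use Z in simp)
qed

lemma vertical_lift_eq: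
  assumes X: "vector_field A X"
  shows "vertical_lift A K X = (\<lambda>t. lift t 0 (X (fst t)))"
  unfolding vertical_lift_def
proof (rule the_equality)
  have vf: "vector_field TA (\<lambda>t. lift t 0 (X (fst t)))"
    using vector_field_lift[OF vector_field_0 X] by simp
  then show "vector_field TA (\<lambda>t. lift t 0 (X (fst t))) \<and> (\<forall>t\<in>carrier TA.
      pushforward TA A fst t (lift t 0 (X (fst t))) = 0 \<and> K t (lift t 0 (X (fst t))) = X (fst t))"
    by (auto simp: lift_characterization vector_field_tangent X tangent_0)
  fix Z assume Z: "vector_field TA Z \<and> (\<forall>t\<in>carrier TA. pushforward TA A fst t (Z t) = 0 \<and> K t (Z t) = X (fst t))"
  show "Z = (\<lambda>t. lift t 0 (X (fst t)))"
  proof (rule TM.vector_field_eqI[OF _ vf])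
    fix t assume t: "t \<in> carrier TA"
    then show "Z t = lift t 0 (X (fst t))"
      using lift_unique[of "fst t" "snd t" "Z t"] Z TM.vector_field_tangent[of Z t] by simp
  qed (use Z in simp)
qed

end

section \<open>Curvature and brackets of lifts\<close>

context connector_atlas
begin

text \<open>The classical expression \<open>\<partial>\<Gamma> - \<partial>\<Gamma> + \<Gamma>\<Gamma> - \<Gamma>\<Gamma>\<close> for the curvature tensor.\<close>

definition chart_curvature :: "('m, 'e) chart \<Rightarrow> 'e \<Rightarrow> 'e \<Rightarrow> 'e \<Rightarrow> 'e \<Rightarrow> 'e" where
  "chart_curvature c x a b e =
     frechet_derivative (\<lambda>y. christoffel c y b e) (at x) a - frechet_derivative (\<lambda>y. christoffel c y a e) (at x) b
     + christoffel c x a (christoffel c x b e) - christoffel c x b (christoffel c x a e)"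

text \<open>Stated with a base point \<open>\<phi> z\<close> in order to serve on the manifold, where \<open>\<phi>\<close> is the identity, and
  on the tangent bundle, where it is the projection.\<close>

lemma christoffel_has_derivative:
  assumes c: "c \<in> A" and x: "x \<in> chart_image c" and \<phi>: "(\<phi> has_derivative \<phi>') (at z)" "\<phi> z = x"
    and o: "open S" "z \<in> S" "\<phi> ` S \<subseteq> chart_image c"
    and u: "(u has_derivative u') (at z)" and v: "(v has_derivative v') (at z)"
  shows "((\<lambda>z. christoffel c (\<phi> z) (u z) (v z)) has_derivative
     (\<lambda>h. frechet_derivative (\<lambda>y. christoffel c y (u z) (v z)) (at x) (\<phi>' h)
        + christoffel c x (u' h) (v z) + christoffel c x (u z) (v' h))) (at z)"
proof -
  have "((\<lambda>z. christoffel c (\<phi> z) (u z) (v z)) has_derivative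
     (\<lambda>h. frechet_derivative (\<lambda>y. christoffel c y (u z) (v z)) (at x) (\<phi>' h)
        + christoffel c (\<phi> z) (u' h) (v z) + christoffel c (\<phi> z) (u z) (v' h))) (at z)"
  proof (rule has_derivative_bilinear_field[where G="\<lambda>z. christoffel c (\<phi> z)"
        and G'="\<lambda>a b h. frechet_derivative (\<lambda>y. christoffel c y a b) (at x) (\<phi>' h)", OF o(1,2) _ _ _ u v])
    fix y a b assume "y \<in> S"
    then have "\<phi> y \<in> chart_image c" using o by blast
    then show "linear (\<lambda>a. christoffel c (\<phi> y) a b)" "linear (christoffel c (\<phi> y) a)"
      by (rule linear_christoffel[OF c])+
  next
    fix a b
    have "((\<lambda>y. christoffel c y a b) has_derivative frechet_derivative (\<lambda>y. christoffel c y a b) (at x)) (at (\<phi> z))"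
      using smooth_on_has_derivative[OF smooth_christoffel[OF c] x, of a b] by (simp add: \<phi>(2))
    from has_derivative_compose[OF \<phi>(1) this]
    show "((\<lambda>z. christoffel c (\<phi> z) a b) has_derivative (\<lambda>h. frechet_derivative (\<lambda>y. christoffel c y a b) (at x) (\<phi>' h))) (at z)" .
  qed
  then show ?thesis by (simp add: \<phi>(2))
qed

text \<open>The second derivatives of the components of \<open>Z\<close> cancel by symmetry.\<close>

lemma curvature_in_chart:
  assumes X: "vector_field A X" and Y: "vector_field A Y" and Z: "vector_field A Z"
    and XY: "vector_field A (lie_bracket A X Y)" and c: "c \<in> A" "p \<in> fst c"
  shows "curvature A D X Y Z p c = chart_curvature c (snd c p) (X p c) (Y p c) (Z p c)"
proof -
  let ?x = "snd c p" and ?U = "chart_image c"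
  have x: "?x \<in> ?U" using c by simp
  have o: "open ?U" by (rule open_chart_image[OF c(1)])
  have p: "inv_chart c ?x = p" using c by (simp add: inv_chart_snd)
  define comp where "comp V y = V (inv_chart c y) c" for V :: "('m, 'e) vfield" and y
  define d where "d V = frechet_derivative (comp V) (at ?x)" for V
  define d2 where "d2 u v = frechet_derivative (\<lambda>y. frechet_derivative (comp Z) (at y) u) (at ?x) v" for u v
  let ?G = "christoffel c ?x" and ?G' = "\<lambda>a b h. frechet_derivative (\<lambda>y. christoffel c y a b) (at ?x) h"
  have sm: "smooth_on ?U (comp V)" if "vector_field A V" for V
    using vector_field_smooth[OF that c(1)] by (simp add: comp_def[abs_def])
  have der: "(comp V has_derivative d V) (at ?x)" if "vector_field A V" for V
    unfolding d_def by (rule smooth_on_has_derivative[OF sm[OF that] x])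
  have lin: "linear (d V)" if "vector_field A V" for V
    using has_derivative_linear[OF der[OF that]] .
  have comp_x: "comp V ?x = V p c" for V by (simp add: comp_def p)
  have DV: "D V W p c = d W (V p c) + ?G (V p c) (W p c)" if "vector_field A V" "vector_field A W" for V W
    using connection_in_chart[OF c(1) x that] by (simp add: p d_def comp_def[abs_def])
  have dD: "d (D V Z) h = d2 (V p c) h + d Z (d V h) + (?G' (V p c) (Z p c) h + ?G (d V h) (Z p c) + ?G (V p c) (d Z h))"
    if V: "vector_field A V" for V h
  proof -
    have 1: "((\<lambda>y. frechet_derivative (comp Z) (at y) (comp V y)) has_derivative (\<lambda>h. d2 (comp V ?x) h + d Z (d V h))) (at ?x)"
      unfolding d2_def d_def[of Z]
      by (rule has_derivative_linear_field[where J="\<lambda>y. frechet_derivative (comp Z) (at y)", OF o x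
            linear_frechet_derivative_smooth[OF sm[OF Z]]
            smooth_on_has_derivative[OF smooth_on_frechet[OF sm[OF Z]] x] der[OF V]])
    have 2: "((\<lambda>y. christoffel c y (comp V y) (comp Z y)) has_derivative
        (\<lambda>h. ?G' (comp V ?x) (comp Z ?x) h + ?G (d V h) (comp Z ?x) + ?G (comp V ?x) (d Z h))) (at ?x)"
      by (rule christoffel_has_derivative[OF c(1) x has_derivative_ident refl o x _ der[OF V] der[OF Z]]) simp
    have "(comp (D V Z) has_derivative (\<lambda>h. (d2 (comp V ?x) h + d Z (d V h)) +
        (?G' (comp V ?x) (comp Z ?x) h + ?G (d V h) (comp Z ?x) + ?G (comp V ?x) (d Z h)))) (at ?x)"
    proof (rule has_derivative_transform_within_open[OF has_derivative_add[OF 1 2] o x])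
      fix y assume "y \<in> ?U"
      from connection_in_chart[OF c(1) this V Z]
      show "frechet_derivative (comp Z) (at y) (comp V y) + christoffel c y (comp V y) (comp Z y) = comp (D V Z) y"
        by (simp add: comp_def[abs_def])
    qed
    from has_derivative_unique[OF der[OF D_field[OF V Z]] this] show ?thesis by (simp add: comp_x)
  qed
  have br: "lie_bracket A X Y p c = d Y (X p c) - d X (Y p c)"
    using c by (simp add: lie_bracket_def d_def comp_def[abs_def])
  have sym: "d2 u v = d2 v u" for u v
    unfolding d2_def by (rule symmetric_second_derivative[OF o x sm[OF Z]])
  note G1 = linear_christoffel(1)[OF c(1) x] and G2 = linear_christoffel(2)[OF c(1) x]
  show ?thesis
    using sym[of "X p c" "Y p c"]
    by (simp add: curvature_def DV X Y Z XY D_field dD br chart_curvature_def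
        linear_diff[OF lin[OF Z]] linear_diff[OF G1] linear_add[OF G2])
qed

abbreviation lift_field :: "('m, 'e) vfield \<Rightarrow> ('m, 'e) vfield \<Rightarrow> (('m, 'e) tpoint, 'e \<times> 'e) vfield" where
  "lift_field X Y \<equiv> (\<lambda>t. lift t (X (fst t)) (Y (fst t)))"

lemma lift_field_derivative:
  assumes X: "vector_field A X" and Y: "vector_field A Y" and c: "c \<in> A" "p \<in> fst c" and w: "w \<in> tangent_space A p"
  shows "frechet_derivative (\<lambda>z. lift_field X Y (inv_chart (tc c) z) (tc c)) (at (snd c p, w c)) (a, b) =
    (frechet_derivative (\<lambda>y. X (inv_chart c y) c) (at (snd c p)) a,
     frechet_derivative (\<lambda>y. Y (inv_chart c y) c) (at (snd c p)) a -
     (frechet_derivative (\<lambda>y. christoffel c y (X p c) (w c)) (at (snd c p)) a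
      + christoffel c (snd c p) (frechet_derivative (\<lambda>y. X (inv_chart c y) c) (at (snd c p)) a) (w c)
      + christoffel c (snd c p) (X p c) b))"
proof -
  let ?x = "snd c p" and ?z = "(snd c p, w c)" and ?S = "chart_image c \<times> (UNIV :: 'e set)"
  have x: "?x \<in> chart_image c" using c by simp
  have S: "open ?S" "?z \<in> ?S" using c by (auto intro!: open_Times open_chart_image)
  have fst': "(fst has_derivative fst) (at ?z)" and snd': "(snd has_derivative snd) (at ?z)"
    by (auto intro: bounded_linear_imp_has_derivative bounded_linear_fst bounded_linear_snd)
  define f where "f V y = V (inv_chart c y) c" for V :: "('m, 'e) vfield" and y
  have base: "((\<lambda>z. f V (fst z)) has_derivative (\<lambda>h. frechet_derivative (f V) (at ?x) (fst h))) (at ?z)"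
    if V: "vector_field A V" for V
  proof -
    have "(f V has_derivative frechet_derivative (f V) (at ?x)) (at (fst ?z))"
      using smooth_on_has_derivative[OF vector_field_smooth[OF V c(1)] x] by (simp add: f_def[abs_def])
    from has_derivative_compose[OF fst' this] show ?thesis .
  qed
  have "((\<lambda>z. christoffel c (fst z) (f X (fst z)) (snd z)) has_derivative
      (\<lambda>h. frechet_derivative (\<lambda>y. christoffel c y (f X (fst ?z)) (snd ?z)) (at ?x) (fst h)
       + christoffel c ?x (frechet_derivative (f X) (at ?x) (fst h)) (snd ?z) + christoffel c ?x (f X (fst ?z)) (snd h))) (at ?z)"
    by (rule christoffel_has_derivative[OF c(1) x fst' _ S _ base[OF X] snd']) auto
  from has_derivative_Pair[OF base[OF X] has_derivative_diff[OF base[OF Y] this]]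
  have "((\<lambda>z. lift_field X Y (inv_chart (tc c) z) (tc c)) has_derivative
     (\<lambda>h. (frechet_derivative (f X) (at ?x) (fst h), frechet_derivative (f Y) (at ?x) (fst h) -
      (frechet_derivative (\<lambda>y. christoffel c y (f X (fst ?z)) (snd ?z)) (at ?x) (fst h)
       + christoffel c ?x (frechet_derivative (f X) (at ?x) (fst h)) (snd ?z) + christoffel c ?x (f X (fst ?z)) (snd h))))) (at ?z)"
  proof (rule has_derivative_transform_within_open[OF _ S])
    fix z assume zS: "z \<in> ?S"
    obtain y v where z: "z = (y, v)" "y \<in> chart_image c" using zS by (cases z) auto
    let ?p = "inv_chart c y"
    have p: "?p \<in> fst c" by (rule inv_chart_in[OF z(2)])
    have "(?p, chart_vector A c ?p v) \<in> carrier TA"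
      using chart_vector_tangent[OF c(1) p] in_carrier[OF c(1) p] by (simp add: carrier_tangent_bundle)
    then show "(f X (fst z), f Y (fst z) - christoffel c (fst z) (f X (fst z)) (snd z)) =
        lift_field X Y (inv_chart (tc c) z) (tc c)"
      using p z by (simp add: inv_tangent_chart[OF c(1)] lift_component vector_field_tangent X Y c snd_inv_chart chart_vector_self f_def)
  qed
  from frechet_derivative_at[OF this, symmetric] show ?thesis
    using c by (simp add: f_def[abs_def] inv_chart_snd)
qed

text \<open>With \<open>Y\<^sub>i = 0\<close> or \<open>X\<^sub>i = 0\<close> this specialises to the classical formulas
  \<open>[X\<^sup>h, Y\<^sup>h] = [X, Y]\<^sup>h - (R(X, Y) w)\<^sup>v\<close>, \<open>[X\<^sup>h, Y\<^sup>v] = (D\<^sub>X Y)\<^sup>v\<close> and \<open>[X\<^sup>v, Y\<^sup>v] = 0\<close>. The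
  curvature appears because a horizontal lift has vertical component \<open>- \<Gamma>(X, w)\<close>, which is differentiated
  in the base and in the fibre. The field \<open>W\<close> serves only to express the base vector \<open>w\<close>, as
  \<^const>\<open>curvature\<close> acts on fields.\<close>

lemma lie_bracket_lift_field:
  assumes X1: "vector_field A X1" and Y1: "vector_field A Y1" and X2: "vector_field A X2" and Y2: "vector_field A Y2"
    and W: "vector_field A W" and p: "p \<in> carrier A" and br: "vector_field A (lie_bracket A X1 X2)"
  shows "lie_bracket TA (lift_field X1 Y1) (lift_field X2 Y2) (p, W p) =
    lift (p, W p) (lie_bracket A X1 X2 p) (D X1 Y2 p - D X2 Y1 p - curvature A D X1 X2 W p)"
proof -
  define c where "c = chart_at A p"
  have c: "c \<in> A" "p \<in> fst c" using chart_at[OF p] by (auto simp: c_def)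
  let ?x = "snd c p" and ?w = "W p"
  have x: "?x \<in> chart_image c" using c by simp
  have w: "?w \<in> tangent_space A p" by (rule vector_field_tangent[OF W])
  have t: "(p, ?w) \<in> carrier TA" using p w by (simp add: carrier_tangent_bundle)
  have tc: "tc c \<in> TA" "(p, ?w) \<in> fst (tc c)" using c w by (simp_all add: tc_in)
  have px: "inv_chart c ?x = p" using c by (simp add: inv_chart_snd)
  have a: "lie_bracket A X1 X2 p \<in> tangent_space A p" by (rule vector_field_tangent[OF br])
  have Dt: "D V V' p \<in> tangent_space A p" if "vector_field A V" "vector_field A V'" for V V'
    by (rule vector_field_tangent[OF D_field[OF that]])
  have curv: "vector_field A (curvature A D X1 X2 W)"
    unfolding curvature_def by (intro vector_field_diff D_field X1 X2 W br)
  have k: "D X1 Y2 p - D X2 Y1 p - curvature A D X1 X2 W p \<in> tangent_space A p"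
    by (intro tangent_diff Dt vector_field_tangent[OF curv] X1 X2 Y1 Y2)
  note G1 = linear_christoffel(1)[OF c(1) x] and G2 = linear_christoffel(2)[OF c(1) x]
  show ?thesis
  proof (rule TM.tangent_eqI[OF _ lift_characterization(1)[OF t a k] tc])
    show "lie_bracket TA (lift_field X1 Y1) (lift_field X2 Y2) (p, ?w) \<in> tangent_space TA (p, ?w)"
      by (intro TM.lie_bracket_tangent vector_field_lift X1 X2 Y1 Y2)
    have comp: "lift_field X Y (p, ?w) (tc c) = (X p c, Y p c - christoffel c ?x (X p c) (?w c))"
      if "vector_field A X" "vector_field A Y" for X Y
      using lift_component[OF t vector_field_tangent[OF that(1)] vector_field_tangent[OF that(2)] c] by simp
    have L: "lie_bracket TA (lift_field X1 Y1) (lift_field X2 Y2) (p, ?w) (tc c) =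
      frechet_derivative (\<lambda>z. lift_field X2 Y2 (inv_chart (tc c) z) (tc c)) (at (?x, ?w c)) (lift_field X1 Y1 (p, ?w) (tc c)) -
      frechet_derivative (\<lambda>z. lift_field X1 Y1 (inv_chart (tc c) z) (tc c)) (at (?x, ?w c)) (lift_field X2 Y2 (p, ?w) (tc c))"
      using tc by (simp add: lie_bracket_def)
    have bc: "lie_bracket A X1 X2 p c = frechet_derivative (\<lambda>y. X2 (inv_chart c y) c) (at ?x) (X1 p c) -
        frechet_derivative (\<lambda>y. X1 (inv_chart c y) c) (at ?x) (X2 p c)"
      using c by (simp add: lie_bracket_def)
    have Dc: "D V V' p c = frechet_derivative (\<lambda>y. V' (inv_chart c y) c) (at ?x) (V p c) + christoffel c ?x (V p c) (V' p c)"
      if "vector_field A V" "vector_field A V'" for V V'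
      using connection_in_chart[OF c(1) x that] by (simp add: px)
    show "lie_bracket TA (lift_field X1 Y1) (lift_field X2 Y2) (p, ?w) (tc c) =
        lift (p, ?w) (lie_bracket A X1 X2 p) (D X1 Y2 p - D X2 Y1 p - curvature A D X1 X2 W p) (tc c)"
      unfolding L lift_component[OF t a k c] comp[OF X1 Y1] comp[OF X2 Y2]
        lift_field_derivative[OF X1 Y1 c w] lift_field_derivative[OF X2 Y2 c w]
      by (simp add: Dc X1 X2 Y1 Y2 curvature_in_chart[OF X1 X2 W br c] chart_curvature_def bc
          linear_diff[OF G1] linear_diff[OF G2] algebra_simps)
  qed
qed

end

section \<open>The Nijenhuis tensor\<close>

context smooth_atlas
begin

text \<open>In a chart the derivatives of the components of \<open>X\<close> and \<open>Y\<close> cancel, so the value at a point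
  depends only on the values of the two fields there.\<close>

lemma nijenhuis_in_chart:
  assumes J: "endo_field A J" and JJ: "\<And>v. v \<in> tangent_space A p \<Longrightarrow> J p (J p v) = (\<lambda>d. - (\<epsilon> *\<^sub>R v d))"
    and X: "vector_field A X" and Y: "vector_field A Y" and c: "c \<in> A" "p \<in> fst c"
  defines "x \<equiv> snd c p"
  defines "M \<equiv> chart_endo J c x" and "M' \<equiv> \<lambda>e h. frechet_derivative (\<lambda>y. chart_endo J c y e) (at x) h"
  shows "nijenhuis A \<epsilon> J X Y p c =
    M' (Y p c) (M (X p c)) - M' (X p c) (M (Y p c)) - M (M' (Y p c) (X p c)) + M (M' (X p c) (Y p c))"
proof -
  have x: "x \<in> chart_image c" and px: "inv_chart c x = p" using c by (simp_all add: x_def inv_chart_snd)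
  have o: "open (chart_image c)" by (rule open_chart_image[OF c(1)])
  define d where "d V = frechet_derivative (\<lambda>y. V (inv_chart c y) c) (at x)" for V :: "('m, 'e) vfield"
  have lM: "linear M" unfolding M_def by (rule linear_chart_endo[OF J c(1) x])
  have Jc: "J p v c = M (v c)" if "v \<in> tangent_space A p" for v
    using chart_endo_component[OF J that c] by (simp add: M_def x_def)
  have MM: "M (M e) = - (\<epsilon> *\<^sub>R e)" for e
  proof -
    let ?v = "chart_vector A c p e"
    have v: "?v \<in> tangent_space A p" by (rule chart_vector_tangent[OF c])
    then have "M (M (?v c)) = - (\<epsilon> *\<^sub>R ?v c)"
      using Jc[OF endo_tangent[OF J v]] Jc[OF v] JJ[OF v] by simp
    then show ?thesis by (simp add: chart_vector_self c)
  qed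
  have JV: "vector_field A (endo_apply J V)" if "vector_field A V" for V
    by (rule vector_field_endo_apply[OF J that])
  have JVc: "endo_apply J V p c = M (V p c)" if "vector_field A V" for V
    by (simp add: endo_apply_def Jc vector_field_tangent that)
  have dJ: "d (endo_apply J V) h = M' (V p c) h + M (d V h)" if V: "vector_field A V" for V h
  proof -
    have "((\<lambda>y. chart_endo J c y (V (inv_chart c y) c)) has_derivative
        (\<lambda>h. M' (V (inv_chart c x) c) h + chart_endo J c x (d V h))) (at x)"
      unfolding M'_def d_def
      by (rule has_derivative_linear_field[OF o x linear_chart_endo[OF J c(1)]
          smooth_on_has_derivative[OF smooth_chart_endo[OF J c(1)] x]
          smooth_on_has_derivative[OF vector_field_smooth[OF V c(1)] x]])
    then have "((\<lambda>y. endo_apply J V (inv_chart c y) c) has_derivative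
        (\<lambda>h. M' (V (inv_chart c x) c) h + chart_endo J c x (d V h))) (at x)"
      by (rule has_derivative_transform_within_open[OF _ o x]) (simp add: chart_endo_apply[OF J V c(1)])
    from frechet_derivative_at[OF this, symmetric] show ?thesis by (simp add: d_def px M_def)
  qed
  have br: "lie_bracket A V W p c = d W (V p c) - d V (W p c)" for V W
    using c by (simp add: lie_bracket_def d_def x_def)
  have Jbr: "endo_apply J (lie_bracket A V W) p c = M (d W (V p c) - d V (W p c))"
    if "vector_field A V" "vector_field A W" for V W
    unfolding br[symmetric] endo_apply_def by (rule Jc[OF lie_bracket_tangent[OF that]])
  show ?thesis
    by (simp add: nijenhuis_def field_scale_def Jbr X Y JV br JVc dJ linear_diff[OF lM] linear_add[OF lM] MM
        algebra_simps)
qed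

lemma nijenhuis_tangent:
  assumes J: "endo_field A J" and X: "vector_field A X" and Y: "vector_field A Y"
  shows "nijenhuis A \<epsilon> J X Y p \<in> tangent_space A p"
  unfolding nijenhuis_def
  by (simp add: endo_apply_def field_scale_def tangent_diff tangent_scale lie_bracket_tangent endo_tangent[OF J]
      vector_field_endo_apply[OF J, unfolded endo_apply_def] X Y)

lemma nijenhuis_pointwise:
  assumes "endo_field A J" "\<And>v. v \<in> tangent_space A p \<Longrightarrow> J p (J p v) = (\<lambda>d. - (\<epsilon> *\<^sub>R v d))"
    and "vector_field A X" "vector_field A Y" "vector_field A X'" "vector_field A Y'" "X p = X' p" "Y p = Y' p"
  shows "nijenhuis A \<epsilon> J X Y p = nijenhuis A \<epsilon> J X' Y' p"
proof (cases "p \<in> carrier A")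
  case True
  note c = chart_at[OF True]
  show ?thesis
    by (rule tangent_eqI[OF nijenhuis_tangent nijenhuis_tangent c])
      (simp_all add: nijenhuis_in_chart[OF assms(1,2) _ _ c] assms(1,3-8))
next
  case False
  then show ?thesis
    using tangent_outside_carrier[OF nijenhuis_tangent] assms(1,3-6) by metis
qed

end

section \<open>The triple of endomorphism fields\<close>

locale lifted_triple = connector_atlas A D K
  for A :: "('m, 'e::euclidean_space) atlas" and D :: "('m, 'e) connection" and K :: "('m, 'e) connector" +
  fixes P :: "('m, 'e) endo" and g :: "('m, 'e) bilinear_field"
    and J1 J2 J3 :: "(('m, 'e) tpoint, 'e \<times> 'e) endo"
  assumes para_hermitian: "almost_para_hermitian A P g"
    and levi_civita: "levi_civita A g D"
    and J1: "endo_field (tangent_bundle A) J1"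
    and J2: "endo_field (tangent_bundle A) J2"
    and J3: "endo_field (tangent_bundle A) J3"
    and J1_lift: "\<And>X. vector_field A X \<Longrightarrow>
           endo_apply J1 (horizontal_lift A K X) = vertical_lift A K X \<and>
           endo_apply J1 (vertical_lift A K X) = - horizontal_lift A K X"
    and J2_lift: "\<And>X. vector_field A X \<Longrightarrow>
           endo_apply J2 (horizontal_lift A K X) = vertical_lift A K (endo_apply P X) \<and>
           endo_apply J2 (vertical_lift A K X) = horizontal_lift A K (endo_apply P X)"
    and J3_lift: "\<And>X. vector_field A X \<Longrightarrow>
           endo_apply J3 (horizontal_lift A K X) = horizontal_lift A K (endo_apply P X) \<and>
           endo_apply J3 (vertical_lift A K X) = - vertical_lift A K (endo_apply P X)"
begin

lemma P_endo: "endo_field A P"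
  using para_hermitian by (simp add: almost_para_hermitian_def almost_product_def)

lemma P_P:
  assumes "v \<in> tangent_space A p" shows "P p (P p v) = v"
proof (cases "p \<in> carrier A")
  case True
  then show ?thesis
    using para_hermitian assms by (simp add: almost_para_hermitian_def almost_product_def)
next
  case False
  then have "v = 0" by (rule tangent_outside_carrier[OF assms])
  then show ?thesis by (simp add: endo_0[OF P_endo])
qed

abbreviation PF :: "('m, 'e) vfield \<Rightarrow> ('m, 'e) vfield" where "PF \<equiv> endo_apply P"

lemma PF_field: "vector_field A X \<Longrightarrow> vector_field A (PF X)"
  by (rule vector_field_endo_apply[OF P_endo])

lemma PF_PF: "vector_field A X \<Longrightarrow> PF (PF X) = X"
  by (simp add: endo_apply_def P_P vector_field_tangent)

lemma PF_minus: "vector_field A X \<Longrightarrow> PF (- X) = - PF X"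
  by (intro ext) (simp add: endo_apply_def endo_minus[OF P_endo] vector_field_tangent)

lemma PF_diff: "vector_field A X \<Longrightarrow> vector_field A Y \<Longrightarrow> PF (X - Y) = PF X - PF Y"
  by (intro ext) (simp add: endo_apply_def endo_diff[OF P_endo] vector_field_tangent)

lemma PF_0: "PF 0 = 0"
  by (intro ext) (simp add: endo_apply_def endo_0[OF P_endo])

lemma torsion_free: "vector_field A X \<Longrightarrow> vector_field A Y \<Longrightarrow> lie_bracket A X Y = D X Y - D Y X"
  using levi_civita by (simp add: levi_civita_def)

lemma bracket_field: "vector_field A X \<Longrightarrow> vector_field A Y \<Longrightarrow> vector_field A (lie_bracket A X Y)"
  by (simp add: torsion_free vector_field_diff D_field)

lemma curvature_field:
  "vector_field A X \<Longrightarrow> vector_field A Y \<Longrightarrow> vector_field A Z \<Longrightarrow> vector_field A (curvature A D X Y Z)"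
  by (simp add: curvature_def vector_field_diff D_field bracket_field)

lemmas fields = vector_field_0 vector_field_minus vector_field_diff PF_field D_field curvature_field

context
  fixes p w a k
  assumes t: "(p, w) \<in> carrier TA" and a: "a \<in> tangent_space A p" and k: "k \<in> tangent_space A p"
begin

lemma J_lift_split:
  assumes "endo_field TA J"
  shows "J (p, w) (lift (p, w) a k) = J (p, w) (lift (p, w) a 0) + J (p, w) (lift (p, w) 0 k)"
  using t a k
  by (simp add: TM.endo_add[OF assms, symmetric] lift_characterization tangent_0 lift_add)

text \<open>Every tangent vector of the base is the value of a vector field, so the action on lifts of fields
  determines the action on single vectors.\<close>

lemma J_on_lift:
  shows "J1 (p, w) (lift (p, w) a k) = lift (p, w) (- k) a"
    and "J2 (p, w) (lift (p, w) a k) = lift (p, w) (P p k) (P p a)"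
    and "J3 (p, w) (lift (p, w) a k) = lift (p, w) (P p a) (- P p k)"
proof -
  obtain X where X: "vector_field A X" "X p = a" by (rule vector_field_through[OF a])
  obtain Y where Y: "vector_field A Y" "Y p = k" by (rule vector_field_through[OF k])
  have h: "J (p, w) (lift (p, w) a 0) = endo_apply J (horizontal_lift A K X) (p, w)"
    and v: "J (p, w) (lift (p, w) 0 k) = endo_apply J (vertical_lift A K Y) (p, w)"
    for J :: "(('m, 'e) tpoint, 'e \<times> 'e) endo"
    by (simp_all add: endo_apply_def horizontal_lift_eq vertical_lift_eq X Y)
  have Pt: "P p a \<in> tangent_space A p" "P p k \<in> tangent_space A p"
    using endo_tangent[OF P_endo] a k by auto
  have "J1 (p, w) (lift (p, w) a 0) = lift (p, w) 0 a" "J1 (p, w) (lift (p, w) 0 k) = - lift (p, w) k 0"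
    unfolding h v by (simp_all add: J1_lift X Y, simp_all add: horizontal_lift_eq vertical_lift_eq PF_field X Y)
  then show "J1 (p, w) (lift (p, w) a k) = lift (p, w) (- k) a"
    using t a k by (simp add: J_lift_split[OF J1] lift_minus lift_add tangent_0 tangent_minus)
  have "J2 (p, w) (lift (p, w) a 0) = lift (p, w) 0 (P p a)" "J2 (p, w) (lift (p, w) 0 k) = lift (p, w) (P p k) 0"
    unfolding h v by (simp_all add: J2_lift X Y, simp_all add: horizontal_lift_eq vertical_lift_eq PF_field X Y, simp_all add: endo_apply_def X Y)
  then show "J2 (p, w) (lift (p, w) a k) = lift (p, w) (P p k) (P p a)"
    using t Pt by (simp add: J_lift_split[OF J2] lift_add tangent_0)
  have "J3 (p, w) (lift (p, w) a 0) = lift (p, w) (P p a) 0" "J3 (p, w) (lift (p, w) 0 k) = - lift (p, w) 0 (P p k)"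
    unfolding h v by (simp_all add: J3_lift X Y, simp_all add: horizontal_lift_eq vertical_lift_eq PF_field X Y, simp_all add: endo_apply_def X Y)
  then show "J3 (p, w) (lift (p, w) a k) = lift (p, w) (P p a) (- P p k)"
    using t Pt by (simp add: J_lift_split[OF J3] lift_minus lift_add tangent_0 tangent_minus)
qed

end

lemma lift_inject:
  assumes "(p, w) \<in> carrier TA" "a \<in> tangent_space A p" "k \<in> tangent_space A p"
    "a' \<in> tangent_space A p" "k' \<in> tangent_space A p" "lift (p, w) a k = lift (p, w) a' k'"
  shows "a = a'" "k = k'"
  using lift_characterization(2,3)[OF assms(1-3)] lift_characterization(2,3)[OF assms(1,4,5)] assms(6) by simp_all

lemma lift_cases:
  assumes "(p, w) \<in> carrier TA" "\<zeta> \<in> tangent_space TA (p, w)"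
  obtains a k where "a \<in> tangent_space A p" "k \<in> tangent_space A p" "\<zeta> = lift (p, w) a k"
  using that[OF pushforward_fst_tangent[OF assms] connector_tangent[OF assms]] lift_unique[OF assms] by simp

lemma J_squares:
  assumes "\<zeta> \<in> tangent_space TA t"
  shows "J1 t (J1 t \<zeta>) = - \<zeta>" "J2 t (J2 t \<zeta>) = \<zeta>" "J3 t (J3 t \<zeta>) = \<zeta>"
proof -
  obtain p w where pw: "t = (p, w)" by (cases t)
  have "J1 t (J1 t \<zeta>) = - \<zeta> \<and> J2 t (J2 t \<zeta>) = \<zeta> \<and> J3 t (J3 t \<zeta>) = \<zeta>"
  proof (cases "t \<in> carrier TA")
    case True
    then have t: "(p, w) \<in> carrier TA" by (simp add: pw)
    obtain a k where a: "a \<in> tangent_space A p" and k: "k \<in> tangent_space A p" and z: "\<zeta> = lift (p, w) a k"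
      by (rule lift_cases[OF t assms[unfolded pw]])
    have P: "P p a \<in> tangent_space A p" "P p k \<in> tangent_space A p"
      using endo_tangent[OF P_endo] a k by auto
    have "J1 (p, w) (J1 (p, w) \<zeta>) = - \<zeta>"
      by (simp only: z J_on_lift(1)[OF t a k] J_on_lift(1)[OF t tangent_minus[OF k] a] lift_minus[OF t a k])
    moreover have "J2 (p, w) (J2 (p, w) \<zeta>) = \<zeta>"
      by (simp only: z J_on_lift(2)[OF t a k] J_on_lift(2)[OF t P(2,1)] P_P[OF a] P_P[OF k])
    moreover have "J3 (p, w) (J3 (p, w) \<zeta>) = \<zeta>"
      by (simp only: z J_on_lift(3)[OF t a k] J_on_lift(3)[OF t P(1) tangent_minus[OF P(2)]] P_P[OF a] P_P[OF k]
          endo_minus[OF P_endo P(2)] minus_minus)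
    ultimately show ?thesis unfolding pw by blast
  next
    case False
    then have "\<zeta> = 0" by (rule tangent_outside_carrier[OF assms])
    then show ?thesis by (simp add: TM.endo_0[OF J1] TM.endo_0[OF J2] TM.endo_0[OF J3])
  qed
  then show "J1 t (J1 t \<zeta>) = - \<zeta>" "J2 t (J2 t \<zeta>) = \<zeta>" "J3 t (J3 t \<zeta>) = \<zeta>" by auto
qed

text \<open>Only the conditions \<open>J \<noteq> \<plusminus> id\<close> are not formal. They are witnessed over a point where \<open>P\<close> differs from
  plus or minus the identity, by horizontal vectors; any vector of the fibre serves as base point, here zero.\<close>

lemma para_hypercomplex: "almost_para_hypercomplex TA (J1, J2, J3)"
proof -
  obtain p v where p: "p \<in> carrier A" and v: "v \<in> tangent_space A p" "P p v \<noteq> v"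
    using para_hermitian unfolding almost_para_hermitian_def almost_product_def by blast
  obtain q u where q: "q \<in> carrier A" and u: "u \<in> tangent_space A q" "P q u \<noteq> - u"
    using para_hermitian unfolding almost_para_hermitian_def almost_product_def by blast
  have t: "(p, 0) \<in> carrier TA" "(q, 0) \<in> carrier TA" using p q by (simp_all add: carrier_tangent_bundle tangent_0)
  have v0: "v \<noteq> 0" using v(2) endo_0[OF P_endo] by metis
  have Pv: "P p v \<in> tangent_space A p" and Pu: "P q u \<in> tangent_space A q"
    using endo_tangent[OF P_endo] u v by auto
  have V: "lift (p, 0) v 0 \<in> tangent_space TA (p, 0)" and U: "lift (q, 0) u 0 \<in> tangent_space TA (q, 0)"
    using t u v by (simp_all add: lift_characterization tangent_0)
  have n1: "J2 (p, 0) (lift (p, 0) v 0) \<noteq> lift (p, 0) v 0"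
    using lift_inject(1)[OF t(1) tangent_0 Pv v(1) tangent_0] v0
    by (auto simp: J_on_lift[OF t(1) v(1) tangent_0] endo_0[OF P_endo])
  have n2: "J2 (p, 0) (lift (p, 0) v 0) \<noteq> - lift (p, 0) v 0"
    using lift_inject(1)[OF t(1) tangent_0 Pv tangent_minus[OF v(1)] tangent_0] v0
    by (auto simp: J_on_lift[OF t(1) v(1) tangent_0] endo_0[OF P_endo] lift_minus[OF t(1) v(1) tangent_0])
  have n3: "J3 (p, 0) (lift (p, 0) v 0) \<noteq> lift (p, 0) v 0"
    using lift_inject(1)[OF t(1) Pv tangent_0 v(1) tangent_0] v(2)
    by (auto simp: J_on_lift[OF t(1) v(1) tangent_0] endo_0[OF P_endo])
  have n4: "J3 (q, 0) (lift (q, 0) u 0) \<noteq> - lift (q, 0) u 0"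
    using lift_inject(1)[OF t(2) Pu tangent_0 tangent_minus[OF u(1)] tangent_0] u(2)
    by (auto simp: J_on_lift[OF t(2) u(1) tangent_0] endo_0[OF P_endo] lift_minus[OF t(2) u(1) tangent_0])
  have "J2 t' (J1 t' \<zeta>) = - J1 t' (J2 t' \<zeta>) \<and> - J1 t' (J2 t' \<zeta>) = J3 t' \<zeta>"
    if t': "t' \<in> carrier TA" and z: "\<zeta> \<in> tangent_space TA t'" for t' \<zeta>
  proof -
    obtain p w where pw: "t' = (p, w)" by (cases t')
    have t: "(p, w) \<in> carrier TA" using t' pw by simp
    obtain a k where a: "a \<in> tangent_space A p" and k: "k \<in> tangent_space A p" and z: "\<zeta> = lift (p, w) a k"
      by (rule lift_cases[OF t z[unfolded pw]])
    have P: "P p a \<in> tangent_space A p" "P p k \<in> tangent_space A p"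
      using endo_tangent[OF P_endo] a k by auto
    show ?thesis
      unfolding pw z J_on_lift[OF t a k] J_on_lift(2)[OF t tangent_minus[OF k] a] J_on_lift(1)[OF t P(2,1)]
        lift_minus[OF t tangent_minus[OF P(1)] P(2)]
      by (simp only: endo_minus[OF P_endo k] minus_minus simp_thms)
  qed
  moreover have "almost_complex TA J1"
    unfolding almost_complex_def by (intro conjI ballI J1 J_squares)
  moreover have "almost_product TA J2"
    unfolding almost_product_def
  proof (intro conjI ballI J2 J_squares)
    show "\<not> (\<forall>t\<in>carrier TA. \<forall>\<zeta>\<in>tangent_space TA t. J2 t \<zeta> = \<zeta>)" using t(1) V n1 by blast
    show "\<not> (\<forall>t\<in>carrier TA. \<forall>\<zeta>\<in>tangent_space TA t. J2 t \<zeta> = - \<zeta>)" using t(1) V n2 by blast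
  qed
  moreover have "almost_product TA J3"
    unfolding almost_product_def
  proof (intro conjI ballI J3 J_squares)
    show "\<not> (\<forall>t\<in>carrier TA. \<forall>\<zeta>\<in>tangent_space TA t. J3 t \<zeta> = \<zeta>)" using t(1) V n3 by blast
    show "\<not> (\<forall>t\<in>carrier TA. \<forall>\<zeta>\<in>tangent_space TA t. J3 t \<zeta> = - \<zeta>)" using t(2) U n4 by blast
  qed
  ultimately show ?thesis by (simp add: almost_para_hypercomplex_def)
qed

section \<open>The Nijenhuis tensors on lifts\<close>

lemma J_on_lift_field:
  assumes "vector_field A X" "vector_field A Y"
  shows "endo_apply J1 (lift_field X Y) = lift_field (- Y) X"
    and "endo_apply J2 (lift_field X Y) = lift_field (PF Y) (PF X)"
    and "endo_apply J3 (lift_field X Y) = lift_field (PF X) (- PF Y)"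
proof -
  have "J1 t (lift_field X Y t) = lift_field (- Y) X t \<and> J2 t (lift_field X Y t) = lift_field (PF Y) (PF X) t \<and>
      J3 t (lift_field X Y t) = lift_field (PF X) (- PF Y) t" for t
  proof (cases "t \<in> carrier TA")
    case True
    then show ?thesis
      by (cases t) (simp add: J_on_lift vector_field_tangent assms endo_apply_def)
  next
    case False
    then show ?thesis by (simp add: lift_outside TM.endo_0[OF J1] TM.endo_0[OF J2] TM.endo_0[OF J3])
  qed
  then show "endo_apply J1 (lift_field X Y) = lift_field (- Y) X"
    "endo_apply J2 (lift_field X Y) = lift_field (PF Y) (PF X)"
    "endo_apply J3 (lift_field X Y) = lift_field (PF X) (- PF Y)"
    unfolding endo_apply_def by auto
qed

context
  fixes p :: 'm and W :: "('m, 'e) vfield"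
  assumes p: "p \<in> carrier A" and W: "vector_field A W"
begin

abbreviation lift_at :: "('m, 'e) vfield \<Rightarrow> ('m, 'e) vfield \<Rightarrow> (('m, 'e) tpoint, 'e \<times> 'e) tvector" where
  "lift_at X Y \<equiv> lift (p, W p) (X p) (Y p)"

lemma point_in_bundle: "(p, W p) \<in> carrier TA"
  using p W by (simp add: carrier_tangent_bundle vector_field_tangent)

lemma bracket_at:
  assumes "vector_field A X1" "vector_field A Y1" "vector_field A X2" "vector_field A Y2"
  shows "lie_bracket TA (lift_field X1 Y1) (lift_field X2 Y2) (p, W p) =
    lift_at (D X1 X2 - D X2 X1) (D X1 Y2 - D X2 Y1 - curvature A D X1 X2 W)"
  using lie_bracket_lift_field[OF assms W p bracket_field[OF assms(1,3)]] assms by (simp add: torsion_free)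

lemma lift_at_diff:
  assumes "vector_field A X" "vector_field A Y" "vector_field A X'" "vector_field A Y'"
  shows "lift_at X Y - lift_at X' Y' = lift_at (X - X') (Y - Y')"
proof -
  have "lift_at X Y - lift_at X' Y' = lift_at X Y + lift (p, W p) (- X' p) (- Y' p)"
    using assms by (simp add: lift_minus[OF point_in_bundle, symmetric] vector_field_tangent)
  also have "\<dots> = lift_at (X - X') (Y - Y')"
    using assms by (simp add: lift_add[OF point_in_bundle] vector_field_tangent tangent_minus)
  finally show ?thesis .
qed

lemma J_at:
  assumes "vector_field A X" "vector_field A Y"
  shows "J1 (p, W p) (lift_at X Y) = lift_at (- Y) X"
    and "J2 (p, W p) (lift_at X Y) = lift_at (PF Y) (PF X)"
    and "J3 (p, W p) (lift_at X Y) = lift_at (PF X) (- PF Y)"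
  using assms by (simp_all add: J_on_lift[OF point_in_bundle] vector_field_tangent endo_apply_def)

lemma lift_at_minus:
  assumes "vector_field A X" "vector_field A Y"
  shows "- lift_at X Y = lift_at (- X) (- Y)"
  using assms by (simp add: lift_minus[OF point_in_bundle] vector_field_tangent)

lemma nijenhuis_at:
  "nijenhuis TA 1 J Z Z' (p, W p) =
    lie_bracket TA (endo_apply J Z) (endo_apply J Z') (p, W p) - J (p, W p) (lie_bracket TA Z (endo_apply J Z') (p, W p))
    - J (p, W p) (lie_bracket TA (endo_apply J Z) Z' (p, W p)) - lie_bracket TA Z Z' (p, W p)"
  "nijenhuis TA (- 1) J Z Z' (p, W p) =
    lie_bracket TA (endo_apply J Z) (endo_apply J Z') (p, W p) - J (p, W p) (lie_bracket TA Z (endo_apply J Z') (p, W p))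
    - J (p, W p) (lie_bracket TA (endo_apply J Z) Z' (p, W p)) - (- lie_bracket TA Z Z' (p, W p))"
  by (simp_all add: nijenhuis_def endo_apply_def field_scale_def fun_eq_iff)

lemma curvature_0: "vector_field A X \<Longrightarrow> curvature A D X 0 W = 0" "vector_field A X \<Longrightarrow> curvature A D 0 X W = 0"
  by (simp_all add: curvature_def torsion_free W fields D_0_left D_0_right)

text \<open>The horizontal part is \<open>D\<^sub>X Y - D\<^sub>Y X - [X, Y]\<close>, which is zero since the torsion vanishes; the vertical part of
  \<open>[X\<^sup>h, Y\<^sup>h]\<close> is all that remains.\<close>

lemma nijenhuis_J1_horizontal:
  assumes "vector_field A X" "vector_field A Y"
  shows "nijenhuis TA 1 J1 (lift_field X 0) (lift_field Y 0) (p, W p) =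
    lift_at 0 (curvature A D X Y W)"
  by (simp only: nijenhuis_at J_on_lift_field bracket_at J_at lift_at_diff assms W fields D_0_left D_0_right
      curvature_0 minus_zero diff_zero diff_0)
    (rule arg_cong2[where f="\<lambda>U V. lift_at U V"]; simp add: algebra_simps)

text \<open>Up to an application of \<open>P\<close>, the horizontal part is the difference of \<open>(D\<^sub>Y P) X\<close> and \<open>(D\<^sub>X P) Y\<close>.\<close>

lemma nijenhuis_J2_horizontal:
  assumes "vector_field A X" "vector_field A Y"
  shows "nijenhuis TA (- 1) J2 (lift_field X 0) (lift_field Y 0) (p, W p) =
    lift_at (PF (D Y (PF X)) - PF (D X (PF Y)) + (D X Y - D Y X)) (- curvature A D X Y W)"
  by (simp only: nijenhuis_at J_on_lift_field bracket_at J_at lift_at_diff lift_at_minus assms W fields D_0_left D_0_right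
      curvature_0 PF_0 PF_minus minus_zero diff_zero diff_0)
    (rule arg_cong2[where f="\<lambda>U V. lift_at U V"]; simp add: algebra_simps)

lemma nijenhuis_lift_field_zero:
  assumes flat: "flat A D" and parallel: "parallel_endo A D P"
    and f: "vector_field A X1" "vector_field A Y1" "vector_field A X2" "vector_field A Y2"
  shows "nijenhuis TA 1 J1 (lift_field X1 Y1) (lift_field X2 Y2) (p, W p) = 0"
    and "nijenhuis TA (- 1) J2 (lift_field X1 Y1) (lift_field X2 Y2) (p, W p) = 0"
    and "nijenhuis TA (- 1) J3 (lift_field X1 Y1) (lift_field X2 Y2) (p, W p) = 0"
proof -
  have par: "D X (PF Y) = PF (D X Y)" if "vector_field A X" "vector_field A Y" for X Y
    using parallel that by (simp add: parallel_endo_def)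
  have curv: "curvature A D X Y W = 0" if "vector_field A X" "vector_field A Y" for X Y
    using flat that W by (simp add: flat_def)
  have zero: "lift_at X Y = 0" if "X = 0" "Y = 0" for X Y
    using lift_at_diff[of 0 0 0 0] by (simp add: that vector_field_0)
  \<comment> \<open>Since \<open>P\<close> commutes with \<open>D\<close>, both parts become signed sums of covariant derivatives that cancel.\<close>
  note rules = nijenhuis_at J_on_lift_field bracket_at J_at lift_at_diff lift_at_minus f fields curv par
    D_minus_left D_minus_right PF_minus PF_diff PF_PF PF_0 minus_zero diff_zero diff_0
  show "nijenhuis TA 1 J1 (lift_field X1 Y1) (lift_field X2 Y2) (p, W p) = 0"
    by (simp only: rules) (rule zero; simp add: fun_eq_iff algebra_simps)
  show "nijenhuis TA (- 1) J2 (lift_field X1 Y1) (lift_field X2 Y2) (p, W p) = 0"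
    by (simp only: rules) (rule zero; simp add: fun_eq_iff algebra_simps)
  show "nijenhuis TA (- 1) J3 (lift_field X1 Y1) (lift_field X2 Y2) (p, W p) = 0"
    by (simp only: rules) (rule zero; simp add: fun_eq_iff algebra_simps)
qed

end

section \<open>The metric\<close>

lemma metric_bilinear:
  assumes "p \<in> carrier A" "u \<in> tangent_space A p" "v \<in> tangent_space A p" "w \<in> tangent_space A p"
  shows "g p u v = g p v u" "g p (u + w) v = g p u v + g p w v" "g p (\<lambda>c. r *\<^sub>R u c) v = r * g p u v"
proof -
  have "\<forall>p\<in>carrier A. \<forall>u\<in>tangent_space A p. \<forall>v\<in>tangent_space A p. g p u v = g p v u \<and>
      (\<forall>w\<in>tangent_space A p. g p (u + w) v = g p u v + g p w v) \<and>
      (\<forall>r. g p (\<lambda>c. r *\<^sub>R u c) v = r * g p u v)"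
    using para_hermitian unfolding almost_para_hermitian_def semi_riemannian_metric_def by (elim conjE)
  from bspec[OF bspec[OF bspec[OF this assms(1)] assms(2)] assms(3)] assms(4)
  show "g p u v = g p v u" "g p (u + w) v = g p u v + g p w v" "g p (\<lambda>c. r *\<^sub>R u c) v = r * g p u v"
    by simp_all
qed

lemma metric_add_right:
  assumes "p \<in> carrier A" "u \<in> tangent_space A p" "v \<in> tangent_space A p" "w \<in> tangent_space A p"
  shows "g p v (u + w) = g p v u + g p v w"
  using metric_bilinear[OF assms] metric_bilinear(1)[OF assms(1) tangent_add[OF assms(2,4)] assms(3) assms(4)]
    metric_bilinear(1)[OF assms(1,4,3,4)] by simp

lemma metric_scale_right:
  assumes "p \<in> carrier A" "u \<in> tangent_space A p" "v \<in> tangent_space A p"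
  shows "g p v (\<lambda>c. r *\<^sub>R u c) = r * g p v u"
  using metric_bilinear[OF assms assms(3)] metric_bilinear(1)[OF assms(1) tangent_scale[OF assms(2)] assms(3,3)] by simp

lemma metric_minus_left:
  assumes "p \<in> carrier A" "u \<in> tangent_space A p" "v \<in> tangent_space A p"
  shows "g p (- u) v = - g p u v"
  using metric_bilinear(3)[OF assms assms(3), of "-1"] by (simp add: fun_Compl_def)

lemma metric_minus_right:
  assumes "p \<in> carrier A" "u \<in> tangent_space A p" "v \<in> tangent_space A p"
  shows "g p v (- u) = - g p v u"
  using metric_scale_right[OF assms, of "-1"] by (simp add: fun_Compl_def)

lemma metric_diff:
  assumes "p \<in> carrier A" "u \<in> tangent_space A p" "v \<in> tangent_space A p" "w \<in> tangent_space A p"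
  shows "g p (u - w) v = g p u v - g p w v" "g p v (u - w) = g p v u - g p v w"
  using metric_bilinear(2)[OF assms(1-3) tangent_minus[OF assms(4)]]
    metric_add_right[OF assms(1-3) tangent_minus[OF assms(4)]]
    metric_minus_left[OF assms(1,4,3)] metric_minus_right[OF assms(1,4,3)] by simp_all

lemma metric_P:
  assumes "p \<in> carrier A" "vector_field A X" "vector_field A Y"
  shows "g p (PF X p) (Y p) = - g p (X p) (PF Y p)"
proof -
  have "\<forall>X Y. vector_field A X \<longrightarrow> vector_field A Y \<longrightarrow> (\<forall>p\<in>carrier A. g p (PF X p) (PF Y p) = - g p (X p) (Y p))"
    using para_hermitian by (simp add: almost_para_hermitian_def)
  then have "g p (PF X p) (PF (PF Y) p) = - g p (X p) (PF Y p)"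
    using assms PF_field[OF assms(3)] by blast
  then show ?thesis by (simp add: PF_PF assms)
qed

lemma smooth_metric:
  assumes X: "vector_field A X" and Y: "vector_field A Y" and c: "c \<in> A"
  shows "smooth_on (chart_image c) ((\<lambda>q. g q (X q) (Y q)) \<circ> inv_chart c)"
proof -
  define G where "G x a b = g (inv_chart c x) (chart_vector A c (inv_chart c x) a) (chart_vector A c (inv_chart c x) b)" for x a b
  let ?U = "chart_image c"
  have o: "open ?U" by (rule open_chart_image[OF c])
  have sm: "smooth_on ?U (\<lambda>x. G x a b)" for a b
    using para_hermitian c by (simp add: almost_para_hermitian_def semi_riemannian_metric_def G_def)
  have car: "inv_chart c x \<in> carrier A" if "x \<in> ?U" for x using in_carrier[OF c inv_chart_in[OF that]] .
  note cv = chart_vector_add[OF c inv_chart_in] chart_vector_scale[OF c inv_chart_in] chart_vector_tangent[OF c inv_chart_in]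
  have l1: "linear (\<lambda>a. G x a b)" if "x \<in> ?U" for x b
    by (rule linearI) (simp_all add: G_def cv[OF that] metric_bilinear(2,3)[OF car[OF that] _ _ tangent_0]
      metric_bilinear(2)[OF car[OF that]])
  have l2: "linear (G x a)" if "x \<in> ?U" for x a
    by (rule linearI) (simp_all add: G_def cv[OF that] metric_add_right[OF car[OF that]] metric_scale_right[OF car[OF that]])
  have GX: "smooth_on ?U (\<lambda>x. G x (X (inv_chart c x) c) b)" for b
    by (rule smooth_on_linear_field[where J="\<lambda>x a. G x a b", OF o l1 sm vector_field_smooth[OF X c]])
  have "smooth_on ?U (\<lambda>x. G x (X (inv_chart c x) c) (Y (inv_chart c x) c))"
    by (rule smooth_on_linear_field[where J="\<lambda>x. G x (X (inv_chart c x) c)", OF o l2 GX vector_field_smooth[OF Y c]])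
  then show ?thesis
    by (rule smooth_on_cong[OF o, THEN iffD1, rotated])
      (simp add: G_def chart_vector_component vector_field_tangent X Y c inv_chart_in)
qed

text \<open>Differentiate \<open>g(P Y, Z) = - g(Y, P Z)\<close> along \<open>X\<close> and use that the metric is parallel.\<close>

lemma nabla_P_skew:
  assumes p: "p \<in> carrier A" and f: "vector_field A X" "vector_field A Y" "vector_field A Z"
  shows "g p ((D X (PF Y) - PF (D X Y)) p) (Z p) = - g p (Y p) ((D X (PF Z) - PF (D X Z)) p)"
proof -
  note fs = f fields vector_field_tangent
  define c where "c = chart_at A p"
  have c: "c \<in> A" "p \<in> fst c" using chart_at[OF p] by (auto simp: c_def)
  have x: "snd c p \<in> chart_image c" using c by simp
  have o: "open (chart_image c)" by (rule open_chart_image[OF c(1)])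
  let ?f = "\<lambda>q. g q (PF Y q) (Z q)" and ?h = "\<lambda>q. g q (Y q) (PF Z q)"
  have compat: "field_derivative A X (\<lambda>q. g q (V q) (V' q)) p = g p (D X V p) (V' p) + g p (V p) (D X V' p)"
    if "vector_field A V" "vector_field A V'" for V V'
    using levi_civita p f(1) that by (simp add: levi_civita_def)
  have h: "((?h \<circ> inv_chart c) has_derivative frechet_derivative (?h \<circ> inv_chart c) (at (snd c p))) (at (snd c p))"
    by (rule smooth_on_has_derivative[OF smooth_metric[OF f(2) PF_field[OF f(3)] c(1)] x])
  have "((?f \<circ> inv_chart c) has_derivative (\<lambda>v. - frechet_derivative (?h \<circ> inv_chart c) (at (snd c p)) v)) (at (snd c p))"
    by (rule has_derivative_transform_within_open[OF has_derivative_minus[OF h] o x])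
      (simp add: metric_P[OF in_carrier[OF c(1) inv_chart_in] f(2,3)])
  from frechet_derivative_at[OF this]
  have "field_derivative A X ?f p = - field_derivative A X ?h p"
    by (simp add: field_derivative_def c_def[symmetric] fun_eq_iff)
  then have "g p (D X (PF Y) p) (Z p) + g p (PF Y p) (D X Z p) = - (g p (D X Y p) (PF Z p) + g p (Y p) (D X (PF Z) p))"
    using compat[of "PF Y" Z] compat[of Y "PF Z"] by (simp add: fs)
  moreover have "g p (PF Y p) (D X Z p) = - g p (Y p) (PF (D X Z) p)"
    by (rule metric_P[OF p]) (simp_all add: fs)
  moreover have "g p (PF (D X Y) p) (Z p) = - g p (D X Y p) (PF Z p)"
    by (rule metric_P[OF p]) (simp_all add: fs)
  moreover have "g p ((D X (PF Y) - PF (D X Y)) p) (Z p) = g p (D X (PF Y) p) (Z p) - g p (PF (D X Y) p) (Z p)"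
    using metric_diff(1)[OF p, of "D X (PF Y) p" "Z p" "PF (D X Y) p"] by (simp add: fs)
  moreover have "g p (Y p) ((D X (PF Z) - PF (D X Z)) p) = g p (Y p) (D X (PF Z) p) - g p (Y p) (PF (D X Z) p)"
    using metric_diff(2)[OF p, of "D X (PF Z) p" "Y p" "PF (D X Z) p"] by (simp add: fs)
  ultimately show ?thesis by linarith
qed

text \<open>Write \<open>S(X, Y, Z) = g((D\<^sub>X P) Y, Z)\<close>, symmetric in \<open>X, Y\<close> and skew in \<open>Y, Z\<close>. Then
  \<open>S(X, Y, Z) = - S(X, Z, Y) = - S(Z, X, Y) = S(Z, Y, X) = S(Y, Z, X) = - S(Y, X, Z) = - S(X, Y, Z)\<close>, and
  \<open>g\<close> is nondegenerate.\<close>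

lemma parallel_if_symmetric:
  assumes sym: "\<And>X Y. vector_field A X \<Longrightarrow> vector_field A Y \<Longrightarrow>
    D X (PF Y) - PF (D X Y) = D Y (PF X) - PF (D Y X)"
  shows "parallel_endo A D P"
  unfolding parallel_endo_def
proof (intro allI impI)
  fix X Y assume f: "vector_field A X" "vector_field A Y"
  define T where "T X Y = D X (PF Y) - PF (D X Y)" for X Y
  have Tf: "vector_field A (T X Y)" if "vector_field A X" "vector_field A Y" for X Y
    using that by (simp add: T_def fields)
  have "T X Y = 0"
  proof (rule vector_field_eqI[OF Tf[OF f] vector_field_0])
    fix p assume p: "p \<in> carrier A"
    define S where "S X Y Z = g p (T X Y p) (Z p)" for X Y Z
    have skew: "S X Y Z = - S X Z Y" if f: "vector_field A X" "vector_field A Y" "vector_field A Z" for X Y Z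
    proof -
      have "S X Y Z = - g p (Y p) (T X Z p)"
        unfolding S_def T_def by (rule nabla_P_skew[OF p f])
      also have "g p (Y p) (T X Z p) = S X Z Y"
        unfolding S_def by (rule metric_bilinear(1)[OF p _ _ tangent_0]) (simp_all add: vector_field_tangent Tf f)
      finally show ?thesis .
    qed
    have s: "S X Y Z = S Y X Z" if "vector_field A X" "vector_field A Y" for X Y Z
      using sym[OF that] by (simp add: S_def T_def)
    have S0: "S X Y Z = 0" if Z: "vector_field A Z" for Z
      using skew[OF f Z] s[OF f(1) Z, of Y] skew[OF Z f] s[OF Z f(2), of X] skew[OF f(2) Z f(1)] s[OF f(2,1), of Z] by linarith
    have "g p (T X Y p) v = 0" if v: "v \<in> tangent_space A p" for v
    proof -
      obtain Z where "vector_field A Z" "Z p = v" by (rule vector_field_through[OF v])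
      then show ?thesis using S0[of Z] by (simp add: S_def)
    qed
    moreover have "\<forall>p\<in>carrier A. \<forall>u\<in>tangent_space A p. (\<forall>v\<in>tangent_space A p. g p u v = 0) \<longrightarrow> u = 0"
      using para_hermitian by (simp add: almost_para_hermitian_def semi_riemannian_metric_def)
    ultimately show "T X Y p = 0 p"
      using p vector_field_tangent[OF Tf[OF f]] by simp
  qed
  then show "D X (PF Y) - PF (D X Y) = 0" by (simp add: T_def)
qed

section \<open>Integrability\<close>

lemma integrable_imp_flat_parallel:
  assumes "integrable_triple TA (J1, J2, J3)"
  shows "flat A D" "parallel_endo A D P"
proof -
  have N1: "nijenhuis TA 1 J1 U V = 0" and N2: "nijenhuis TA (- 1) J2 U V = 0"
    if "vector_field TA U" "vector_field TA V" for U V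
    using assms that by (simp_all add: integrable_triple_def)
  show "flat A D"
    unfolding flat_def
  proof (intro allI impI)
    fix X Y W assume f: "vector_field A X" "vector_field A Y" "vector_field A W"
    show "curvature A D X Y W = 0"
    proof (rule vector_field_eqI[OF curvature_field[OF f] vector_field_0])
      fix p assume p: "p \<in> carrier A"
      have "lift (p, W p) (0 p) (curvature A D X Y W p) = 0"
        using nijenhuis_J1_horizontal[OF p f(3,1,2)]
          N1[OF vector_field_lift[OF f(1) vector_field_0] vector_field_lift[OF f(2) vector_field_0]]
        by simp
      also have "0 = lift (p, W p) 0 0"
        using lift_at_diff[OF p f(3), of 0 0 0 0] by (simp add: vector_field_0)
      finally show "curvature A D X Y W p = 0 p"
        using lift_inject(2)[OF point_in_bundle[OF p f(3)] tangent_0 vector_field_tangent[OF curvature_field[OF f]] tangent_0 tangent_0]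
        by simp
    qed
  qed
  show "parallel_endo A D P"
  proof (rule parallel_if_symmetric)
    fix X Y assume f: "vector_field A X" "vector_field A Y"
    let ?E = "PF (D Y (PF X)) - PF (D X (PF Y)) + (D X Y - D Y X)"
    have E: "vector_field A ?E" by (simp add: fields f vector_field_add)
    have "?E = 0"
    proof (rule vector_field_eqI[OF E vector_field_0])
      fix p assume p: "p \<in> carrier A"
      note z = vector_field_0
      have "lift (p, 0 p) (?E p) ((- curvature A D X Y 0) p) = 0"
        using nijenhuis_J2_horizontal[OF p z f] N2[OF vector_field_lift[OF f(1) z] vector_field_lift[OF f(2) z]] by simp
      also have "0 = lift (p, 0 p) 0 0"
        using lift_at_diff[OF p z, of 0 0 0 0] by (simp add: vector_field_0)
      finally show "?E p = 0 p"
        using lift_inject(1)[OF point_in_bundle[OF p z] vector_field_tangent[OF E]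
            vector_field_tangent[OF vector_field_minus[OF curvature_field[OF f z]]] tangent_0 tangent_0]
        by simp
    qed
    moreover have "PF (D X (PF Y)) - PF (D Y (PF X)) = (D X Y - D Y X) - ?E"
      by (simp add: algebra_simps)
    ultimately have "PF (D X (PF Y)) - PF (D Y (PF X)) = D X Y - D Y X"
      by (simp only: diff_zero)
    then have "PF (PF (D X (PF Y)) - PF (D Y (PF X))) = PF (D X Y - D Y X)" by (rule arg_cong)
    then show "D X (PF Y) - PF (D X Y) = D Y (PF X) - PF (D Y X)"
      by (simp add: PF_diff PF_PF fields f algebra_simps)
  qed
qed

text \<open>At a given point both arguments may be replaced by fields composed of lifts, since the
  Nijenhuis tensor is determined by their values there.\<close>

lemma flat_parallel_imp_integrable:
  assumes flat: "flat A D" and parallel: "parallel_endo A D P"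
  shows "integrable_triple TA (J1, J2, J3)"
proof -
  have "nijenhuis TA 1 J1 U V t = 0 \<and> nijenhuis TA (- 1) J2 U V t = 0 \<and> nijenhuis TA (- 1) J3 U V t = 0"
    if U: "vector_field TA U" and V: "vector_field TA V" for U V t
  proof (cases "t \<in> carrier TA")
    case False
    then show ?thesis
      using tangent_outside_carrier TM.nijenhuis_tangent J1 J2 J3 U V by metis
  next
    case True
    obtain p w where t: "t = (p, w)" by (cases t)
    have tw: "(p, w) \<in> carrier TA" and p: "p \<in> carrier A" and w: "w \<in> tangent_space A p"
      using True by (simp_all add: t carrier_tangent_bundle)
    obtain W where W: "vector_field A W" "W p = w" by (rule vector_field_through[OF w])
    have rep: "\<exists>X Y. vector_field A X \<and> vector_field A Y \<and> Z (p, w) = lift_field X Y (p, w)"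
      if Z: "vector_field TA Z" for Z
    proof -
      obtain a k where a: "a \<in> tangent_space A p" and k: "k \<in> tangent_space A p" and eq: "Z (p, w) = lift (p, w) a k"
        by (rule lift_cases[OF tw TM.vector_field_tangent[OF Z]])
      obtain X where X: "vector_field A X" "X p = a" by (rule vector_field_through[OF a])
      obtain Y where Y: "vector_field A Y" "Y p = k" by (rule vector_field_through[OF k])
      show ?thesis using X Y eq by (intro exI[of _ X] exI[of _ Y] conjI) simp_all
    qed
    obtain X1 Y1 where 1: "vector_field A X1" "vector_field A Y1" "U (p, w) = lift_field X1 Y1 (p, w)"
      using rep[OF U] by blast
    obtain X2 Y2 where 2: "vector_field A X2" "vector_field A Y2" "V (p, w) = lift_field X2 Y2 (p, w)"
      using rep[OF V] by blast
    have pw: "nijenhuis TA \<epsilon> J U V (p, w) = nijenhuis TA \<epsilon> J (lift_field X1 Y1) (lift_field X2 Y2) (p, w)"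
      if "endo_field TA J" "\<And>\<zeta>. \<zeta> \<in> tangent_space TA (p, w) \<Longrightarrow> J (p, w) (J (p, w) \<zeta>) = (\<lambda>d. - (\<epsilon> *\<^sub>R \<zeta> d))" for J \<epsilon>
      by (rule TM.nijenhuis_pointwise[OF that U V vector_field_lift[OF 1(1,2)] vector_field_lift[OF 2(1,2)] 1(3) 2(3)])
    have "nijenhuis TA 1 J1 U V (p, w) = 0"
      by (subst pw[OF J1]) (use nijenhuis_lift_field_zero(1)[OF p W(1) flat parallel 1(1,2) 2(1,2)] W(2) in
          \<open>simp_all add: J_squares fun_Compl_def\<close>)
    moreover have "nijenhuis TA (- 1) J2 U V (p, w) = 0"
      by (subst pw[OF J2]) (use nijenhuis_lift_field_zero(2)[OF p W(1) flat parallel 1(1,2) 2(1,2)] W(2) in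
          \<open>simp_all add: J_squares\<close>)
    moreover have "nijenhuis TA (- 1) J3 U V (p, w) = 0"
      by (subst pw[OF J3]) (use nijenhuis_lift_field_zero(3)[OF p W(1) flat parallel 1(1,2) 2(1,2)] W(2) in
          \<open>simp_all add: J_squares\<close>)
    ultimately show ?thesis by (simp add: t)
  qed
  then show ?thesis by (auto simp: integrable_triple_def fun_eq_iff)
qed

end

theorem theorem3p5:
  fixes A :: "('m, 'e::euclidean_space) atlas"
    and P :: "('m, 'e) endo"
    and g :: "('m, 'e) bilinear_field"
    and D :: "('m, 'e) connection"
    and K :: "('m, 'e) connector"
    and J1 J2 J3 :: "(('m, 'e) tpoint, 'e \<times> 'e) endo"
  assumes "almost_para_hermitian A P g"
    and "levi_civita A g D"
    and "connection_map A D K"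
    and "endo_field (tangent_bundle A) J1"
    and "endo_field (tangent_bundle A) J2"
    and "endo_field (tangent_bundle A) J3"
    and "\<And>X. vector_field A X \<Longrightarrow>
           endo_apply J1 (horizontal_lift A K X) = vertical_lift A K X \<and>
           endo_apply J1 (vertical_lift A K X) = - horizontal_lift A K X"
    and "\<And>X. vector_field A X \<Longrightarrow>
           endo_apply J2 (horizontal_lift A K X) = vertical_lift A K (endo_apply P X) \<and>
           endo_apply J2 (vertical_lift A K X) = horizontal_lift A K (endo_apply P X)"
    and "\<And>X. vector_field A X \<Longrightarrow>
           endo_apply J3 (horizontal_lift A K X) = horizontal_lift A K (endo_apply P X) \<and>
           endo_apply J3 (vertical_lift A K X) = - vertical_lift A K (endo_apply P X)"
  shows "almost_para_hypercomplex (tangent_bundle A) (J1, J2, J3) \<and>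
         (integrable_triple (tangent_bundle A) (J1, J2, J3) \<longleftrightarrow>
            para_kahler A P g D \<and> flat A D)"
proof -
  have mfd: "smooth_manifold A" using assms(1) by (simp add: almost_para_hermitian_def)
  interpret smooth_atlas A by (rule smooth_manifold_imp_smooth_atlas[OF mfd])
  interpret lifted_triple A D K P g J1 J2 J3
  proof unfold_locales
    show "Hausdorff_space (manifold_topology A)" using mfd by (simp add: smooth_manifold_def)
    show "affine_connection A D" using assms(2) by (simp add: levi_civita_def)
  qed (fact assms)+
  have "integrable_triple (tangent_bundle A) (J1, J2, J3) \<longleftrightarrow> flat A D \<and> parallel_endo A D P"
    using integrable_imp_flat_parallel flat_parallel_imp_integrable by blast
  then show ?thesis
    using para_hypercomplex assms(1,2) by (auto simp: para_kahler_def)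
qed

end
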